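(* Let $1\le p<\infty$ and let $\mu:\mathbb{R}\to\mathbb{R}$ be a function such that: $\mu(t)\ge1$ for $t\in\mathbb{R}$; $\mu$ is even and monotonically nondecreasing for $t>0$; $\mu(t+s)\le\mu(t)\mu(s)$ for all $s,t\in\mathbb{R}$; and $\int_{-\infty}^{\infty}\frac{\ln\mu(t)}{1+t^2}\,dt<\infty$. Let $\omega(t)$, $t\in\mathbb{R}_+=[0,\infty)$, be a (real-valued) function of the type of a module of continuity, meaning that the following conditions are satisfied: (1) $\omega$ is continuous and nondecreasing for $t\in\mathbb{R}_+$; (2) $\omega(0)=0$; (3) there is $c>0$ such that $\omega(2t)\le c\,\omega(t)$ for all $t\in[0,1]$; (4) $\int_0^1\frac{\omega(t)}{t}\,dt<\infty$. If, for $f\in L_p(\mathbb{R},\mu^p)$, there exist $n\in\mathbb{N}$ and $m>0$ such that $$\mathcal{E}_r(f)\le\frac{m}{r^n}\,\omega\left(\frac1r\right)\qquad\text{for all } r\ge1,$$ then $f\in W_p^n(\mathbb{R},\mu^p)$ and for every $k\in\mathbb{N}$ there exists $m_k>0$ such that $$\omega_k(t,f^{(n)})\le m_k\left(t^k\int_t^1\frac{\omega(u)}{u^{k+1}}\,du+\int_0^t\frac{\omega(u)}{u}\,du\right),\qquad 0<t\le\frac12.$$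
   Context: $L_p(\mathbb{R},\mu^p)$ is the Banach space of (complex-valued, measurable) functions $f$ on $\mathbb{R}$ with $\|f\|^p_{L_p(\mathbb{R},\mu^p)}=\int_{-\infty}^{\infty}|f(s)|^p\mu^p(s)\,ds<\infty$. $B_r$ denotes the set of (restrictions to $\mathbb{R}$ of) entire functions of exponential type $r$, i.e. entire $g$ such that for every $\epsilon>0$ there is $C_\epsilon>0$ with $|g(z)|\le C_\epsilon e^{(r+\epsilon)|z|}$ for all $z\in\mathbb{C}$. The best approximation is $\mathcal{E}_r(f)=\inf\{\|f-g\|_{L_p(\mathbb{R},\mu^p)}: g\in B_r\cap L_p(\mathbb{R},\mu^p)\}$, $r>0$. $W_p^n(\mathbb{R},\mu^p)$ is the weighted Sobolev space, i.e. the domain of $A^n$ where $A=\frac{d}{dx}$ with $\mathcal{D}(A)=\{x\in L_p(\mathbb{R},\mu^p)\cap AC(\mathbb{R}): x'\in L_p(\mathbb{R},\mu^p)\}$, with $AC(\mathbb{R})$ the (locally) absolutely continuous functions on $\mathbb{R}$; thus $f, f',\dots,f^{(n-1)}$ are locally absolutely continuous and $f,f',\dots,f^{(n)}\in L_p(\mathbb{R},\mu^p)$. The $k$-th module of continuity of $g\in L_p(\mathbb{R},\mu^p)$ is $\omega_k(t,g)=\sup_{0\le h\le t}\left\|\sum_{j=0}^k(-1)^{k-j}\binom{k}{j}g(\cdot+jh)\right\|_{L_p(\mathbb{R},\mu^p)}$, $t\ge0$. $\mathbb{N}=\{1,2,\dots\}$.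
   Formalization: The estimate for ω_k(t, f^(n)) is claimed only when ω is not identically zero on [0,1]; for ω vanishing there it fails (e.g. μ=1, p=1, f(x)=(sin(x/2)/(x/2))^2). The claim f ∈ W_p^n is kept in all cases. *)

theory Defs
  imports "HOL-Analysis.Analysis"
begin

definition weight :: "(real \<Rightarrow> real) \<Rightarrow> bool" where
  "weight \<mu> \<longleftrightarrow>
     (\<forall>t. 1 \<le> \<mu> t) \<and>
     (\<forall>t. \<mu> (- t) = \<mu> t) \<and>
     mono_on {0<..} \<mu> \<and>
     (\<forall>s t. \<mu> (t + s) \<le> \<mu> t * \<mu> s) \<and>
     integrable lebesgue (\<lambda>t. ln (\<mu> t) / (1 + t\<^sup>2))"

text \<open>Elements of \<open>L\<^sub>p(\<real>, \<mu>\<^sup>p)\<close> are represented by functions; functions that agree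
  almost everywhere are not identified.\<close>

definition Lp_space :: "real \<Rightarrow> (real \<Rightarrow> real) \<Rightarrow> (real \<Rightarrow> complex) set" where
  "Lp_space p \<mu> =
     {f. f \<in> borel_measurable lebesgue \<and>
         integrable lebesgue (\<lambda>s. norm (f s) powr p * \<mu> s powr p)}"

text \<open>Meaningful only on \<^const>\<open>Lp_space\<close>: the Bochner integral of a non-integrable
  function is \<open>0\<close>.\<close>

definition Lp_norm :: "real \<Rightarrow> (real \<Rightarrow> real) \<Rightarrow> (real \<Rightarrow> complex) \<Rightarrow> real" where
  "Lp_norm p \<mu> f = (LINT s|lebesgue. norm (f s) powr p * \<mu> s powr p) powr (1 / p)"

definition entire_exp_type :: "real \<Rightarrow> (complex \<Rightarrow> complex) \<Rightarrow> bool" where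
  "entire_exp_type r g \<longleftrightarrow>
     g holomorphic_on UNIV \<and>
     (\<forall>\<epsilon>>0. \<exists>C>0. \<forall>z. norm (g z) \<le> C * exp ((r + \<epsilon>) * norm z))"

definition B_space :: "real \<Rightarrow> (real \<Rightarrow> complex) set" where
  "B_space r = {\<lambda>s. g (complex_of_real s) | g. entire_exp_type r g}"

definition best_approx :: "real \<Rightarrow> (real \<Rightarrow> real) \<Rightarrow> real \<Rightarrow> (real \<Rightarrow> complex) \<Rightarrow> real" where
  "best_approx p \<mu> r f = (INF g \<in> B_space r \<inter> Lp_space p \<mu>. Lp_norm p \<mu> (\<lambda>s. f s - g s))"

definition locally_AC :: "(real \<Rightarrow> complex) \<Rightarrow> bool" where
  "locally_AC F \<longleftrightarrow>
     (\<forall>a b. \<forall>\<epsilon>>0. \<exists>\<delta>>0. \<forall>(N::nat) u v.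
        (\<forall>i<N. a \<le> u i \<and> u i \<le> v i \<and> v i \<le> b) \<and>
        disjoint_family_on (\<lambda>i. {u i<..<v i}) {..<N} \<and>
        (\<Sum>i<N. v i - u i) < \<delta>
        \<longrightarrow> (\<Sum>i<N. norm (F (v i) - F (u i))) < \<epsilon>)"

text \<open>The graph of \<open>A = d/dx\<close>. It is closed under changing either component on a null set:
  \<open>x\<close> is only required to have a locally absolutely continuous representative \<open>F\<close>, whose
  derivative exists almost everywhere and represents \<open>y\<close>.\<close>

definition deriv_graph ::
    "real \<Rightarrow> (real \<Rightarrow> real) \<Rightarrow> ((real \<Rightarrow> complex) \<times> (real \<Rightarrow> complex)) set" where
  "deriv_graph p \<mu> =
     {(x, y). x \<in> Lp_space p \<mu> \<and> y \<in> Lp_space p \<mu> \<and>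
        (\<exists>F. locally_AC F \<and>
             (AE s in lebesgue. F s = x s) \<and>
             (AE s in lebesgue. (F has_vector_derivative y s) (at s)))}"

text \<open>\<open>(f, g) \<in> (deriv_graph p \<mu>) ^^ n\<close> says that \<open>f\<close> lies in the domain of \<open>A\<^sup>n\<close> and that
  \<open>g\<close> represents \<open>A\<^sup>n f\<close>, the \<open>n\<close>-th derivative of \<open>f\<close>.\<close>

definition weighted_Sobolev :: "real \<Rightarrow> (real \<Rightarrow> real) \<Rightarrow> nat \<Rightarrow> (real \<Rightarrow> complex) set" where
  "weighted_Sobolev p \<mu> n = Lp_space p \<mu> \<inter> Domain (deriv_graph p \<mu> ^^ n)"

definition modulus_of_continuity ::
    "real \<Rightarrow> (real \<Rightarrow> real) \<Rightarrow> nat \<Rightarrow> real \<Rightarrow> (real \<Rightarrow> complex) \<Rightarrow> real" where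
  "modulus_of_continuity p \<mu> k t g =
     (SUP h\<in>{0..t}. Lp_norm p \<mu>
        (\<lambda>s. \<Sum>j=0..k. (-1) ^ (k - j) * of_nat (k choose j) * g (s + real j * h)))"

text \<open>Only the values on \<open>[0, \<infinity>)\<close> matter. A function vanishing identically on \<open>[0, 1]\<close>
  satisfies all the conditions.\<close>

definition modulus_type :: "(real \<Rightarrow> real) \<Rightarrow> bool" where
  "modulus_type \<omega> \<longleftrightarrow>
     continuous_on {0..} \<omega> \<and> mono_on {0..} \<omega> \<and>
     \<omega> 0 = 0 \<and>
     (\<exists>c>0. \<forall>t\<in>{0..1}. \<omega> (2 * t) \<le> c * \<omega> t) \<and>
     set_integrable lebesgue {0<..1} (\<lambda>t. \<omega> t / t)"

end

theory Submission
  imports Defs "HOL-Complex_Analysis.Complex_Analysis"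
begin

text \<open>
  This is the inverse theorem of approximation theory in Bernstein's form. Choose entire
  functions \<open>G\<^sub>j\<close> of exponential type \<open>2^j\<close> whose distance to \<open>f\<close> is at most a constant times
  \<open>2^(-nj) \<omega>(2^(-j))\<close>. The differences \<open>Q\<^sub>j = G\<^sub>j\<^sub>+\<^sub>1 - G\<^sub>j\<close> are equally small, and the Bernstein
  inequality \<open>\<parallel>u'\<parallel> \<le> C r \<parallel>u\<parallel>\<close> for \<open>u\<close> of type \<open>r \<ge> 1\<close> bounds the \<open>l\<close>-th derivative of \<open>Q\<^sub>j\<close> by a
  constant times \<open>2^((l-n)j) \<omega>(2^(-j))\<close>. For \<open>l \<le> n\<close> these bounds are summable, because
  \<open>\<Sum> \<omega>(2^(-j))\<close> is comparable to \<open>\<integral>\<^sub>0\<^sup>1 \<omega>(u)/u du\<close>. So the telescoping series of \<open>f\<close> may be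
  differentiated \<open>n\<close> times, and since differentiation is a closed operator the sums are the
  derivatives of \<open>f\<close> (\<open>dyadic_synthesis\<close>). For a \<open>k\<close>-th difference of step \<open>h \<le> t\<close> of
  \<open>f\<^sup>(\<^sup>n\<^sup>)\<close>, cut the series at the scale \<open>2^(-N)\<close> of \<open>t\<close>: each term beyond the cut is estimated by
  its norm, each term before it by \<open>h^k\<close> times the norm of its \<open>k\<close>-th derivative. The two resulting
  sums compare with the two integrals of the claim (\<open>modulus_type_dyadic\<close>).

  The analytic core is the Bernstein inequality for the weighted norm (\<open>bernstein\<close>). Convergence of
  the logarithmic integral of \<open>\<mu>\<close> yields an entire function \<open>\<phi>\<close> of exponential type with \<open>\<phi>(0) = 1\<close>
  and \<open>|\<phi>| \<mu>\<close> bounded on the real line, a product of powers of \<open>sin(bz)/(bz)\<close>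
  (\<open>weight_multiplier_exists\<close>). Pair \<open>g\<close> of type \<open>r\<close> with a test function \<open>h\<close> of dual norm at most 1
  and set \<open>F(z) = \<phi>(z) \<integral> g(x + z/r) h(x) dx\<close>. A translation by \<open>t\<close> costs a factor \<open>\<mu>(t)\<close>, so \<open>F\<close>
  is bounded on the real line by a multiple of \<open>\<parallel>g\<parallel>\<close>, and its exponential type is bounded
  independently of \<open>r\<close>, \<open>g\<close> and \<open>h\<close>. By Phragmen-Lindelof and Cauchy, \<open>F'(0)\<close> is bounded by a multiple
  of \<open>\<parallel>g\<parallel>\<close> (\<open>phragmen_lindelof_deriv\<close>), and up to a multiple of \<open>F(0)\<close> it is \<open>1/r\<close> times the
  pairing of \<open>g'\<close> with \<open>h\<close>. Duality concludes.

  Closedness of differentiation (\<open>deriv_graph_limit\<close>) contains the Lebesgue differentiation theorem: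
  the last derivative \<open>f\<^sup>(\<^sup>n\<^sup>)\<close> is only locally integrable. It follows from a maximal inequality,
  with the derivatives of the approximants as the approximating continuous functions.
\<close>

section \<open>A Phragmen-Lindelof bound\<close>

text \<open>In the sector \<open>0 \<le> Im z \<le> |Re z|/2\<close> the real part of \<open>z\<^sup>2\<close> is at least \<open>3/4 |Re z|\<^sup>2\<close>. Hence
\<open>F(z) exp(-\<epsilon> z\<^sup>2)\<close> tends to 0 at infinity, whatever the exponential type of \<open>F\<close>, and the maximum
principle on large triangles applies. The sign \<open>s\<close> selects the right or the left sector.\<close>

lemma sector_bound:
  fixes F :: "complex \<Rightarrow> complex" and s :: real
  assumes hol: "F holomorphic_on UNIV" and s: "\<bar>s\<bar> = 1" and M: "0 < M" and tau: "0 \<le> \<tau>" "0 < K"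
    and growth: "\<And>z. norm (F z) \<le> K * exp (\<tau> * norm z)"
    and axis: "\<And>t. norm (F (of_real t)) \<le> M"
    and edge: "\<And>z. Im z = s * Re z / 2 \<Longrightarrow> 0 \<le> Im z \<Longrightarrow> norm (F z) \<le> M"
    and z: "0 \<le> Im z" "Im z \<le> s * Re z / 2"
  shows "norm (F z) \<le> M"
proof -
  have cont: "continuous_on UNIV F"
    using hol by (rule holomorphic_on_imp_continuous_on)
  have bound: "norm (F z) \<le> M * exp (\<epsilon> * Re (z^2))" if \<epsilon>: "0 < \<epsilon>" for \<epsilon>
  proof -
    \<comment> \<open>On the side \<open>s * Re w = R\<close> of the triangle, \<open>|w| \<le> 3/2 R\<close> and \<open>Re (w\<^sup>2) \<ge> 3/4 R\<^sup>2\<close>.\<close>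
    have "((\<lambda>R. K * exp (\<tau> * (3/2 * R) - \<epsilon> * (3/4 * R^2))) \<longlongrightarrow> 0) at_top"
      using \<epsilon> by real_asymp
    then have "\<forall>\<^sub>F R in at_top. K * exp (\<tau> * (3/2 * R) - \<epsilon> * (3/4 * R^2)) < M"
      using M by (rule order_tendstoD)
    then have "\<forall>\<^sub>F R in at_top. K * exp (\<tau> * (3/2 * R) - \<epsilon> * (3/4 * R^2)) < M \<and> s * Re z \<le> R \<and> 0 \<le> R"
      by (intro eventually_conj eventually_ge_at_top)
    then obtain R where R: "K * exp (\<tau> * (3/2 * R) - \<epsilon> * (3/4 * R^2)) < M" "s * Re z \<le> R" "0 \<le> R"
      by (auto simp: eventually_at_top_linorder)
    define S where "S = {z::complex. 0 \<le> Im z \<and> Im z \<le> s * Re z / 2 \<and> s * Re z \<le> R}"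
    have "closed S"
      unfolding S_def by (intro closed_Collect_conj closed_Collect_le continuous_intros) simp_all
    have "bounded S"
    proof (rule boundedI[of _ "R + R"])
      fix w assume w: "w \<in> S"
      have "\<bar>Re w\<bar> = \<bar>s * Re w\<bar>" using s by (simp add: abs_mult)
      then show "norm w \<le> R + R"
        using w cmod_le[of w] R by (auto simp: S_def)
    qed
    have "norm (F z * exp (- of_real \<epsilon> * z^2)) \<le> M"
    proof (rule maximum_modulus_frontier[of "\<lambda>z. F z * exp (- of_real \<epsilon> * z^2)" S])
      show "(\<lambda>z. F z * exp (- of_real \<epsilon> * z^2)) holomorphic_on interior S"
        by (intro holomorphic_intros holomorphic_on_subset[OF hol]) auto
      show "continuous_on (closure S) (\<lambda>z. F z * exp (- of_real \<epsilon> * z^2))"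
        by (intro continuous_intros continuous_on_subset[OF cont]) auto
      show "z \<in> S" using z R by (simp add: S_def)
      fix w assume w: "w \<in> frontier S"
      then have wS: "w \<in> S"
        using \<open>closed S\<close> frontier_subset_closed by blast
      have sx: "\<bar>Re w\<bar> = s * Re w"
        using wS s by (cases "s = 1") (auto simp: S_def abs_if split: if_splits)
      have re: "Re (w^2) \<ge> 3/4 * (s * Re w)^2"
      proof -
        have "(Im w)^2 \<le> (s * Re w / 2)^2"
          using wS by (intro power_mono) (auto simp: S_def)
        moreover have "(s * Re w)^2 = (Re w)^2" using sx by (metis power2_abs)
        ultimately show ?thesis unfolding Re_power2 by (simp only: power_divide) simp
      qed
      have ne: "norm (exp (- of_real \<epsilon> * w^2)) = exp (- \<epsilon> * Re (w^2))"
        by (simp add: norm_exp_eq_Re)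
      have ne1: "norm (exp (- of_real \<epsilon> * w^2)) \<le> 1"
      proof -
        have "0 \<le> Re (w^2)" using re by (rule order_trans[rotated]) simp
        then show ?thesis unfolding ne using \<epsilon> by (simp del: power2_eq_square)
      qed
      have "Im w = 0 \<or> Im w = s * Re w / 2 \<or> s * Re w = R"
      proof (rule ccontr)
        assume "\<not> ?thesis"
        with wS have "w \<in> {z. 0 < Im z} \<inter> {z. Im z < s * Re z / 2} \<inter> {z. s * Re z < R}"
          by (auto simp: S_def)
        moreover have "open ({z::complex. 0 < Im z} \<inter> {z. Im z < s * Re z / 2} \<inter> {z. s * Re z < R})"
          by (intro open_Int open_Collect_less continuous_intros) simp_all
        moreover have "{z::complex. 0 < Im z} \<inter> {z. Im z < s * Re z / 2} \<inter> {z. s * Re z < R} \<subseteq> S"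
          by (auto simp: S_def)
        ultimately have "w \<in> interior S" using interiorI by blast
        with w show False by (simp add: frontier_def)
      qed
      then consider "Im w = 0" | "Im w = s * Re w / 2" | "s * Re w = R" by blast
      then show "norm (F w * exp (- of_real \<epsilon> * w^2)) \<le> M"
      proof cases
        case 1
        then have "w = of_real (Re w)" by (simp add: complex_eq_iff)
        then have "norm (F w) \<le> M" using axis by metis
        then show ?thesis
          using mult_mono[OF _ ne1, of "norm (F w)" M] M by (simp add: norm_mult)
      next
        case 2
        then have "norm (F w) \<le> M" using edge wS by (simp add: S_def)
        then show ?thesis
          using mult_mono[OF _ ne1, of "norm (F w)" M] M by (simp add: norm_mult)
      next
        case 3
        have "norm w \<le> 3/2 * R"
          using cmod_le[of w] sx 3 wS by (auto simp: S_def)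
        then have "norm (F w) \<le> K * exp (\<tau> * (3/2 * R))"
          using growth[of w] tau by (smt (verit) exp_le_cancel_iff mult_left_mono)
        moreover have "exp (- \<epsilon> * Re (w^2)) \<le> exp (- \<epsilon> * (3/4 * R^2))"
          using re 3 \<epsilon> by simp
        ultimately have "norm (F w * exp (- of_real \<epsilon> * w^2))
           \<le> K * exp (\<tau> * (3/2 * R)) * exp (- \<epsilon> * (3/4 * R^2))"
          unfolding norm_mult ne using tau by (intro mult_mono) auto
        also have "\<dots> = K * exp (\<tau> * (3/2 * R) - \<epsilon> * (3/4 * R^2))"
          by (simp only: mult.assoc exp_add[symmetric]) simp
        finally show ?thesis using R(1) by simp
      qed
    qed (use \<open>bounded S\<close> in auto)
    then have "norm (F z) * exp (- \<epsilon> * Re (z^2)) \<le> M"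
      by (simp add: norm_mult norm_exp_eq_Re)
    then have "norm (F z) * exp (- \<epsilon> * Re (z^2)) * exp (\<epsilon> * Re (z^2)) \<le> M * exp (\<epsilon> * Re (z^2))"
      by (rule mult_right_mono) simp
    then show ?thesis by (simp add: mult.assoc flip: exp_add)
  qed
  have "((\<lambda>\<epsilon>. M * exp (\<epsilon> * Re (z^2))) \<longlongrightarrow> M * exp (0 * Re (z^2))) (at_right 0)"
    by (intro tendsto_intros)
  then show ?thesis
    using bound by (intro tendsto_lowerbound[of "\<lambda>\<epsilon>. M * exp (\<epsilon> * Re (z^2))" M "at_right 0"])
       (auto simp: eventually_at_right_less intro: eventually_at_rightI[of 0 1])
qed

text \<open>Dividing a bounded function by \<open>1 - i\<epsilon>z\<close>, whose modulus in the upper half-plane is at least 1 and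
tends to infinity, makes it small on the far sides of a large rectangle; then \<open>\<epsilon>\<close> tends to 0.\<close>

lemma halfplane_bound:
  fixes F :: "complex \<Rightarrow> complex"
  assumes hol: "F holomorphic_on UNIV" and C: "0 < C"
    and M: "\<And>z. 0 \<le> Im z \<Longrightarrow> norm (F z) \<le> M"
    and axis: "\<And>t. norm (F (of_real t)) \<le> C"
    and z: "0 \<le> Im z"
  shows "norm (F z) \<le> C"
proof -
  have cont: "continuous_on UNIV F"
    using hol by (rule holomorphic_on_imp_continuous_on)
  have "0 \<le> M" using M[of 0] by (simp add: order_trans[OF norm_ge_zero])
  have bound: "norm (F z) \<le> C * norm (1 - \<i> * of_real \<epsilon> * z)" if \<epsilon>: "0 < \<epsilon>" for \<epsilon>
  proof -
    define R where "R = max (M / (\<epsilon> * C)) (norm z)"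
    have R: "M \<le> C * (\<epsilon> * R)" "norm z \<le> R"
      using C \<epsilon> by (auto simp: R_def field_simps max_def split: if_splits)
    define S where "S = {z::complex. 0 \<le> Im z \<and> Im z \<le> R \<and> -R \<le> Re z \<and> Re z \<le> R}"
    define D where "D = (\<lambda>w. 1 - \<i> * of_real \<epsilon> * w)"
    have Re_D: "Re (D w) = 1 + \<epsilon> * Im w" and Im_D: "Im (D w) = - (\<epsilon> * Re w)" for w
      by (auto simp: D_def)
    have D_ge: "1 + \<epsilon> * Im w \<le> norm (D w)" "\<epsilon> * \<bar>Re w\<bar> \<le> norm (D w)" for w
      using complex_Re_le_cmod[of "D w"] abs_Im_le_cmod[of "D w"] \<epsilon>
      unfolding Re_D Im_D by (auto simp: abs_mult)
    have D_ge1: "1 \<le> norm (D w)" if "0 \<le> Im w" for w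
      using D_ge(1)[of w] that \<epsilon> by (smt (verit) mult_nonneg_nonneg)
    have "closed S"
      unfolding S_def by (intro closed_Collect_conj closed_Collect_le continuous_intros)
    have "bounded S"
    proof (rule boundedI[of _ "R + R"])
      fix w assume "w \<in> S"
      then show "norm w \<le> R + R"
        using cmod_le[of w] by (auto simp: S_def)
    qed
    have "norm (F z / D z) \<le> C"
    proof (rule maximum_modulus_frontier[of "\<lambda>z. F z / D z" S])
      have nz: "D w \<noteq> 0" if "w \<in> S" for w
        using D_ge1[of w] that by (auto simp: S_def)
      show "(\<lambda>z. F z / D z) holomorphic_on interior S"
        using nz interior_subset[of S]
        by (intro holomorphic_intros holomorphic_on_subset[OF hol]) (auto simp: D_def intro!: holomorphic_intros)
      show "continuous_on (closure S) (\<lambda>z. F z / D z)"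
        using nz \<open>closed S\<close>
        by (intro continuous_intros continuous_on_subset[OF cont]) (auto simp: D_def intro!: continuous_intros)
      show "z \<in> S" using R(2) z abs_Re_le_cmod[of z] abs_Im_le_cmod[of z] by (auto simp: S_def)
      fix w assume w: "w \<in> frontier S"
      then have wS: "w \<in> S"
        using \<open>closed S\<close> frontier_subset_closed by blast
      then have D1: "1 \<le> norm (D w)" and FM: "norm (F w) \<le> M" by (auto simp: S_def intro: D_ge1 M)
      have "Im w = 0 \<or> Im w = R \<or> \<bar>Re w\<bar> = R"
      proof (rule ccontr)
        assume "\<not> ?thesis"
        with wS have "w \<in> {z. 0 < Im z} \<inter> {z. Im z < R} \<inter> {z. -R < Re z} \<inter> {z. Re z < R}"
          by (auto simp: S_def)
        moreover have "open ({z::complex. 0 < Im z} \<inter> {z. Im z < R} \<inter> {z. -R < Re z} \<inter> {z. Re z < R})"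
          by (intro open_Int open_Collect_less continuous_intros)
        moreover have "{z::complex. 0 < Im z} \<inter> {z. Im z < R} \<inter> {z. -R < Re z} \<inter> {z. Re z < R} \<subseteq> S"
          by (auto simp: S_def)
        ultimately have "w \<in> interior S" using interiorI by blast
        with w show False by (simp add: frontier_def)
      qed
      then consider "Im w = 0" | "Im w = R \<or> \<bar>Re w\<bar> = R" by blast
      then have "norm (F w) \<le> C * norm (D w)"
      proof cases
        case 1
        then have "w = of_real (Re w)" by (simp add: complex_eq_iff)
        then have "norm (F w) \<le> C" using axis by metis
        then show ?thesis using D1 C by (smt (verit) mult_le_cancel_left1)
      next
        case 2
        then have "\<epsilon> * R \<le> norm (D w)"
          using D_ge[of w] by auto
        then have "C * (\<epsilon> * R) \<le> C * norm (D w)" using C by simp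
        then show ?thesis using FM R(1) by linarith
      qed
      then show "norm (F w / D w) \<le> C"
        using D1 C by (auto simp: norm_divide divide_le_eq)
    qed (use \<open>bounded S\<close> in auto)
    then show ?thesis
      using D_ge1[OF z] by (simp add: norm_divide divide_le_eq D_def split: if_splits)
  qed
  have "((\<lambda>\<epsilon>. C * norm (1 - \<i> * of_real \<epsilon> * z)) \<longlongrightarrow> C * norm (1 - \<i> * of_real 0 * z)) (at_right 0)"
    by (intro tendsto_intros)
  then show ?thesis
    using bound by (intro tendsto_lowerbound[of "\<lambda>\<epsilon>. C * norm (1 - \<i> * of_real \<epsilon> * z)" C "at_right 0"])
       (auto intro: eventually_at_rightI[of 0 1])
qed

text \<open>Multiplication by \<open>exp(3i\<tau>z)\<close> absorbs the growth where \<open>|Re z| \<le> 2 Im z\<close>, since there \<open>|z| \<le> 3 Im z\<close>.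
The two remaining sectors are those of \<open>sector_bound\<close>, so the product is bounded in the half-plane. The
exponent \<open>3\<tau>\<close> in place of \<open>\<tau>\<close> is the price of using sectors in which \<open>exp(-\<epsilon>z\<^sup>2)\<close> decays.\<close>

lemma phragmen_lindelof_upper:
  fixes H :: "complex \<Rightarrow> complex"
  assumes hol: "H holomorphic_on UNIV" and C: "0 < C" and tau: "0 \<le> \<tau>" "0 < K"
    and growth: "\<And>z. norm (H z) \<le> K * exp (\<tau> * norm z)"
    and axis: "\<And>t. norm (H (of_real t)) \<le> C"
    and z: "0 \<le> Im z"
  shows "norm (H z) \<le> C * exp (3 * \<tau> * Im z)"
proof -
  define F where "F = (\<lambda>z. H z * exp (\<i> * of_real (3 * \<tau>) * z))"
  have nF: "norm (F z) = norm (H z) * exp (- (3 * \<tau> * Im z))" for z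
    by (simp add: F_def norm_mult norm_exp_eq_Re)
  have holF: "F holomorphic_on UNIV"
    unfolding F_def by (intro holomorphic_intros hol)
  have FC: "norm (F (of_real t)) \<le> C" for t
    using axis by (simp add: nF)
  have steep: "norm (F z) \<le> K" if "0 \<le> Im z" "\<bar>Re z\<bar> \<le> 2 * Im z" for z
  proof -
    have "norm z \<le> 3 * Im z" using cmod_le[of z] that by auto
    then have "\<tau> * norm z \<le> \<tau> * (3 * Im z)" using tau by (intro mult_left_mono) auto
    have "norm (F z) \<le> K * exp (\<tau> * norm z) * exp (- (3 * \<tau> * Im z))"
      unfolding nF by (intro mult_right_mono growth) auto
    also have "\<dots> = K * exp (\<tau> * norm z - 3 * \<tau> * Im z)"
      by (simp add: exp_diff exp_minus field_simps)
    also have "\<dots> \<le> K * 1"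
      using tau \<open>\<tau> * norm z \<le> _\<close> by (intro mult_left_mono) auto
    finally show ?thesis by simp
  qed
  have growthF: "norm (F z) \<le> K * exp (4 * \<tau> * norm z)" for z
  proof -
    have "- (\<tau> * Im z) \<le> \<tau> * norm z"
      using tau abs_Im_le_cmod[of z] mult_left_mono[of "- Im z" "norm z" \<tau>] by auto
    then have "exp (- (3 * \<tau> * Im z)) \<le> exp (3 * \<tau> * norm z)" by simp
    then have "norm (F z) \<le> K * exp (\<tau> * norm z) * exp (3 * \<tau> * norm z)"
      unfolding nF using tau by (intro mult_mono growth) auto
    also have "\<dots> = K * exp (4 * \<tau> * norm z)"
      by (simp add: mult.assoc flip: exp_add)
    finally show ?thesis .
  qed
  have "norm (F z) \<le> max C K" if z: "0 \<le> Im z" for z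
  proof (cases "\<bar>Re z\<bar> \<le> 2 * Im z")
    case True
    then show ?thesis using steep[OF z True] by simp
  next
    case False
    define s :: real where "s = (if Re z > 0 then 1 else -1)"
    show ?thesis
    proof (rule sector_bound[of F s "max C K" "4 * \<tau>" K])
      show "norm (F (complex_of_real t)) \<le> max C K" for t
        using FC[of t] by simp
      show "norm (F w) \<le> max C K" if "Im w = s * Re w / 2" "0 \<le> Im w" for w
      proof -
        have "\<bar>Re w\<bar> \<le> 2 * Im w" using that by (auto simp: s_def split: if_splits)
        then show ?thesis using steep[of w] that by simp
      qed
    qed (use holF growthF tau C z False in \<open>auto simp: s_def\<close>)
  qed
  then have "norm (F z) \<le> C"
    by (rule halfplane_bound[OF holF C _ FC z])
  then have "norm (F z) * exp (3 * \<tau> * Im z) \<le> C * exp (3 * \<tau> * Im z)"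
    by (intro mult_right_mono) auto
  then show ?thesis
    by (simp add: nF mult.assoc flip: exp_add)
qed

text \<open>Cauchy's estimate on the unit circle; the lower half-plane is covered by \<open>z \<mapsto> H(-z)\<close>. Working with
\<open>D > C\<close> allows for \<open>C = 0\<close>.\<close>

lemma phragmen_lindelof_deriv:
  fixes H :: "complex \<Rightarrow> complex"
  assumes hol: "H holomorphic_on UNIV" and C: "0 \<le> C" and tau: "0 \<le> \<tau>"
    and growth: "\<And>z. norm (H z) \<le> K * exp (\<tau> * norm z)"
    and axis: "\<And>t. norm (H (of_real t)) \<le> C"
  shows "norm (deriv H 0) \<le> C * exp (3 * \<tau>)"
proof -
  have strict: "norm (deriv H 0) \<le> D * exp (3 * \<tau>)" if D: "C < D" for D
  proof -
    define L where "L = max K 1"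
    have L: "0 < L" by (simp add: L_def)
    have growthL: "norm (H z) \<le> L * exp (\<tau> * norm z)" for z
      by (rule order_trans[OF growth]) (simp add: L_def)
    have axisD: "norm (H (of_real t)) \<le> D" for t using axis[of t] D by simp
    have H: "norm (H z) \<le> D * exp (3 * \<tau> * \<bar>Im z\<bar>)" for z
    proof (cases "0 \<le> Im z")
      case True
      then show ?thesis
        using phragmen_lindelof_upper[OF hol _ tau L growthL axisD True] C D by simp
    next
      case False
      have "(\<lambda>z. H (- z)) holomorphic_on UNIV"
        by (rule holomorphic_on_compose[of uminus UNIV H, unfolded o_def])
          (auto intro!: holomorphic_intros holomorphic_on_subset[OF hol])
      then have "norm (H (- (- z))) \<le> D * exp (3 * \<tau> * Im (- z))"
      proof (rule phragmen_lindelof_upper[where K = L])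
        show "norm (H (- w)) \<le> L * exp (\<tau> * norm w)" for w using growthL[of "- w"] by simp
        show "norm (H (- of_real t)) \<le> D" for t using axisD[of "- t"] by simp
      qed (use C D tau L False in auto)
      then show ?thesis using False by simp
    qed
    have "norm ((deriv ^^ 1) H 0) \<le> fact 1 * (D * exp (3 * \<tau>)) / 1 ^ 1"
    proof (rule Cauchy_inequality)
      show "H holomorphic_on ball 0 1" "continuous_on (cball 0 1) H"
        using hol holomorphic_on_imp_continuous_on holomorphic_on_subset by blast+
      fix w :: complex assume "norm (0 - w) = 1"
      then have "\<bar>Im w\<bar> \<le> 1" using abs_Im_le_cmod[of w] by simp
      then have "3 * \<tau> * \<bar>Im w\<bar> \<le> 3 * \<tau>" using tau by (simp add: mult_left_le)
      then show "norm (H w) \<le> D * exp (3 * \<tau>)"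
        using H[of w] C D by (smt (verit) exp_le_cancel_iff mult_left_mono)
    qed auto
    then show ?thesis by simp
  qed
  have "norm (deriv H 0) / exp (3 * \<tau>) \<le> C"
    by (rule dense_ge) (use strict in \<open>simp add: field_simps\<close>)
  then show ?thesis by (simp add: field_simps)
qed

section \<open>Integrals over disjoint cells\<close>

lemma set_integral_mono_subset:
  fixes f :: "'a \<Rightarrow> real"
  assumes f: "set_integrable M B f" "\<And>x. x \<in> B \<Longrightarrow> 0 \<le> f x" and AB: "A \<in> sets M" "A \<subseteq> B"
  shows "(LINT x:A|M. f x) \<le> (LINT x:B|M. f x)"
  unfolding set_lebesgue_integral_def
proof (rule integral_mono)
  show "integrable M (\<lambda>x. indicat_real A x *\<^sub>R f x)" "integrable M (\<lambda>x. indicat_real B x *\<^sub>R f x)"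
    using f(1) set_integrable_subset[OF f(1) AB] by (auto simp: set_integrable_def)
  show "indicat_real A x *\<^sub>R f x \<le> indicat_real B x *\<^sub>R f x" for x
    using f(2)[of x] AB(2) by (auto simp: indicator_def)
qed

lemma sum_set_integrals_disjoint_le:
  fixes f :: "'a \<Rightarrow> real"
  assumes f: "set_integrable M B f" "\<And>x. x \<in> B \<Longrightarrow> 0 \<le> f x"
    and A: "\<And>i. i \<in> I \<Longrightarrow> A i \<in> sets M \<and> A i \<subseteq> B" "disjoint_family_on A I" "finite I"
  shows "(\<Sum>i\<in>I. LINT x:A i|M. f x) \<le> (LINT x:B|M. f x)"
proof -
  have "(\<Sum>i\<in>I. LINT x:A i|M. f x) = (LINT x:(\<Union>i\<in>I. A i)|M. f x)"
    using A by (intro set_integral_finite_Union[symmetric]) (auto intro: set_integrable_subset[OF f(1)])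
  also have "\<dots> \<le> (LINT x:B|M. f x)"
    using A by (intro set_integral_mono_subset f) auto
  finally show ?thesis .
qed

text \<open>Condensation: a series is summable if its terms are dominated by the integrals of one nonnegative
integrable function over disjoint cells. It is used for the logarithmic integral of the weight and for
the Dini integral of the modulus of continuity.\<close>

lemma set_integrals_disjoint_suminf_le:
  fixes f :: "'a \<Rightarrow> real"
  assumes f: "set_integrable M B f" "\<And>x. x \<in> B \<Longrightarrow> 0 \<le> f x"
    and A: "\<And>i::nat. A i \<in> sets M" "\<And>i. A i \<subseteq> B" "disjoint_family A"
  shows "summable (\<lambda>i. LINT x:A i|M. f x)" "(\<Sum>i. LINT x:A i|M. f x) \<le> (LINT x:B|M. f x)"
proof -
  have le: "(\<Sum>i<n. LINT x:A i|M. f x) \<le> (LINT x:B|M. f x)" for n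
    using A by (intro sum_set_integrals_disjoint_le f) (auto simp: disjoint_family_on_def)
  have nonneg: "0 \<le> (LINT x:A i|M. f x)" for i
    unfolding set_lebesgue_integral_def using f(2) A(2)[of i]
    by (intro integral_nonneg_AE AE_I2) (auto simp: indicator_def)
  show summable: "summable (\<lambda>i. LINT x:A i|M. f x)"
    by (rule summableI_nonneg_bounded[OF nonneg le])
  show "(\<Sum>i. LINT x:A i|M. f x) \<le> (LINT x:B|M. f x)"
    using le by (intro suminf_le_const summable) auto
qed

lemma dyadic_scale:
  fixes x :: real
  assumes "1 \<le> x"
  shows "\<exists>i. 2 ^ i \<le> x \<and> x < 2 ^ (i + 1)"
proof -
  define k where "k = (LEAST k. x < 2 ^ k)"
  have ex: "\<exists>k. x < 2 ^ k" using real_arch_pow[of 2 x] by simp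
  have k: "x < 2 ^ k" unfolding k_def using ex by (rule LeastI_ex)
  have "k \<noteq> 0" using k assms by (cases k) auto
  then obtain i where ki: "k = Suc i" by (cases k) auto
  have "\<not> x < 2 ^ i" using ki not_less_Least[of i "\<lambda>k. x < 2 ^ k"] by (simp add: k_def)
  then show ?thesis using k ki by (intro exI[of _ i]) simp
qed

text \<open>With \<open>min\<close> and \<open>max\<close> for the endpoints the lemma serves cells that tend to infinity and cells that
shrink to 0.\<close>

lemma disjoint_family_Ioc_mono:
  fixes a :: "nat \<Rightarrow> real"
  assumes "mono a \<or> antimono a"
  shows "disjoint_family (\<lambda>i. {min (a i) (a (Suc i))<..max (a i) (a (Suc i))})"
proof -
  have "{min (a i) (a (Suc i))<..max (a i) (a (Suc i))} \<inter> {min (a j) (a (Suc j))<..max (a j) (a (Suc j))} = {}"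
    if "i < j" for i j
  proof -
    have "Suc i \<le> j" using that by simp
    then show ?thesis
      using assms monoD[of a i "Suc i"] monoD[of a j "Suc j"] monoD[of a "Suc i" j]
        antimonoD[of a i "Suc i"] antimonoD[of a j "Suc j"] antimonoD[of a "Suc i" j]
      by auto
  qed
  then show ?thesis unfolding disjoint_family_on_def by (metis Int_commute linorder_neqE_nat)
qed

section \<open>An entire multiplier dominated by the reciprocal weight\<close>

lemma weight_ge_1: "weight \<mu> \<Longrightarrow> 1 \<le> \<mu> t"
  and weight_submult: "weight \<mu> \<Longrightarrow> \<mu> (s + t) \<le> \<mu> s * \<mu> t"
  by (auto simp: weight_def)

text \<open>The case \<open>s = 0\<close> is excluded since a weight is monotone only on the open half-line; that is why \<open>\<mu> 0\<close> is
added to some of the constants below.\<close>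

lemma weight_mono:
  assumes "weight \<mu>" "\<bar>s\<bar> \<le> \<bar>t\<bar>" "s \<noteq> 0"
  shows "\<mu> s \<le> \<mu> t"
proof -
  have abs: "\<mu> \<bar>u\<bar> = \<mu> u" for u
    using assms(1) by (auto simp: weight_def abs_if)
  have "\<mu> \<bar>s\<bar> \<le> \<mu> \<bar>t\<bar>"
    by (rule mono_onD[of "{0<..}" \<mu>]) (use assms in \<open>simp_all add: weight_def\<close>)
  then show ?thesis by (simp add: abs)
qed

text \<open>The cell from \<open>2^(i+1)\<close> to \<open>2^(i+2)\<close> contributes to the logarithmic integral of \<open>\<mu>\<close> at least
\<open>1/16\<close> of the \<open>i\<close>-th term.\<close>

lemma weight_dyadic_summable:
  assumes \<mu>: "weight \<mu>"
  shows "summable (\<lambda>i::nat. ln (\<mu> (2 ^ (i + 1))) / 2 ^ i)"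
proof -
  define f where "f = (\<lambda>t. ln (\<mu> t) / (1 + t\<^sup>2))"
  define A where "A = (\<lambda>i::nat. {2 ^ (i + 1)<..2 ^ (i + 2)} :: real set)"
  have f: "integrable lebesgue f" "0 \<le> f t" for t
    using \<mu> by (auto simp: weight_def f_def)
  have mono: "mono (\<lambda>i::nat. 2 ^ (i + 1) :: real)" by (intro monoI power_increasing) auto
  have "A = (\<lambda>i. {min (2 ^ (i + 1)) (2 ^ (Suc i + 1))<..max (2 ^ (i + 1)) (2 ^ (Suc i + 1))})"
    by (simp add: A_def fun_eq_iff)
  then have disj: "disjoint_family A"
    using disjoint_family_Ioc_mono[of "\<lambda>i. 2 ^ (i + 1)"] mono by simp
  have "summable (\<lambda>i. LINT x:A i|lebesgue. f x)"
    by (rule set_integrals_disjoint_suminf_le[of _ UNIV])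
      (use f disj in \<open>auto simp: A_def set_integrable_def\<close>)
  then have sum: "summable (\<lambda>i. 16 * (LINT x:A i|lebesgue. f x))"
    by (rule summable_mult)
  show ?thesis
  proof (rule summable_comparison_test'[OF sum])
    fix i :: nat
    define a :: real where "a = 2 ^ (i + 1)"
    have a: "2 \<le> a" by (simp add: a_def)
    define L where "L = ln (\<mu> a)"
    have L: "0 \<le> L" using weight_ge_1[OF \<mu>] by (simp add: L_def)
    have Aa: "A i = {a<..2 * a}" by (simp add: A_def a_def)
    have "L / (8 * a^2) * a = (LINT x:A i|lebesgue. L / (8 * a^2))"
      using a by (simp add: Aa set_integral_const emeasure_lborel_Ioc)
    also have "\<dots> \<le> (LINT x:A i|lebesgue. f x)"
    proof (rule set_integral_mono)
      show "set_integrable lebesgue (A i) f"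
        unfolding set_integrable_def using f by (intro integrable_mult_indicator) (auto simp: A_def)
      show "set_integrable lebesgue (A i) (\<lambda>x. L / (8 * a^2))"
        unfolding set_integrable_def Aa
        by (intro integrable_scaleR_left integrable_real_indicator impI) (use a in \<open>simp_all add: less_top[symmetric]\<close>)
      fix t assume "t \<in> A i"
      then have t: "a \<le> t" "t \<le> 2 * a" by (auto simp: Aa)
      have "L \<le> ln (\<mu> t)"
        unfolding L_def using weight_mono[OF \<mu>, of a t] weight_ge_1[OF \<mu>, of a] t a by simp
      moreover have "1 + t^2 \<le> 8 * a^2"
      proof -
        have "t^2 \<le> (2*a)^2" using t a by (intro power_mono) auto
        moreover have "1 \<le> a^2" using a by (simp add: one_le_power)
        ultimately show ?thesis by (simp add: power_mult_distrib)
      qed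
      moreover have "0 < 1 + t^2" by (simp add: add_pos_nonneg)
      ultimately show "L / (8 * a^2) \<le> f t"
        unfolding f_def using L by (intro frac_le) auto
    qed
    finally have "L / a \<le> 8 * (LINT x:A i|lebesgue. f x)"
      using a by (simp add: field_simps power2_eq_square)
    then show "norm (ln (\<mu> (2 ^ (i + 1))) / 2 ^ i) \<le> 16 * (LINT x:A i|lebesgue. f x)"
      using L by (simp add: L_def a_def)
  qed
qed

text \<open>The unnormalized cardinal sine \<open>sin z / z\<close>, with its removable singularity filled in.\<close>

definition csinc :: "complex \<Rightarrow> complex" where
  "csinc z = (if z = 0 then 1 else sin z / z)"

lemma holomorphic_csinc: "csinc holomorphic_on UNIV"
proof -
  have "(\<lambda>z. if z = 0 then deriv sin 0 else (sin z - sin 0) / (z - 0 :: complex)) holomorphic_on UNIV"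
    by (rule pole_lemma) (auto intro!: holomorphic_intros)
  moreover have "deriv sin (0::complex) = 1"
    by (rule DERIV_imp_deriv) (auto intro!: derivative_eq_intros)
  ultimately show ?thesis by (simp add: csinc_def[abs_def] cong: if_cong)
qed

lemma norm_exp_minus_1_le: "norm (exp z - 1) \<le> norm z * exp (norm z)" for z :: complex
proof -
  have "norm (exp z - exp 0) \<le> exp (norm z) * norm (z - 0)"
  proof (rule field_differentiable_bound[of "cball 0 (norm z)" exp exp])
    fix w :: complex assume "w \<in> cball 0 (norm z)"
    then have "norm w \<le> norm z" by simp
    then show "norm (exp w) \<le> exp (norm z)" using norm_exp[of w] by (meson exp_le_cancel_iff order_trans)
  qed (auto intro!: derivative_eq_intros)
  then show ?thesis by (simp add: mult.commute)
qed

text \<open>A bound by an exponential minus 1 passes to powers (\<open>norm_power_minus_1_le\<close>); it yields both the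
convergence of the product of \<open>weight_multiplier_exists\<close> and its exponential type.\<close>

lemma norm_csinc_minus_1_le: "norm (csinc z - 1) \<le> exp (2 * norm z) - 1"
proof (cases "z = 0")
  case False
  define x where "x = norm z"
  have cos: "norm (cos w - 1) \<le> x * exp x" if "norm w \<le> x" for w :: complex
  proof -
    have "norm (exp (\<i> * w) - 1) \<le> norm w * exp (norm w)" "norm (exp (-(\<i> * w)) - 1) \<le> norm w * exp (norm w)"
      using norm_exp_minus_1_le[of "\<i> * w"] norm_exp_minus_1_le[of "-(\<i> * w)"] by (simp_all add: norm_mult)
    moreover have "cos w - 1 = ((exp (\<i> * w) - 1) + (exp (-(\<i> * w)) - 1)) / 2"
      by (simp add: cos_exp_eq field_simps)
    then have "norm (cos w - 1) = norm ((exp (\<i> * w) - 1) + (exp (-(\<i> * w)) - 1)) / 2"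
      by (simp only: norm_divide) simp
    ultimately have "norm (cos w - 1) \<le> norm w * exp (norm w)"
      using norm_triangle_ineq[of "exp (\<i> * w) - 1" "exp (-(\<i> * w)) - 1"] by linarith
    also have "\<dots> \<le> x * exp x"
      using that order_trans[OF norm_ge_zero that] by (intro mult_mono) auto
    finally show ?thesis .
  qed
  have "norm ((sin z - z) - (sin 0 - 0)) \<le> (x * exp x) * norm (z - 0)"
  proof (rule field_differentiable_bound[of "cball 0 x" "\<lambda>w. sin w - w" "\<lambda>w. cos w - 1"])
  qed (use cos in \<open>auto intro!: derivative_eq_intros simp: x_def\<close>)
  moreover have "csinc z - 1 = (sin z - z) / z"
    using False by (simp add: csinc_def field_simps)
  then have "norm (csinc z - 1) = norm (sin z - z) / x"
    by (simp only: norm_divide x_def)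
  ultimately have "norm (csinc z - 1) \<le> x * exp x"
    using False by (simp add: x_def divide_le_eq)
  also have "\<dots> \<le> exp (2 * x) - 1"
  proof -
    have "x * exp x \<le> (exp x - 1) * (exp x + 1)"
    proof (rule mult_mono)
      show "x \<le> exp x - 1" using exp_ge_add_one_self[of x] by linarith
    qed (simp_all add: x_def)
    also have "\<dots> = exp (2 * x) - 1"
      by (simp add: algebra_simps mult_exp_exp)
    finally show ?thesis .
  qed
  finally show ?thesis by (simp add: x_def)
qed (simp add: csinc_def)

lemma norm_le_exp_of_near_1:
  fixes a :: complex
  assumes "norm (a - 1) \<le> exp x - 1"
  shows "norm a \<le> exp x"
  using assms norm_triangle_ineq2[of a 1] by simp

lemma norm_power_minus_1_le:
  fixes a :: complex
  assumes a: "norm (a - 1) \<le> exp x - 1"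
  shows "norm (a ^ n - 1) \<le> exp (real n * x) - 1"
proof (induction n)
  case (Suc n)
  have "a ^ Suc n - 1 = a * (a ^ n - 1) + (a - 1)" by (simp add: algebra_simps)
  then have "norm (a ^ Suc n - 1) \<le> norm a * norm (a ^ n - 1) + norm (a - 1)"
    by (metis norm_mult norm_triangle_ineq)
  also have "\<dots> \<le> exp x * (exp (real n * x) - 1) + (exp x - 1)"
    using Suc a norm_le_exp_of_near_1[OF a] by (intro add_mono mult_mono) auto
  also have "\<dots> = exp (real (Suc n) * x) - 1"
    by (simp add: algebra_simps exp_add)
  finally show ?case .
qed simp

lemma norm_csinc_real:
  "norm (csinc (of_real t)) \<le> 1" "t \<noteq> 0 \<Longrightarrow> norm (csinc (of_real t)) \<le> 1 / \<bar>t\<bar>"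
proof -
  have *: "norm (csinc (of_real t)) = \<bar>sin t\<bar> / \<bar>t\<bar>" if "t \<noteq> 0"
    using that by (simp add: csinc_def norm_divide sin_of_real)
  show "norm (csinc (of_real t)) \<le> 1"
    using * abs_sin_x_le_abs_x[of t] by (cases "t = 0") (simp_all add: csinc_def[of 0] divide_le_eq)
  show "norm (csinc (of_real t)) \<le> 1 / \<bar>t\<bar>" if "t \<noteq> 0"
    using *[OF that] that by (simp add: divide_right_mono)
qed

text \<open>The multiplier is \<open>\<phi>(z) = \<Prod> csinc(b\<^sub>i z)^(n\<^sub>i)\<close> with \<open>b\<^sub>i = e/2^i\<close> and \<open>n\<^sub>i = \<lceil>ln \<mu>(2^(i+1))\<rceil>\<close>. If
\<open>2^i \<le> |t| < 2^(i+1)\<close>, then \<open>|b\<^sub>i t| \<ge> e\<close>, so the \<open>i\<close>-th factor is at most \<open>exp(-n\<^sub>i) \<le> 1/\<mu>(t)\<close>, and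
all other factors are at most 1. The exponential type is at most \<open>\<Sum> 2 n\<^sub>i b\<^sub>i\<close>, which is finite by
\<open>weight_dyadic_summable\<close>.\<close>

lemma weight_multiplier_exists:
  assumes \<mu>: "weight \<mu>"
  obtains \<phi> :: "complex \<Rightarrow> complex" and A C :: real where
    "\<phi> holomorphic_on UNIV" "\<phi> 0 = 1" "0 \<le> A" "0 \<le> C"
    "\<And>z. norm (\<phi> z) \<le> exp (A * norm z)" "\<And>t. norm (\<phi> (of_real t)) * \<mu> t \<le> C"
proof -
  define n where "n = (\<lambda>i::nat. nat \<lceil>ln (\<mu> (2 ^ (i + 1)))\<rceil>)"
  define b :: "nat \<Rightarrow> real" where "b = (\<lambda>i. exp 1 / 2 ^ i)"
  define a where "a = (\<lambda>i. 2 * real (n i) * b i)"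
  have b: "0 < b i" for i by (simp add: b_def)
  have a0: "0 \<le> a i" for i by (simp add: a_def b_def)
  have "summable (\<lambda>i. 2 * exp 1 * (ln (\<mu> (2 ^ (i + 1))) / 2 ^ i + (1/2) ^ i))"
    by (intro summable_mult summable_add weight_dyadic_summable[OF \<mu>]) simp
  then have sa: "summable a"
  proof (rule summable_comparison_test')
    fix i :: nat
    have "0 \<le> ln (\<mu> (2 ^ (i + 1)))" using weight_ge_1[OF \<mu>] by simp
    then have "real (n i) \<le> ln (\<mu> (2 ^ (i + 1))) + 1" unfolding n_def by linarith
    then have "a i \<le> 2 * (ln (\<mu> (2 ^ (i + 1))) + 1) * b i"
      unfolding a_def using b[of i] by (intro mult_right_mono mult_left_mono) auto
    then show "norm (a i) \<le> 2 * exp 1 * (ln (\<mu> (2 ^ (i + 1))) / 2 ^ i + (1/2) ^ i)"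
      using a0[of i] by (simp add: b_def field_simps)
  qed
  define A where "A = suminf a"
  have A: "0 \<le> A" "(\<Sum>i<N. a i) \<le> A" "a i \<le> A" for N i
    using sa a0 sum_le_suminf[OF sa, of "{..<N}"] sum_le_suminf[OF sa, of "{i}"]
    by (auto simp: A_def intro: suminf_nonneg)
  define f where "f = (\<lambda>i z. csinc (of_real (b i) * z) ^ n i)"
  have f1: "norm (f i z - 1) \<le> exp (a i * norm z) - 1" for i z
  proof -
    have "norm (csinc (of_real (b i) * z) - 1) \<le> exp (2 * (b i * norm z)) - 1"
      using norm_csinc_minus_1_le[of "of_real (b i) * z"] b[of i] by (simp add: norm_mult)
    from norm_power_minus_1_le[OF this, of "n i"] show ?thesis
      by (simp add: f_def a_def algebra_simps)
  qed
  have holf: "f i holomorphic_on UNIV" for i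
  proof -
    have "(\<lambda>z. csinc (of_real (b i) * z)) holomorphic_on UNIV"
      by (rule holomorphic_on_compose[of "\<lambda>z. of_real (b i) * z" UNIV csinc, unfolded o_def])
        (auto intro!: holomorphic_intros holomorphic_on_subset[OF holomorphic_csinc])
    then show ?thesis unfolding f_def by (intro holomorphic_intros)
  qed
  have uconv: "uniformly_convergent_on (cball 0 R) (\<lambda>N z. \<Prod>i<N. f i z)" if R: "0 \<le> R" for R
  proof (rule uniformly_convergent_on_prod')
    show "continuous_on (cball 0 R) (f i)" for i
      using holf[of i] holomorphic_on_imp_continuous_on continuous_on_subset by blast
    show "uniformly_convergent_on (cball 0 R) (\<lambda>N x. \<Sum>n<N. norm (f n x - 1))"
    proof (rule Weierstrass_m_test')
      show "summable (\<lambda>i. a i * (R * exp (A * R)))"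
        by (rule summable_mult2[OF sa])
      fix i z assume "z \<in> cball (0::complex) R"
      then have z: "norm z \<le> R" by simp
      have "norm (f i z - 1) \<le> exp (a i * R) - 1"
        using z a0[of i] by (intro order_trans[OF f1]) (auto intro: mult_left_mono)
      also have "\<dots> \<le> a i * R * exp (a i * R)"
      proof -
        have "1 - a i * R \<le> exp (- (a i * R))" using exp_ge_add_one_self[of "- (a i * R)"] by simp
        then have "(1 - a i * R) * exp (a i * R) \<le> exp (- (a i * R)) * exp (a i * R)"
          by (rule mult_right_mono) simp
        then show ?thesis by (simp add: algebra_simps flip: exp_add)
      qed
      also have "\<dots> \<le> a i * R * exp (A * R)"
        using A(3)[of i] R a0[of i] by (intro mult_left_mono) (auto intro: mult_right_mono)
      finally show "norm (norm (f i z - 1)) \<le> a i * (R * exp (A * R))" by (simp add: mult.assoc)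
    qed
  qed auto
  define \<phi> where "\<phi> = (\<lambda>z. lim (\<lambda>N. \<Prod>i<N. f i z))"
  have ulim: "uniform_limit (cball 0 R) (\<lambda>N z. \<Prod>i<N. f i z) \<phi> sequentially" if "0 \<le> R" for R
    using uconv[OF that] unfolding uniformly_convergent_uniform_limit_iff \<phi>_def .
  have lim: "(\<lambda>N. \<Prod>i<N. f i z) \<longlonglongrightarrow> \<phi> z" for z
    using tendsto_uniform_limitI[OF ulim[of "norm z"], of z] by simp
  show thesis
  proof
    show "\<phi> holomorphic_on UNIV"
    proof (rule holomorphic_uniform_sequence)
      show "(\<lambda>z. \<Prod>i<N. f i z) holomorphic_on UNIV" for N
        by (intro holomorphic_intros holf)
      fix z :: complex
      have "cball z 1 \<subseteq> cball 0 (norm z + 1)"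
        by (simp add: cball_subset_cball_iff dist_norm)
      then have "uniform_limit (cball z 1) (\<lambda>N z. \<Prod>i<N. f i z) \<phi> sequentially"
        by (intro uniform_limit_on_subset[OF ulim[of "norm z + 1"]]) auto
      then show "\<exists>d>0. cball z d \<subseteq> UNIV \<and> uniform_limit (cball z d) (\<lambda>N z. \<Prod>i<N. f i z) \<phi> sequentially"
        by (intro exI[of _ 1]) auto
    qed auto
    have "(\<lambda>N. 1) \<longlonglongrightarrow> \<phi> 0"
      using lim[of 0] by (simp add: f_def csinc_def)
    then show "\<phi> 0 = 1" by (simp add: LIMSEQ_const_iff)
    show "0 \<le> A" by (rule A)
    show "0 \<le> \<mu> 1 + \<mu> 0" using weight_ge_1[OF \<mu>, of 1] weight_ge_1[OF \<mu>, of 0] by simp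
    show "norm (\<phi> z) \<le> exp (A * norm z)" for z
    proof (rule tendsto_upperbound[OF tendsto_norm[OF lim[of z]]])
      have "norm (\<Prod>i<N. f i z) \<le> exp (A * norm z)" for N
      proof -
        have "norm (\<Prod>i<N. f i z) \<le> (\<Prod>i<N. exp (a i * norm z))"
          unfolding prod_norm[symmetric] by (intro prod_mono) (auto intro: norm_le_exp_of_near_1 f1)
        also have "\<dots> = exp ((\<Sum>i<N. a i) * norm z)"
          by (simp add: exp_sum sum_distrib_right)
        also have "\<dots> \<le> exp (A * norm z)" using A(2)[of N] by (auto intro: mult_right_mono)
        finally show ?thesis .
      qed
      then show "\<forall>\<^sub>F N in sequentially. norm (\<Prod>i<N. f i z) \<le> exp (A * norm z)" by simp
    qed auto
    have f_le1: "norm (f i (of_real t)) \<le> 1" for i t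
      unfolding f_def using norm_csinc_real(1)[of "b i * t"] by (simp add: norm_power power_le_one)
    show "norm (\<phi> (of_real t)) * \<mu> t \<le> \<mu> 1 + \<mu> 0" for t
    proof (cases "\<bar>t\<bar> < 1")
      case True
      have "norm (\<phi> (of_real t)) \<le> 1"
      proof (rule tendsto_upperbound[OF tendsto_norm[OF lim[of "of_real t"]]])
        show "\<forall>\<^sub>F N in sequentially. norm (\<Prod>i<N. f i (of_real t)) \<le> 1"
          using f_le1 by (simp add: prod_norm[symmetric] prod_le_1)
      qed auto
      moreover have "\<mu> t \<le> \<mu> 1 + \<mu> 0"
        using True weight_mono[OF \<mu>, of t 1] weight_ge_1[OF \<mu>, of 0] weight_ge_1[OF \<mu>, of 1]
        by (cases "t = 0") auto
      ultimately show ?thesis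
        using mult_mono[of "norm (\<phi> (of_real t))" 1 "\<mu> t" "\<mu> 1 + \<mu> 0"] weight_ge_1[OF \<mu>, of t] by simp
    next
      case False
      then have "1 \<le> \<bar>t\<bar>" by simp
      then obtain i where i: "2 ^ i \<le> \<bar>t\<bar>" "\<bar>t\<bar> < 2 ^ (i + 1)"
        using dyadic_scale by blast
      have fi: "norm (f i (of_real t)) \<le> exp (- real (n i))"
      proof -
        have "exp 1 \<le> \<bar>b i * t\<bar>" using i(1) by (simp add: b_def abs_mult field_simps)
        then have "1 / \<bar>b i * t\<bar> \<le> 1 / exp 1" and "b i * t \<noteq> 0"
          by (auto intro!: divide_left_mono mult_pos_pos simp del: zero_less_mult_iff)
        then have "norm (csinc (of_real (b i * t))) \<le> 1 / exp 1"
          using norm_csinc_real(2)[of "b i * t"] by linarith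
        then have "norm (csinc (of_real (b i * t))) ^ n i \<le> (1 / exp 1) ^ n i"
          by (rule power_mono) simp
        also have "\<dots> = exp (- real (n i))"
          by (simp add: exp_minus power_one_over inverse_eq_divide exp_of_nat_mult[of "n i" 1, simplified])
        finally show ?thesis by (simp add: f_def norm_power)
      qed
      have "norm (\<phi> (of_real t)) \<le> exp (- real (n i))"
      proof (rule tendsto_upperbound[OF tendsto_norm[OF lim[of "of_real t"]]])
        have "norm (\<Prod>j<N. f j (of_real t)) \<le> exp (- real (n i))" if "i < N" for N
        proof -
          have "norm (\<Prod>j<N. f j (of_real t)) = norm (f i (of_real t)) * (\<Prod>j\<in>{..<N}-{i}. norm (f j (of_real t)))"
            unfolding prod_norm[symmetric] by (rule prod.remove) (use that in auto)
          also have "\<dots> \<le> exp (- real (n i)) * 1"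
            using f_le1 by (intro mult_mono fi prod_le_1 prod_nonneg) auto
          finally show ?thesis by simp
        qed
        then show "\<forall>\<^sub>F N in sequentially. norm (\<Prod>j<N. f j (of_real t)) \<le> exp (- real (n i))"
          by (intro eventually_sequentiallyI[of "Suc i"]) auto
      qed auto
      moreover have "\<mu> t \<le> exp (real (n i))"
      proof -
        have "\<mu> t \<le> \<mu> (2 ^ (i + 1))"
          using i(2) \<open>1 \<le> \<bar>t\<bar>\<close> by (intro weight_mono[OF \<mu>]) auto
        also have "\<dots> = exp (ln (\<mu> (2 ^ (i + 1))))"
          using weight_ge_1[OF \<mu>, of "2 ^ (i + 1)"] by simp
        also have "\<dots> \<le> exp (real (n i))"
          unfolding n_def by (simp add: real_nat_ceiling_ge)
        finally show ?thesis .
      qed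
      ultimately have "norm (\<phi> (of_real t)) * \<mu> t \<le> exp (- real (n i)) * exp (real (n i))"
        using weight_ge_1[OF \<mu>, of t] by (intro mult_mono) auto
      then show ?thesis
        using weight_ge_1[OF \<mu>, of 1] weight_ge_1[OF \<mu>, of 0] by (simp flip: exp_add)
    qed
  qed
qed

section \<open>Weighted Lebesgue spaces\<close>

text \<open>Young's inequality in a form that makes sense for \<open>p = 1\<close>. It gives the convexity of the \<open>p\<close>-th power as
well as the Hoelder inequality without the conjugate exponent.\<close>

lemma young_powr:
  fixes a b p :: real
  assumes "1 \<le> p" "0 \<le> a" "0 \<le> b"
  shows "a * b powr (p - 1) \<le> a powr p / p + (1 - 1 / p) * b powr p"
proof (cases "a = 0 \<or> b = 0")
  case False
  then have ab: "0 < a" "0 < b" using assms by auto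
  have "(a powr p) powr (1 / p) * (b powr p) powr (1 - 1 / p) \<le> 1 / p * a powr p + (1 - 1 / p) * b powr p"
    using assms ab by (intro Youngs_inequality_0) (auto simp: field_simps)
  moreover have "p * (1 - 1 / p) = p - 1" using assms by (simp add: field_simps)
  ultimately show ?thesis using ab assms by (simp add: powr_powr)
qed (use assms in auto)

text \<open>With \<open>w\<close> the convex combination, write \<open>w^p = w w^(p-1)\<close>, expand the first factor, apply \<open>young_powr\<close>
to both terms and cancel the resulting multiple of \<open>w^p\<close>.\<close>

lemma powr_convex:
  fixes u v p \<theta> :: real
  assumes p: "1 \<le> p" and uv: "0 \<le> u" "0 \<le> v" and \<theta>: "0 \<le> \<theta>" "\<theta> \<le> 1"
  shows "(\<theta> * u + (1 - \<theta>) * v) powr p \<le> \<theta> * u powr p + (1 - \<theta>) * v powr p"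
proof -
  define w where "w = \<theta> * u + (1 - \<theta>) * v"
  have w: "0 \<le> w" using uv \<theta> by (simp add: w_def)
  show ?thesis
  proof (cases "w = 0")
    case False
    with w have "w powr p = w * w powr (p - 1)"
      by (simp add: powr_diff)
    also have "\<dots> = \<theta> * (u * w powr (p - 1)) + (1 - \<theta>) * (v * w powr (p - 1))"
      by (subst (1) w_def) (simp add: algebra_simps)
    also have "\<dots> \<le> \<theta> * (u powr p / p + (1 - 1 / p) * w powr p) + (1 - \<theta>) * (v powr p / p + (1 - 1 / p) * w powr p)"
      using young_powr[OF p] uv w \<theta> by (intro add_mono mult_left_mono) auto
    also have "\<dots> = (\<theta> * u powr p + (1 - \<theta>) * v powr p) / p + (1 - 1 / p) * w powr p"
      using p by (simp add: field_simps)
    finally have "w powr p * (1 / p) \<le> (\<theta> * u powr p + (1 - \<theta>) * v powr p) * (1 / p)"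
      by (simp add: left_diff_distrib)
    then have "w powr p \<le> \<theta> * u powr p + (1 - \<theta>) * v powr p"
      using p by (subst (asm) mult_le_cancel_right_pos) auto
    then show ?thesis by (simp add: w_def)
  next
    case True
    then show ?thesis using \<theta> by (simp add: w_def[symmetric])
  qed
qed

lemma borel_measurable_weight:
  assumes \<mu>: "weight \<mu>"
  shows "\<mu> \<in> borel_measurable borel"
proof -
  have pos: "(\<lambda>t. if t \<in> {0<..} then \<mu> t else 0) \<in> borel_measurable borel"
  proof -
    have "\<mu> \<in> borel_measurable (restrict_space borel {0<..})"
      using \<mu> by (intro borel_measurable_mono_on_fnc) (simp add: weight_def)
    then show ?thesis by (subst (asm) measurable_restrict_space_iff[where c = 0]) auto
  qed
  define h where "h = (\<lambda>t. if t \<in> {0<..} then \<mu> t else 0)"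
  have h[measurable]: "h \<in> borel_measurable borel" using pos by (simp add: h_def)
  have "\<mu> = (\<lambda>t. if t = 0 then \<mu> 0 else h \<bar>t\<bar>)"
    using \<mu> by (auto simp: h_def weight_def abs_if fun_eq_iff)
  also have "\<dots> \<in> borel_measurable borel" by measurable
  finally show ?thesis .
qed

lemma measurable_shift:
  assumes "f \<in> borel_measurable lebesgue"
  shows "(\<lambda>s::real. f (s + h) :: complex) \<in> borel_measurable lebesgue"
  using borel_measurable_affine[of f 1 h] assms by (simp add: add.commute)

lemma AE_shift:
  assumes "AE s in lebesgue. P s"
  shows "AE s in lebesgue. P (s + h :: real)"
proof -
  from assms obtain N where N: "{s. \<not> P s} \<subseteq> N" "negligible N"
    unfolding eventually_ae_filter negligible_iff_null_sets by auto
  have "negligible ((+) (- h) ` N)" using N(2) by (rule negligible_translation)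
  moreover have "{s. \<not> P (s + h)} \<subseteq> (+) (- h) ` N"
  proof
    fix s assume "s \<in> {s. \<not> P (s + h)}"
    then have "s + h \<in> N" using N(1) by auto
    then show "s \<in> (+) (- h) ` N" by (intro image_eqI[of _ _ "s + h"]) auto
  qed
  ultimately show ?thesis
    unfolding eventually_ae_filter negligible_iff_null_sets by auto
qed

locale weighted_Lp =
  fixes p :: real and \<mu> :: "real \<Rightarrow> real"
  assumes p: "1 \<le> p" and \<mu>: "weight \<mu>"
begin

abbreviation "L \<equiv> Lp_space p \<mu>"
abbreviation "nm \<equiv> Lp_norm p \<mu>"

lemma \<mu>_pos: "0 < \<mu> t" and \<mu>_ge_1: "1 \<le> \<mu> t"
  using weight_ge_1[OF \<mu>, of t] by linarith+

lemma measurable_weight_lebesgue [measurable]: "\<mu> \<in> borel_measurable lebesgue"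
  by (rule measurable_completion) (simp add: borel_measurable_weight[OF \<mu>])

lemma Lp_measurable: "f \<in> L \<Longrightarrow> f \<in> borel_measurable lebesgue"
  by (simp add: Lp_space_def)

text \<open>The \<open>p\<close>-th power of the norm as an extended nonnegative integral, so that it is meaningful before
integrability is known.\<close>

definition pint :: "(real \<Rightarrow> complex) \<Rightarrow> ennreal" where
  "pint f = (\<integral>\<^sup>+s. ennreal (norm (f s) powr p * \<mu> s powr p) \<partial>lebesgue)"

lemma Lp_norm_nonneg [simp]: "0 \<le> nm f"
  by (simp add: Lp_norm_def)

lemma pint_Lp:
  assumes "f \<in> L" shows "pint f = ennreal (nm f powr p)"
proof -
  have "nm f powr p = (LINT s|lebesgue. norm (f s) powr p * \<mu> s powr p)"
    using p unfolding Lp_norm_def by (subst powr_powr) (auto intro!: integral_nonneg_AE)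
  then show ?thesis
    using assms unfolding pint_def by (simp add: nn_integral_eq_integral Lp_space_def)
qed

lemma Lp_if_pint_le:
  assumes f: "f \<in> borel_measurable lebesgue" and B: "0 \<le> B" and le: "pint f \<le> ennreal (B powr p)"
  shows "f \<in> L" "nm f \<le> B"
proof -
  note [measurable] = f
  have "integrable lebesgue (\<lambda>s. norm (f s) powr p * \<mu> s powr p)"
    by (rule integrableI_bounded)
      (use le in \<open>auto simp: pint_def intro: le_less_trans\<close>)
  then show fL: "f \<in> L" using f by (simp add: Lp_space_def)
  have "nm f powr p \<le> B powr p"
    using le pint_Lp[OF fL] B by simp
  then show "nm f \<le> B"
    using p B powr_less_mono2[of p B "nm f"] by force
qed

lemma Lp_cong_AE:
  assumes g: "g \<in> L" and f: "f \<in> borel_measurable lebesgue" and eq: "AE s in lebesgue. f s = g s"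
  shows "f \<in> L" "nm f = nm g"
proof -
  note [measurable] = f Lp_measurable[OF g]
  have "integrable lebesgue (\<lambda>s. norm (f s) powr p * \<mu> s powr p) \<longleftrightarrow>
    integrable lebesgue (\<lambda>s. norm (g s) powr p * \<mu> s powr p)"
    using eq by (intro integrable_cong_AE) auto
  then show "f \<in> L" using g f by (simp add: Lp_space_def)
  show "nm f = nm g"
    unfolding Lp_norm_def using eq by (intro arg_cong2[of _ _ _ _ "(powr)"] integral_cong_AE) auto
qed

lemma Lp_mono:
  assumes g: "g \<in> L" and f: "f \<in> borel_measurable lebesgue" and c: "0 \<le> c"
    and le: "AE s in lebesgue. norm (f s) \<le> c * norm (g s)"
  shows "f \<in> L" "nm f \<le> c * nm g"
proof -
  note [measurable] = f Lp_measurable[OF g]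
  have "pint f \<le> (\<integral>\<^sup>+s. ennreal (c powr p) * ennreal (norm (g s) powr p * \<mu> s powr p) \<partial>lebesgue)"
    unfolding pint_def
  proof (rule nn_integral_mono_AE)
    show "AE s in lebesgue. ennreal (norm (f s) powr p * \<mu> s powr p)
      \<le> ennreal (c powr p) * ennreal (norm (g s) powr p * \<mu> s powr p)"
      using le
    proof eventually_elim
      case (elim s)
      have "norm (f s) powr p \<le> c powr p * norm (g s) powr p"
        using powr_mono2[OF _ _ elim, of p] p c by (simp add: powr_mult)
      then have "norm (f s) powr p * \<mu> s powr p \<le> c powr p * norm (g s) powr p * \<mu> s powr p"
        by (rule mult_right_mono) simp
      then show ?case by (simp add: mult.assoc flip: ennreal_mult)
    qed
  qed
  also have "\<dots> = ennreal (c powr p) * pint g"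
    unfolding pint_def by (rule nn_integral_cmult) measurable
  also have "\<dots> = ennreal ((c * nm g) powr p)"
    using c by (simp add: pint_Lp[OF g] powr_mult flip: ennreal_mult)
  finally show "f \<in> L" "nm f \<le> c * nm g"
    using Lp_if_pint_le[OF f, of "c * nm g"] c by auto
qed

lemma Lp_zero [simp]: "(\<lambda>s. 0) \<in> L" and Lp_norm_zero [simp]: "nm (\<lambda>s. 0) = 0"
  using p by (auto simp: Lp_space_def Lp_norm_def)

lemma Lp_cmult: "f \<in> L \<Longrightarrow> (\<lambda>s. c * f s) \<in> L" and Lp_norm_cmult: "f \<in> L \<Longrightarrow> nm (\<lambda>s. c * f s) \<le> norm c * nm f"
  using Lp_mono[of f "\<lambda>s. c * f s" "norm c"] Lp_measurable[of f] by (auto simp: norm_mult)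

text \<open>Convexity of the \<open>p\<close>-th power with weights proportional to strict upper bounds \<open>A\<close>, \<open>B\<close> of the norms;
the norms themselves could vanish.\<close>

lemma minkowski:
  assumes f: "f \<in> L" and g: "g \<in> L"
  shows "(\<lambda>s. f s + g s) \<in> L" "nm (\<lambda>s. f s + g s) \<le> nm f + nm g"
proof -
  note [measurable] = Lp_measurable[OF f] Lp_measurable[OF g]
  have *: "(\<lambda>s. f s + g s) \<in> L \<and> nm (\<lambda>s. f s + g s) \<le> A + B" if AB: "nm f < A" "nm g < B" for A B
  proof -
    have pos: "0 < A" "0 < B" using AB Lp_norm_nonneg[of f] Lp_norm_nonneg[of g] by linarith+
    \<comment> \<open>With this weight, \<open>|f| + |g| = (A + B) (\<theta> |f|/A + (1 - \<theta>) |g|/B)\<close>.\<close>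
    define \<theta> where "\<theta> = A / (A + B)"
    have \<theta>: "0 \<le> \<theta>" "\<theta> \<le> 1" "1 - \<theta> = B / (A + B)" using pos by (auto simp: \<theta>_def field_simps)
    define K where "K = (A + B) powr p"
    define a where "a = K * \<theta> / A powr p"
    define b where "b = K * (1 - \<theta>) / B powr p"
    have ab: "0 \<le> a" "0 \<le> b" using \<theta> pos by (auto simp: a_def b_def K_def)
    have pw: "norm (f s + g s) powr p \<le> a * norm (f s) powr p + b * norm (g s) powr p" for s
    proof -
      have "norm (f s + g s) powr p \<le> (norm (f s) + norm (g s)) powr p"
        using p by (intro powr_mono2 norm_triangle_ineq) auto
      also have "norm (f s) + norm (g s) = (A + B) * (\<theta> * (norm (f s) / A) + (1 - \<theta>) * (norm (g s) / B))"
      proof -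
        have "(A + B) * (\<theta> * x / A) = x" "(A + B) * ((1 - \<theta>) * x / B) = x" for x
          using pos unfolding \<theta>(3) by (simp_all add: \<theta>_def)
        then show ?thesis by (simp add: distrib_left)
      qed
      also have "\<dots> powr p = K * (\<theta> * (norm (f s) / A) + (1 - \<theta>) * (norm (g s) / B)) powr p"
        using pos \<theta> by (simp add: K_def powr_mult)
      also have "\<dots> \<le> K * (\<theta> * (norm (f s) / A) powr p + (1 - \<theta>) * (norm (g s) / B) powr p)"
        using pos \<theta> p by (intro mult_left_mono powr_convex) (auto simp: K_def)
      also have "\<dots> = a * norm (f s) powr p + b * norm (g s) powr p"
        using pos by (simp add: a_def b_def powr_divide distrib_left)
      finally show ?thesis .
    qed
    have "pint (\<lambda>s. f s + g s) \<le> (\<integral>\<^sup>+s. ennreal a * ennreal (norm (f s) powr p * \<mu> s powr p) +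
       ennreal b * ennreal (norm (g s) powr p * \<mu> s powr p) \<partial>lebesgue)"
      unfolding pint_def
    proof (rule nn_integral_mono)
      fix s
      have "norm (f s + g s) powr p * \<mu> s powr p \<le> (a * norm (f s) powr p + b * norm (g s) powr p) * \<mu> s powr p"
        by (rule mult_right_mono[OF pw]) simp
      also have "\<dots> = a * (norm (f s) powr p * \<mu> s powr p) + b * (norm (g s) powr p * \<mu> s powr p)"
        by (simp add: algebra_simps)
      finally show "ennreal (norm (f s + g s) powr p * \<mu> s powr p) \<le>
        ennreal a * ennreal (norm (f s) powr p * \<mu> s powr p) + ennreal b * ennreal (norm (g s) powr p * \<mu> s powr p)"
        using ab by (simp flip: ennreal_mult ennreal_plus)
    qed
    also have "\<dots> = ennreal a * pint f + ennreal b * pint g"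
      unfolding pint_def by (simp add: nn_integral_add nn_integral_cmult)
    also have "\<dots> = ennreal (a * nm f powr p + b * nm g powr p)"
      using ab by (simp add: pint_Lp[OF f] pint_Lp[OF g] flip: ennreal_mult ennreal_plus)
    also have "\<dots> \<le> ennreal (a * A powr p + b * B powr p)"
      using AB p ab by (intro ennreal_leI add_mono mult_left_mono powr_mono2) auto
    also have "a * A powr p + b * B powr p = (A + B) powr p"
      using pos by (simp add: a_def b_def K_def flip: distrib_left)
    finally show ?thesis using Lp_if_pint_le[of "\<lambda>s. f s + g s" "A + B"] pos by simp
  qed
  show "(\<lambda>s. f s + g s) \<in> L" using *[of "nm f + 1" "nm g + 1"] by simp
  show "nm (\<lambda>s. f s + g s) \<le> nm f + nm g"
  proof (rule field_le_epsilon)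
    fix e :: real assume "0 < e"
    then show "nm (\<lambda>s. f s + g s) \<le> nm f + nm g + e"
      using *[of "nm f + e / 2" "nm g + e / 2"] by simp
  qed
qed

lemma Lp_diff:
  assumes "f \<in> L" "g \<in> L"
  shows "(\<lambda>s. f s - g s) \<in> L" "nm (\<lambda>s. f s - g s) \<le> nm f + nm g"
  using minkowski[OF assms(1) Lp_cmult[OF assms(2), of "-1"]] Lp_norm_cmult[OF assms(2), of "-1"] by auto

lemma Lp_sum:
  assumes "finite I" "\<And>i. i \<in> I \<Longrightarrow> f i \<in> L"
  shows "(\<lambda>s. \<Sum>i\<in>I. f i s) \<in> L \<and> nm (\<lambda>s. \<Sum>i\<in>I. f i s) \<le> (\<Sum>i\<in>I. nm (f i))"
  using assms
proof (induction I rule: finite_induct)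
  case (insert i I)
  then have "(\<lambda>s. \<Sum>i\<in>I. f i s) \<in> L \<and> nm (\<lambda>s. \<Sum>i\<in>I. f i s) \<le> (\<Sum>i\<in>I. nm (f i))" by simp
  then show ?case
    using insert minkowski[of "f i" "\<lambda>s. \<Sum>i\<in>I. f i s"] by auto
qed simp

text \<open>Submultiplicativity and evenness give \<open>\<mu>(s) \<le> \<mu>(h) \<mu>(s + h)\<close>.\<close>

lemma Lp_shift:
  assumes f: "f \<in> L"
  shows "(\<lambda>s. f (s + h)) \<in> L" "nm (\<lambda>s. f (s + h)) \<le> \<mu> h * nm f"
proof -
  note [measurable] = Lp_measurable[OF f] measurable_shift[OF Lp_measurable[OF f], of h]
  define w where "w = (\<lambda>s. norm (f s) powr p * \<mu> s powr p)"
  have w[measurable]: "w \<in> borel_measurable lebesgue" unfolding w_def by measurable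
  have w_shift[measurable]: "(\<lambda>s. w (h + 1 * s)) \<in> borel_measurable lebesgue"
    using borel_measurable_affine[OF w, of 1 h] by simp
  have "pint (\<lambda>s. f (s + h)) \<le> (\<integral>\<^sup>+s. ennreal (\<mu> h powr p) * ennreal (w (h + 1 * s)) \<partial>lebesgue)"
    unfolding pint_def
  proof (rule nn_integral_mono)
    fix s
    have "\<mu> s \<le> \<mu> h * \<mu> (h + s)"
    proof -
      have "\<mu> (- h + (h + s)) \<le> \<mu> (- h) * \<mu> (h + s)" by (rule weight_submult[OF \<mu>])
      then show ?thesis using \<mu> by (simp add: weight_def)
    qed
    then have "\<mu> s powr p \<le> \<mu> h powr p * \<mu> (h + s) powr p"
      using powr_mono2[of p "\<mu> s" "\<mu> h * \<mu> (h + s)"] p \<mu>_pos[of s] \<mu>_pos[of h] \<mu>_pos[of "h + s"]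
      by (simp add: powr_mult)
    then have "norm (f (s + h)) powr p * \<mu> s powr p \<le> norm (f (s + h)) powr p * (\<mu> h powr p * \<mu> (h + s) powr p)"
      by (rule mult_left_mono) simp
    also have "\<dots> = \<mu> h powr p * w (h + 1 * s)" by (simp add: w_def algebra_simps)
    finally show "ennreal (norm (f (s + h)) powr p * \<mu> s powr p) \<le> ennreal (\<mu> h powr p) * ennreal (w (h + 1 * s))"
      by (simp only: ennreal_mult'[symmetric] powr_ge_zero ennreal_leI)
  qed
  also have "\<dots> = ennreal (\<mu> h powr p) * (\<integral>\<^sup>+s. ennreal (w (h + 1 * s)) \<partial>lebesgue)"
    by (rule nn_integral_cmult) measurable
  also have "(\<integral>\<^sup>+s. ennreal (w (h + 1 * s)) \<partial>lebesgue) = pint f"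
  proof -
    have "pint f = (\<integral>\<^sup>+s. ennreal (w s) \<partial>lebesgue)" by (simp add: pint_def w_def)
    then show ?thesis
      using nn_integral_real_affine_lebesgue[of "\<lambda>s. ennreal (w s)" 1 h] by simp
  qed
  also have "ennreal (\<mu> h powr p) * pint f = ennreal ((\<mu> h * nm f) powr p)"
    using \<mu>_pos[of h] by (simp add: pint_Lp[OF f] powr_mult flip: ennreal_mult)
  finally show "(\<lambda>s. f (s + h)) \<in> L" "nm (\<lambda>s. f (s + h)) \<le> \<mu> h * nm f"
    using Lp_if_pint_le[of "\<lambda>s. f (s + h)" "\<mu> h * nm f"] \<mu>_pos[of h] by (auto intro: mult_nonneg_nonneg)
qed

lemma Lp_fatou:
  assumes u: "\<And>N. u N \<in> L" and B: "\<And>N. nm (u N) \<le> B" and f: "f \<in> borel_measurable lebesgue"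
    and lim: "AE s in lebesgue. (\<lambda>N. u N s) \<longlonglongrightarrow> f s"
  shows "f \<in> L" "nm f \<le> B"
proof -
  note [measurable] = f Lp_measurable[OF u]
  have B0: "0 \<le> B" using Lp_norm_nonneg[of "u 0"] B[of 0] by linarith
  have "pint f = (\<integral>\<^sup>+s. liminf (\<lambda>N. ennreal (norm (u N s) powr p * \<mu> s powr p)) \<partial>lebesgue)"
    unfolding pint_def
  proof (rule nn_integral_cong_AE)
    show "AE s in lebesgue. ennreal (norm (f s) powr p * \<mu> s powr p) =
       liminf (\<lambda>N. ennreal (norm (u N s) powr p * \<mu> s powr p))"
      using lim
    proof eventually_elim
      case (elim s)
      have "(\<lambda>N. norm (u N s) powr p * \<mu> s powr p) \<longlonglongrightarrow> norm (f s) powr p * \<mu> s powr p"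
        using elim p by (intro tendsto_intros tendsto_powr') auto
      then have "(\<lambda>N. ennreal (norm (u N s) powr p * \<mu> s powr p)) \<longlonglongrightarrow> ennreal (norm (f s) powr p * \<mu> s powr p)"
        by (rule tendsto_ennrealI)
      then show ?case by (intro lim_imp_Liminf[symmetric]) simp_all
    qed
  qed
  also have "\<dots> \<le> liminf (\<lambda>N. pint (u N))"
    unfolding pint_def by (rule nn_integral_liminf) measurable
  also have "\<dots> \<le> liminf (\<lambda>N. ennreal (B powr p))"
    using B p by (intro Liminf_mono always_eventually allI) (auto simp: pint_Lp[OF u] intro!: ennreal_leI powr_mono2)
  finally have "pint f \<le> ennreal (B powr p)"
    by (simp add: Liminf_const)
  then show "f \<in> L" "nm f \<le> B" using Lp_if_pint_le[OF f B0] by auto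
qed

text \<open>The Riesz-Fischer argument: the sums of the moduli are bounded in norm by \<open>\<Sum> a\<^sub>j\<close>, so by monotone
convergence they are finite almost everywhere; Fatou's lemma then bounds the tails.\<close>

lemma Lp_suminf:
  assumes Q: "\<And>j. Q j \<in> L" and Qa: "\<And>j. nm (Q j) \<le> a j" and a: "summable a"
  shows "AE s in lebesgue. summable (\<lambda>j. norm (Q j s))"
    "(\<lambda>s. \<Sum>j. Q j s) \<in> L"
    "nm (\<lambda>s. (\<Sum>j. Q j s) - (\<Sum>j<N. Q j s)) \<le> (\<Sum>j. a (j + N))"
proof -
  note [measurable] = Lp_measurable[OF Q]
  have a0: "0 \<le> a j" for j using Lp_norm_nonneg Qa order_trans by blast
  define T where "T = (\<lambda>N s. \<Sum>j<N. complex_of_real (norm (Q j s)))"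
  have nT: "norm (T N s) = (\<Sum>j<N. norm (Q j s))" for N s
  proof -
    have "T N s = of_real (\<Sum>j<N. norm (Q j s))" by (simp add: T_def)
    then show ?thesis by (simp only: norm_of_real) (simp add: sum_nonneg)
  qed
  have Qn: "(\<lambda>s. complex_of_real (norm (Q j s))) \<in> L \<and> nm (\<lambda>s. complex_of_real (norm (Q j s))) \<le> a j" for j
    using Lp_mono[OF Q[of j], of "\<lambda>s. complex_of_real (norm (Q j s))" 1] Qa[of j] by auto
  have T: "T N \<in> L \<and> nm (T N) \<le> suminf a" for N
  proof -
    have "T N \<in> L \<and> nm (T N) \<le> (\<Sum>j<N. nm (\<lambda>s. complex_of_real (norm (Q j s))))"
      unfolding T_def by (rule Lp_sum) (use Qn in auto)
    moreover have "(\<Sum>j<N. nm (\<lambda>s. complex_of_real (norm (Q j s)))) \<le> (\<Sum>j<N. a j)"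
      using Qn by (intro sum_mono) auto
    moreover have "(\<Sum>j<N. a j) \<le> suminf a" using a a0 by (intro sum_le_suminf) auto
    ultimately show ?thesis by linarith
  qed
  define F where "F = (\<lambda>N s. ennreal (norm (T N s) powr p * \<mu> s powr p))"
  have mono: "incseq F"
    unfolding F_def incseq_def le_fun_def nT using p
    by (intro allI impI ennreal_leI mult_right_mono powr_mono2 sum_mono2) (auto intro!: sum_nonneg)
  have [measurable]: "T N \<in> borel_measurable lebesgue" for N using T Lp_measurable by blast
  have "(\<integral>\<^sup>+s. (SUP N. F N s) \<partial>lebesgue) = (SUP N. \<integral>\<^sup>+s. F N s \<partial>lebesgue)"
    by (rule nn_integral_monotone_convergence_SUP[OF mono]) (simp add: F_def)
  also have "\<dots> = (SUP N. pint (T N))" by (simp add: F_def pint_def)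
  also have "\<dots> \<le> ennreal (suminf a powr p)"
    using T pint_Lp p by (intro SUP_least) (auto intro!: ennreal_leI powr_mono2)
  finally have "(\<integral>\<^sup>+s. (SUP N. F N s) \<partial>lebesgue) \<noteq> \<infinity>" by (auto simp: top_unique)
  then have "AE s in lebesgue. (SUP N. F N s) \<noteq> \<infinity>"
    by (intro nn_integral_PInf_AE) (auto simp: F_def)
  then show AE: "AE s in lebesgue. summable (\<lambda>j. norm (Q j s))"
  proof eventually_elim
    case (elim s)
    then obtain c where c: "(SUP N. F N s) = ennreal c" "0 \<le> c" by (cases "SUP N. F N s") auto
    have "(\<Sum>j<N. norm (Q j s)) \<le> c powr (1 / p)" for N
    proof -
      have "F N s \<le> ennreal c" unfolding c(1)[symmetric] by (rule SUP_upper) simp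
      then have "norm (T N s) powr p * \<mu> s powr p \<le> c" using c(2) by (simp add: F_def)
      moreover have "norm (T N s) powr p * 1 \<le> norm (T N s) powr p * \<mu> s powr p"
        using \<mu>_ge_1[of s] p by (intro mult_left_mono) (auto simp: ge_one_powr_ge_zero)
      ultimately have "norm (T N s) powr p \<le> c" by simp
      then have "(norm (T N s) powr p) powr (1 / p) \<le> c powr (1 / p)"
        using p by (intro powr_mono2) auto
      then show ?thesis using p by (simp add: powr_powr nT sum_nonneg)
    qed
    then show ?case by (intro summableI_nonneg_bounded) auto
  qed
  have tail: "(\<lambda>s. (\<Sum>j. Q j s) - (\<Sum>j<N. Q j s)) \<in> L \<and> nm (\<lambda>s. (\<Sum>j. Q j s) - (\<Sum>j<N. Q j s)) \<le> (\<Sum>j. a (j + N))" for N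
  proof -
    have "(\<lambda>s. \<Sum>j<M. Q (j + N) s) \<in> L \<and> nm (\<lambda>s. \<Sum>j<M. Q (j + N) s) \<le> (\<Sum>j. a (j + N))" for M
    proof -
      have "(\<lambda>s. \<Sum>j<M. Q (j + N) s) \<in> L \<and> nm (\<lambda>s. \<Sum>j<M. Q (j + N) s) \<le> (\<Sum>j<M. nm (Q (j + N)))"
        by (rule Lp_sum) (use Q in auto)
      moreover have "(\<Sum>j<M. nm (Q (j + N))) \<le> (\<Sum>j<M. a (j + N))" using Qa by (intro sum_mono) auto
      moreover have "(\<Sum>j<M. a (j + N)) \<le> (\<Sum>j. a (j + N))"
        using a0 by (intro sum_le_suminf) (auto simp: summable_iff_shift a)
      ultimately show ?thesis by linarith
    qed
    moreover have "AE s in lebesgue. (\<lambda>M. \<Sum>j<M. Q (j + N) s) \<longlonglongrightarrow> (\<Sum>j. Q j s) - (\<Sum>j<N. Q j s)"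
      using AE
    proof eventually_elim
      case (elim s)
      then have s: "summable (\<lambda>j. Q j s)" by (rule summable_norm_cancel)
      then have "(\<lambda>j. Q (j + N) s) sums ((\<Sum>j. Q j s) - (\<Sum>j<N. Q j s))"
        using sums_split_initial_segment[OF summable_sums[OF s]] by blast
      then show ?case by (simp add: sums_def)
    qed
    ultimately show ?thesis
      using Lp_fatou[of "\<lambda>M s. \<Sum>j<M. Q (j + N) s" "\<Sum>j. a (j + N)" "\<lambda>s. (\<Sum>j. Q j s) - (\<Sum>j<N. Q j s)"]
      by simp
  qed
  show "(\<lambda>s. \<Sum>j. Q j s) \<in> L" using tail[of 0] by simp
  show "nm (\<lambda>s. (\<Sum>j. Q j s) - (\<Sum>j<N. Q j s)) \<le> (\<Sum>j. a (j + N))" using tail by simp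
qed

end

section \<open>Duality and the Bernstein inequality\<close>

lemma continuous_measurable_lebesgue:
  fixes f :: "real \<Rightarrow> complex"
  shows "continuous_on UNIV f \<Longrightarrow> f \<in> borel_measurable lebesgue"
  by (rule measurable_completion) (simp add: borel_measurable_continuous_onI)

lemma holomorphic_measurable_line:
  assumes "G holomorphic_on UNIV"
  shows "(\<lambda>x. G (of_real x + z)) \<in> borel_measurable lebesgue"
    and "(\<lambda>x. G (of_real x)) \<in> borel_measurable lebesgue"
proof -
  have "continuous_on UNIV G" by (rule holomorphic_on_imp_continuous_on[OF assms])
  then show "(\<lambda>x. G (of_real x + z)) \<in> borel_measurable lebesgue" "(\<lambda>x. G (of_real x)) \<in> borel_measurable lebesgue"
    by (auto intro!: continuous_measurable_lebesgue continuous_on_compose2[of UNIV G] continuous_intros)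
qed

text \<open>Dominated convergence along a sequence \<open>X\<^sub>i \<rightarrow> z\<close>: the support of \<open>h\<close> and the bounded sequence keep all
arguments of \<open>G\<close> in one disc, on which \<open>G'\<close> is bounded and so are the difference quotients.\<close>

lemma has_field_derivative_translation_pairing:
  fixes G :: "complex \<Rightarrow> complex" and h :: "real \<Rightarrow> complex"
  assumes G: "G holomorphic_on UNIV" and h[measurable]: "h \<in> borel_measurable lebesgue"
    and bd: "\<And>x. norm (h x) \<le> K" and supp: "\<And>x. R < \<bar>x\<bar> \<Longrightarrow> h x = 0"
  shows "((\<lambda>z. LINT x|lebesgue. G (of_real x + z) * h x) has_field_derivative
           (LINT x|lebesgue. deriv G (of_real x + z) * h x)) (at z)"
    and "integrable lebesgue (\<lambda>x. G (of_real x + z) * h x)"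
    and "0 \<le> B \<Longrightarrow> (\<And>x. \<bar>x\<bar> \<le> R \<Longrightarrow> norm (G (of_real x + z)) \<le> B) \<Longrightarrow>
       norm (LINT x|lebesgue. G (of_real x + z) * h x) \<le> 2 * \<bar>R\<bar> * (B * K)"
proof -
  have K: "0 \<le> K" using norm_ge_zero bd order_trans by blast
  have G'hol: "deriv G holomorphic_on UNIV" by (intro holomorphic_deriv G) auto
  note [measurable] = holomorphic_measurable_line[OF G] holomorphic_measurable_line[OF G'hol]
  have cont: "continuous_on UNIV G" "continuous_on UNIV (deriv G)"
    using G G'hol holomorphic_on_imp_continuous_on by blast+
  define I where "I = {-\<bar>R\<bar>..\<bar>R\<bar>}"
  have hI: "x \<notin> I \<Longrightarrow> h x = 0" for x using supp[of x] by (auto simp: I_def)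
  have indI: "integrable lebesgue (\<lambda>x. c * indicat_real I x)"
      "(LINT x|lebesgue. c * indicat_real I x) = 2 * \<bar>R\<bar> * c" for c
    by (auto simp: I_def)
  have compact_bound: "\<exists>C. \<forall>z\<in>cball 0 r. norm (f z) \<le> C" if "continuous_on UNIV f" for f :: "complex \<Rightarrow> complex" and r
  proof -
    have "bounded (f ` cball 0 r)"
      by (intro compact_imp_bounded compact_continuous_image continuous_on_subset[OF that]) auto
    then show ?thesis unfolding bounded_iff by auto
  qed
  show int: "integrable lebesgue (\<lambda>x. G (of_real x + z) * h x)" for z
  proof -
    obtain C where C: "\<And>w. w \<in> cball 0 (\<bar>R\<bar> + norm z) \<Longrightarrow> norm (G w) \<le> C"
      using compact_bound[OF cont(1)] by metis
    show ?thesis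
    proof (rule Bochner_Integration.integrable_bound[OF indI(1)[of "C * K"]])
      have "norm (G (of_real x + z) * h x) \<le> norm (C * K * indicat_real I x)" for x
      proof (cases "x \<in> I")
        case True
        then have "of_real x + z \<in> cball 0 (\<bar>R\<bar> + norm z)"
          by (auto simp: I_def intro!: order_trans[OF norm_triangle_ineq])
        then have Cx: "norm (G (of_real x + z)) \<le> C" by (rule C)
        then have "norm (G (of_real x + z)) * norm (h x) \<le> C * K"
          using bd[of x] K order_trans[OF norm_ge_zero Cx] by (intro mult_mono) auto
        then show ?thesis using True K order_trans[OF norm_ge_zero Cx] by (simp add: norm_mult abs_mult)
      qed (simp add: hI)
      then show "AE x in lebesgue. norm (G (of_real x + z) * h x) \<le> norm (C * K * indicat_real I x)" by simp
    qed measurable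
  qed
  show "norm (LINT x|lebesgue. G (of_real x + z) * h x) \<le> 2 * \<bar>R\<bar> * (B * K)"
    if B0: "0 \<le> B" and B: "\<And>x. \<bar>x\<bar> \<le> R \<Longrightarrow> norm (G (of_real x + z)) \<le> B"
  proof -
    have "norm (LINT x|lebesgue. G (of_real x + z) * h x) \<le> (LINT x|lebesgue. (B * K) * indicat_real I x)"
    proof (rule Bochner_Integration.integral_norm_bound_integral[OF int indI(1)])
      fix x
      show "norm (G (of_real x + z) * h x) \<le> B * K * indicat_real I x"
      proof (cases "\<bar>x\<bar> \<le> R")
        case True
        then have "x \<in> I" by (auto simp: I_def)
        moreover have "norm (G (of_real x + z)) * norm (h x) \<le> B * K"
          using bd[of x] K B[OF True] order_trans[OF norm_ge_zero B[OF True]] by (intro mult_mono) auto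
        ultimately show ?thesis by (simp add: norm_mult)
      next
        case False
        then show ?thesis using supp[of x] B0 K by simp
      qed
    qed
    then show ?thesis by (simp only: indI)
  qed
  show "((\<lambda>z. LINT x|lebesgue. G (of_real x + z) * h x) has_field_derivative
           (LINT x|lebesgue. deriv G (of_real x + z) * h x)) (at z)"
    unfolding has_field_derivative_iff tendsto_at_iff_sequentially
  proof (intro allI impI)
    fix X :: "nat \<Rightarrow> complex"
    assume X: "\<forall>i. X i \<in> UNIV - {z}" "X \<longlonglongrightarrow> z"
    then have Xz: "X i \<noteq> z" for i by auto
    obtain M where M: "\<And>i. norm (X i) \<le> M"
      using convergent_imp_Bseq[OF convergentI[OF X(2)]] unfolding Bseq_def by auto
    have M0: "0 \<le> M" using M norm_ge_zero order_trans by blast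
    define r where "r = \<bar>R\<bar> + norm z + M"
    obtain C where C: "\<And>w. w \<in> cball 0 r \<Longrightarrow> norm (deriv G w) \<le> C"
      using compact_bound[OF cont(2)] by metis
    have C0: "0 \<le> C" by (rule order_trans[OF norm_ge_zero C[of 0]]) (use M0 in \<open>simp add: r_def\<close>)
    have Gdiff: "(G has_field_derivative deriv G w) (at w within S)" for w S
      using G holomorphic_derivI open_UNIV UNIV_I by (metis has_field_derivative_at_within)
    define q where "q = (\<lambda>i x. (G (of_real x + X i) - G (of_real x + z)) / (X i - z) * h x)"
    have "(\<lambda>i. LINT x|lebesgue. q i x) \<longlonglongrightarrow> (LINT x|lebesgue. deriv G (of_real x + z) * h x)"
    proof (rule integral_dominated_convergence)
      show "(\<lambda>x. deriv G (of_real x + z) * h x) \<in> borel_measurable lebesgue" by measurable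
      show "q i \<in> borel_measurable lebesgue" for i unfolding q_def by measurable
      show "integrable lebesgue (\<lambda>x. C * K * indicat_real I x)" by (rule indI)
      show "AE x in lebesgue. (\<lambda>i. q i x) \<longlonglongrightarrow> deriv G (of_real x + z) * h x"
      proof (rule AE_I2)
        fix x
        have "((\<lambda>w. (G w - G (of_real x + z)) / (w - (of_real x + z))) \<longlongrightarrow> deriv G (of_real x + z)) (at (of_real x + z))"
          using Gdiff[of "of_real x + z" UNIV] by (simp add: has_field_derivative_iff)
        moreover have "filterlim (\<lambda>i. of_real x + X i) (at (of_real x + z)) sequentially"
          unfolding filterlim_at using X Xz by (auto intro!: tendsto_intros)
        ultimately have "((\<lambda>i. (G (of_real x + X i) - G (of_real x + z)) / (of_real x + X i - (of_real x + z))) \<longlongrightarrow> deriv G (of_real x + z)) sequentially"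
          by (rule filterlim_compose)
        then show "(\<lambda>i. q i x) \<longlonglongrightarrow> deriv G (of_real x + z) * h x"
          unfolding q_def by (intro tendsto_intros) simp
      qed
      show "AE x in lebesgue. norm (q i x) \<le> C * K * indicat_real I x" for i
      proof (rule AE_I2)
        fix x
        show "norm (q i x) \<le> C * K * indicat_real I x"
        proof (cases "x \<in> I")
          case True
          have "norm (G (of_real x + X i) - G (of_real x + z)) \<le> C * norm ((of_real x + X i) - (of_real x + z))"
          proof (rule field_differentiable_bound[of "cball 0 r" G "deriv G"])
            have "norm (of_real x + X i) \<le> \<bar>x\<bar> + norm (X i)" "norm (of_real x + z) \<le> \<bar>x\<bar> + norm z"
              using norm_triangle_ineq[of "of_real x" "X i"] norm_triangle_ineq[of "of_real x" z] by simp_all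
            moreover have "\<bar>x\<bar> \<le> \<bar>R\<bar>" using True by (auto simp: I_def)
            ultimately have "norm (of_real x + X i) \<le> r" "norm (of_real x + z) \<le> r"
              using M[of i] M0 norm_ge_zero[of z] unfolding r_def by linarith+
            then show "of_real x + X i \<in> cball 0 r" "of_real x + z \<in> cball 0 r" by simp_all
          qed (use C Gdiff in auto)
          then have "norm ((G (of_real x + X i) - G (of_real x + z)) / (X i - z)) \<le> C"
            using Xz[of i] by (simp add: norm_divide divide_le_eq)
          then have "norm ((G (of_real x + X i) - G (of_real x + z)) / (X i - z)) * norm (h x) \<le> C * K"
            using bd[of x] C0 by (intro mult_mono) auto
          then show ?thesis unfolding q_def norm_mult using True by simp
        qed (simp add: hI q_def)
      qed
    qed
    moreover have "(LINT x|lebesgue. q i x) =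
       ((LINT x|lebesgue. G (of_real x + X i) * h x) - (LINT x|lebesgue. G (of_real x + z) * h x)) / (X i - z)" for i
    proof -
      have "(LINT x|lebesgue. q i x) = (LINT x|lebesgue. (G (of_real x + X i) * h x - G (of_real x + z) * h x) / (X i - z))"
        by (intro Bochner_Integration.integral_cong) (auto simp: q_def field_simps)
      then show ?thesis by (simp add: int)
    qed
    ultimately show "((\<lambda>w. ((LINT x|lebesgue. G (of_real x + w) * h x) - (LINT x|lebesgue. G (of_real x + z) * h x)) / (w - z)) \<circ> X)
       \<longlonglongrightarrow> (LINT x|lebesgue. deriv G (of_real x + z) * h x)"
      by (simp add: o_def)
  qed
qed

context weighted_Lp
begin

text \<open>Elements of the unit ball of the dual space. Boundedness and bounded support make the pairing with any
translate of any entire function finite, whether or not it lies in the space.\<close>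

definition test_function :: "(real \<Rightarrow> complex) \<Rightarrow> bool" where
  "test_function h \<longleftrightarrow> h \<in> borel_measurable lebesgue \<and>
     (\<exists>K R. (\<forall>x. norm (h x) \<le> K) \<and> (\<forall>x. R < \<bar>x\<bar> \<longrightarrow> h x = 0)) \<and>
     (\<forall>v\<in>L. norm (LINT x|lebesgue. v x * h x) \<le> nm v)"

lemma weight_le_on_ball:
  assumes "\<bar>x\<bar> \<le> R" shows "\<mu> x \<le> \<mu> 0 + \<mu> R"
proof (cases "x = 0")
  case True
  then show ?thesis using \<mu>_pos[of R] by simp
next
  case False
  then show ?thesis using weight_mono[OF \<mu>, of x R] \<mu>_pos[of 0] assms by simp
qed

lemma Lp_bounded_support:
  assumes u: "u \<in> borel_measurable lebesgue" and K: "\<And>x. norm (u x) \<le> K" and supp: "\<And>x. R < \<bar>x\<bar> \<Longrightarrow> u x = 0"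
  shows "u \<in> L"
proof -
  note [measurable] = u
  have K0: "0 \<le> K" using K norm_ge_zero order_trans by blast
  have "integrable lebesgue (\<lambda>s. norm (u s) powr p * \<mu> s powr p)"
  proof (rule Bochner_Integration.integrable_bound)
    show "integrable lebesgue (\<lambda>x. (K powr p * (\<mu> 0 + \<mu> R) powr p) * indicat_real {-R..R} x)"
      by (intro integrable_mult_right integrable_real_indicator) (simp_all add: emeasure_lborel_Icc_eq)
    have "norm (u s) powr p * \<mu> s powr p \<le> (K powr p * (\<mu> 0 + \<mu> R) powr p) * indicat_real {-R..R} s" for s
    proof (cases "\<bar>s\<bar> \<le> R")
      case True
      then have "norm (u s) powr p * \<mu> s powr p \<le> K powr p * (\<mu> 0 + \<mu> R) powr p"
        using p K[of s] K0 weight_le_on_ball[OF True] \<mu>_pos[of s] by (intro mult_mono powr_mono2) auto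
      then show ?thesis using True by (auto simp: indicator_def)
    next
      case False
      then show ?thesis using supp[of s] by simp
    qed
    then show "AE s in lebesgue. norm (norm (u s) powr p * \<mu> s powr p) \<le> norm ((K powr p * (\<mu> 0 + \<mu> R) powr p) * indicat_real {-R..R} s)"
      by (intro AE_I2) (simp add: abs_mult)
  qed measurable
  then show ?thesis using u by (simp add: Lp_space_def)
qed

text \<open>The extremal function of Hoelder's inequality, \<open>h = conj(sgn u) |u|^(p-1) \<mu>^p \<parallel>u\<parallel>^(1-p)\<close>. That it is
in the dual unit ball follows from \<open>young_powr\<close> applied to \<open>|v| \<mu> / V\<close> and \<open>|u| \<mu> / \<parallel>u\<parallel>\<close>, with
\<open>V > \<parallel>v\<parallel>\<close>.\<close>

lemma norming_test_function:
  assumes u: "u \<in> L" and K: "\<And>x. norm (u x) \<le> K" and supp: "\<And>x. R < \<bar>x\<bar> \<Longrightarrow> u x = 0"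
    and pos: "0 < nm u"
  obtains h where "test_function h" "\<And>x. u x = 0 \<Longrightarrow> h x = 0" "(LINT x|lebesgue. u x * h x) = of_real (nm u)"
proof -
  note [measurable] = Lp_measurable[OF u]
  define D where "D = nm u"
  have D: "0 < D" using pos by (simp add: D_def)
  have K0: "0 \<le> K" using K norm_ge_zero order_trans by blast
  define g where "g = (\<lambda>x. norm (u x) powr (p - 1) * \<mu> x powr p * D powr (1 - p))"
  define h where "h = (\<lambda>x. cnj (u x) / of_real (norm (u x)) * of_real (g x))"
  have g0: "0 \<le> g x" for x by (simp add: g_def)
  have [measurable]: "(\<lambda>x. cnj (u x)) \<in> borel_measurable lebesgue"
    by (rule measurable_compose[of u lebesgue borel cnj]) (auto intro!: borel_measurable_continuous_onI continuous_intros)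
  have [measurable]: "g \<in> borel_measurable lebesgue" unfolding g_def by measurable
  have h_meas: "h \<in> borel_measurable lebesgue" unfolding h_def by measurable
  have nh: "norm (h x) \<le> g x" for x
    using g0[of x] by (cases "u x = 0") (auto simp: h_def norm_mult norm_divide)
  have h0: "h x = 0" if "u x = 0" for x using that by (simp add: h_def)
  define I where "I = (\<lambda>f :: real \<Rightarrow> complex. \<lambda>s. norm (f s) powr p * \<mu> s powr p)"
  have Iint: "integrable lebesgue (I f)" "(LINT s|lebesgue. I f s) = nm f powr p" if "f \<in> L" for f
  proof -
    show "integrable lebesgue (I f)" using that by (simp add: Lp_space_def I_def)
    show "(LINT s|lebesgue. I f s) = nm f powr p"
      using p unfolding Lp_norm_def I_def by (subst powr_powr) (auto intro!: integral_nonneg_AE)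
  qed
  have bound: "norm (LINT x|lebesgue. v x * h x) \<le> V" if v: "v \<in> L" and V: "nm v < V" for v V
  proof -
    have V0: "0 < V" using V Lp_norm_nonneg[of v] by linarith
    note [measurable] = Lp_measurable[OF v] h_meas
    define W where "W = (\<lambda>x. V / V powr p / p * I v x + V * (1 - 1 / p) / D powr p * I u x)"
    have Wint: "integrable lebesgue W"
      unfolding W_def by (intro Bochner_Integration.integrable_add integrable_mult_right Iint u v)
    have pw: "norm (v x * h x) \<le> W x" for x
    proof -
      define a b where "a = norm (v x) * \<mu> x / V" and "b = norm (u x) * \<mu> x / D"
      have ab: "0 \<le> a" "0 \<le> b" using \<mu>_pos[of x] V0 D by (auto simp: a_def b_def)
      have "norm (v x * h x) \<le> norm (v x) * g x"
        unfolding norm_mult by (intro mult_left_mono nh) auto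
      also have "norm (v x) * g x = V * (a * b powr (p - 1))"
      proof -
        have "b powr (p - 1) = norm (u x) powr (p - 1) * \<mu> x powr (p - 1) * D powr (1 - p)"
          using \<mu>_pos[of x] D by (simp add: b_def powr_mult powr_divide powr_diff)
        moreover have "\<mu> x powr p = \<mu> x * \<mu> x powr (p - 1)"
          using \<mu>_pos[of x] by (simp add: powr_diff)
        ultimately show ?thesis using V0 by (simp add: a_def g_def)
      qed
      also have "\<dots> \<le> V * (a powr p / p + (1 - 1 / p) * b powr p)"
        using V0 young_powr[OF p ab] by (intro mult_left_mono) auto
      also have "\<dots> = W x"
        using \<mu>_pos[of x] V0 D by (simp add: W_def I_def a_def b_def powr_mult powr_divide distrib_left)
      finally show ?thesis .
    qed
    have "integrable lebesgue (\<lambda>x. v x * h x)"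
      by (rule Bochner_Integration.integrable_bound[OF Wint]) (use pw in \<open>auto intro: order_trans[OF pw abs_ge_self]\<close>)
    then have "norm (LINT x|lebesgue. v x * h x) \<le> (LINT x|lebesgue. W x)"
      using pw by (intro Bochner_Integration.integral_norm_bound_integral Wint) auto
    also have "\<dots> = V / V powr p / p * nm v powr p + V * (1 - 1 / p) / D powr p * nm u powr p"
      unfolding W_def by (subst Bochner_Integration.integral_add) (use Iint u v in auto)
    also have "\<dots> \<le> V / V powr p / p * V powr p + V * (1 - 1 / p) / D powr p * D powr p"
      using V V0 p D by (intro add_mono mult_left_mono powr_mono2) (auto simp: D_def)
    also have "\<dots> = V" using V0 D p by (simp add: field_simps)
    finally show ?thesis .
  qed
  show thesis
  proof
    show "test_function h"
      unfolding test_function_def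
    proof (intro conjI ballI h_meas)
      define C where "C = K powr (p - 1) * (\<mu> 0 + \<mu> R) powr p * D powr (1 - p)"
      have "norm (h x) \<le> C" for x
      proof (cases "\<bar>x\<bar> \<le> R")
        case True
        have "g x \<le> C"
          unfolding g_def C_def
          using p K[of x] K0 weight_le_on_ball[OF True] \<mu>_pos[of x]
          by (intro mult_right_mono mult_mono powr_mono2) auto
        then show ?thesis using nh[of x] by linarith
      next
        case False
        then show ?thesis using supp[of x] h0[of x] by (simp add: C_def)
      qed
      moreover have "\<forall>x. R < \<bar>x\<bar> \<longrightarrow> h x = 0" using supp h0 by auto
      ultimately show "\<exists>K R. (\<forall>x. norm (h x) \<le> K) \<and> (\<forall>x. R < \<bar>x\<bar> \<longrightarrow> h x = 0)" by blast
      show "norm (LINT x|lebesgue. v x * h x) \<le> nm v" if "v \<in> L" for v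
        by (rule dense_ge) (rule bound[OF that])
    qed
    show "h x = 0" if "u x = 0" for x using h0[OF that] .
    have "u x * h x = of_real (D powr (1 - p) * I u x)" for x
    proof (cases "u x = 0")
      case False
      then have "u x * h x = of_real (norm (u x) * g x)"
        by (simp add: h_def complex_norm_square[symmetric] power2_eq_square field_simps)
      also have "norm (u x) * g x = D powr (1 - p) * I u x"
        using False by (simp add: g_def I_def powr_diff)
      finally show ?thesis .
    qed (simp add: h_def I_def)
    then have "(LINT x|lebesgue. u x * h x) = of_real (D powr (1 - p) * (LINT x|lebesgue. I u x))"
      using Iint[OF u] by simp
    also have "D powr (1 - p) * (LINT x|lebesgue. I u x) = D"
      using D by (simp add: Iint[OF u] D_def[symmetric] powr_add[symmetric])
    finally show "(LINT x|lebesgue. u x * h x) = of_real (nm u)" by (simp add: D_def)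
  qed
qed

text \<open>A norm bound by duality, which also yields membership in the space: truncations of \<open>u\<close> to bounded
intervals belong to the space and are normed by test functions, and Fatou's lemma removes the
truncation.\<close>

lemma Lp_if_test_le:
  assumes u: "u \<in> borel_measurable lebesgue" and loc: "\<And>R. \<exists>K. \<forall>x. \<bar>x\<bar> \<le> R \<longrightarrow> norm (u x) \<le> K"
    and B: "\<And>h. test_function h \<Longrightarrow> norm (LINT x|lebesgue. u x * h x) \<le> B"
  shows "u \<in> L" "nm u \<le> B"
proof -
  note [measurable] = u
  have B0: "0 \<le> B" using B[of "\<lambda>x. 0"] by (auto simp: test_function_def)
  define v where "v = (\<lambda>N::nat. \<lambda>x. indicator {- real N..real N} x *\<^sub>R u x)"
  have v: "v N \<in> L \<and> nm (v N) \<le> B" for N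
  proof -
    obtain K where K: "\<And>x. \<bar>x\<bar> \<le> real N \<Longrightarrow> norm (u x) \<le> K" using loc by blast
    have K0: "0 \<le> K" using order_trans[OF norm_ge_zero K[of 0]] by simp
    have vK: "norm (v N x) \<le> K" and v0: "real N < \<bar>x\<bar> \<Longrightarrow> v N x = 0" for x
      using K[of x] K0 by (auto simp: v_def indicator_def)
    have vL: "v N \<in> L"
      by (rule Lp_bounded_support[OF _ vK v0]) (unfold v_def, intro borel_measurable_scaleR borel_measurable_indicator u, simp)
    have "nm (v N) \<le> B"
    proof (cases "nm (v N) = 0")
      case False
      then have "0 < nm (v N)" using Lp_norm_nonneg[of "v N"] by linarith
      then obtain h where h: "test_function h" "\<And>x. v N x = 0 \<Longrightarrow> h x = 0"
         "(LINT x|lebesgue. v N x * h x) = of_real (nm (v N))"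
        using norming_test_function[OF vL vK v0] by blast
      have "v N x * h x = u x * h x" for x
        using h(2)[of x] by (auto simp: v_def indicator_def)
      then have "(\<lambda>x. v N x * h x) = (\<lambda>x. u x * h x)" by (rule ext)
      with h(3) have "of_real (nm (v N)) = (LINT x|lebesgue. u x * h x)" by simp
      then have "norm (complex_of_real (nm (v N))) \<le> B" using B[OF h(1)] by simp
      then show ?thesis by simp
    qed (simp add: B0)
    with vL show ?thesis by simp
  qed
  have lim: "(\<lambda>N. v N s) \<longlonglongrightarrow> u s" for s
  proof (rule tendsto_eventually)
    have "\<forall>\<^sub>F N in sequentially. \<bar>s\<bar> \<le> real N"
      using filterlim_real_sequentially by (auto simp: filterlim_at_top)
    then show "\<forall>\<^sub>F N in sequentially. v N s = u s"
      by eventually_elim (auto simp: v_def indicator_def)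
  qed
  show "u \<in> L" "nm u \<le> B" using Lp_fatou[of v B u] v lim u by auto
qed

text \<open>The pairing reduces statements about the norms of translates to statements about one scalar entire
function \<open>H\<close>.\<close>

lemma test_pairing:
  assumes G: "G holomorphic_on UNIV" and h: "test_function h"
  defines "H \<equiv> (\<lambda>z. LINT x|lebesgue. G (of_real x + z) * h x)"
  shows "(H has_field_derivative (LINT x|lebesgue. deriv G (of_real x + z) * h x)) (at z)"
    and "(\<lambda>x. G (of_real x)) \<in> L \<Longrightarrow> norm (H (of_real t)) \<le> \<mu> t * nm (\<lambda>x. G (of_real x))"
    and "(\<lambda>x. G (of_real x)) \<in> L \<Longrightarrow> norm (H 0) \<le> nm (\<lambda>x. G (of_real x))"
    and "entire_exp_type r G \<Longrightarrow> 0 \<le> r \<Longrightarrow> 0 < \<epsilon> \<Longrightarrow> \<exists>C. \<forall>z. norm (H z) \<le> C * exp ((r + \<epsilon>) * norm z)"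
proof -
  obtain K R where KR: "\<And>x. norm (h x) \<le> K" "\<And>x. R < \<bar>x\<bar> \<Longrightarrow> h x = 0" and hm: "h \<in> borel_measurable lebesgue"
    and pair: "\<And>v. v \<in> L \<Longrightarrow> norm (LINT x|lebesgue. v x * h x) \<le> nm v"
    using h by (auto simp: test_function_def)
  note tp = has_field_derivative_translation_pairing[OF G hm KR]
  show "(H has_field_derivative (LINT x|lebesgue. deriv G (of_real x + z) * h x)) (at z)"
    unfolding H_def by (rule tp)
  show "norm (H (of_real t)) \<le> \<mu> t * nm (\<lambda>x. G (of_real x))" if g: "(\<lambda>x. G (of_real x)) \<in> L"
    using order_trans[OF pair[OF Lp_shift(1)[OF g]] Lp_shift(2)[OF g], of t] by (simp add: H_def)
  show "norm (H 0) \<le> nm (\<lambda>x. G (of_real x))" if g: "(\<lambda>x. G (of_real x)) \<in> L"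
    using pair[OF g] by (simp add: H_def)
  show "\<exists>C. \<forall>z. norm (H z) \<le> C * exp ((r + \<epsilon>) * norm z)"
    if exp: "entire_exp_type r G" and r: "0 \<le> r" and \<epsilon>: "0 < \<epsilon>"
  proof -
    obtain C where C: "0 < C" "\<And>z. norm (G z) \<le> C * exp ((r + \<epsilon>) * norm z)"
      using exp \<epsilon> unfolding entire_exp_type_def by blast
    have "norm (H z) \<le> (2 * \<bar>R\<bar> * (C * exp ((r + \<epsilon>) * R) * K)) * exp ((r + \<epsilon>) * norm z)" for z
    proof -
      have "norm (H z) \<le> 2 * \<bar>R\<bar> * ((C * exp ((r + \<epsilon>) * (R + norm z))) * K)"
        unfolding H_def
      proof (rule tp(3))
        show "0 \<le> C * exp ((r + \<epsilon>) * (R + norm z))" using C(1) by simp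
        fix x assume x: "\<bar>x\<bar> \<le> R"
        have "norm (of_real x + z) \<le> R + norm z" using norm_triangle_ineq[of "of_real x" z] x by simp
        then have "(r + \<epsilon>) * norm (of_real x + z) \<le> (r + \<epsilon>) * (R + norm z)" using r \<epsilon> by (intro mult_left_mono) auto
        then have "C * exp ((r + \<epsilon>) * norm (of_real x + z)) \<le> C * exp ((r + \<epsilon>) * (R + norm z))" using C(1) by simp
        then show "norm (G (of_real x + z)) \<le> C * exp ((r + \<epsilon>) * (R + norm z))"
          using C(2)[of "of_real x + z"] by linarith
      qed
      then show ?thesis by (simp add: distrib_left exp_add mult_ac)
    qed
    then show ?thesis by blast
  qed
qed

lemma holomorphic_locally_bounded:
  assumes "G holomorphic_on UNIV"
  shows "\<exists>K. \<forall>x. \<bar>x\<bar> \<le> R \<longrightarrow> norm (G (of_real x)) \<le> K"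
proof -
  have "bounded (G ` cball 0 R)"
    by (intro compact_imp_bounded compact_continuous_image
        continuous_on_subset[OF holomorphic_on_imp_continuous_on[OF assms]]) auto
  then obtain K where "\<forall>w\<in>G ` cball 0 R. norm w \<le> K"
    unfolding bounded_iff by blast
  then have "norm (G (of_real x)) \<le> K" if "\<bar>x\<bar> \<le> R" for x :: real
    using that by (auto simp: image_iff)
  then show ?thesis by blast
qed

text \<open>The scaling \<open>z/r\<close> makes the exponential type of \<open>F(z) = \<phi>(z) H(z/r)\<close> independent of \<open>r\<close>, and costs
nothing in the weight since \<open>\<mu>(t/r) \<le> \<mu>(t)\<close> for \<open>r \<ge> 1\<close>. Because \<open>\<phi>(0) = 1\<close>, the derivative
\<open>F'(0)\<close> is \<open>H'(0)/r + \<phi>'(0) H(0)\<close>, and \<open>H'(0)\<close> is the pairing of \<open>g'\<close> with the test function.\<close>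

lemma bernstein:
  obtains C where "0 \<le> C"
    "\<And>r G. 1 \<le> r \<Longrightarrow> entire_exp_type r G \<Longrightarrow> (\<lambda>s. G (of_real s)) \<in> L \<Longrightarrow>
      (\<lambda>s. deriv G (of_real s)) \<in> L \<and> nm (\<lambda>s. deriv G (of_real s)) \<le> C * r * nm (\<lambda>s. G (of_real s))"
proof -
  obtain \<phi> A B where \<phi>: "\<phi> holomorphic_on UNIV" "\<phi> 0 = 1" and AB: "0 \<le> A" "0 \<le> B"
    "\<And>z. norm (\<phi> z) \<le> exp (A * norm z)" "\<And>t. norm (\<phi> (of_real t)) * \<mu> t \<le> B"
    using weight_multiplier_exists[OF \<mu>] by metis
  define C where "C = B * exp (3 * (A + 2)) + norm (deriv \<phi> 0)"
  have "(\<lambda>s. deriv G (of_real s)) \<in> L \<and> nm (\<lambda>s. deriv G (of_real s)) \<le> C * r * nm (\<lambda>s. G (of_real s))"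
    if r: "1 \<le> r" and G: "entire_exp_type r G" and g: "(\<lambda>s. G (of_real s)) \<in> L" for r G
  proof -
    define M where "M = nm (\<lambda>s. G (of_real s))"
    have M0: "0 \<le> M" by (simp add: M_def)
    have hol: "G holomorphic_on UNIV" using G by (simp add: entire_exp_type_def)
    have hol': "deriv G holomorphic_on UNIV" by (intro holomorphic_deriv hol) auto
    have "norm (LINT x|lebesgue. deriv G (of_real x) * h x) \<le> C * r * M" if h: "test_function h" for h
    proof -
      define H where "H = (\<lambda>z. LINT x|lebesgue. G (of_real x + z) * h x)"
      define D where "D = (\<lambda>z. LINT x|lebesgue. deriv G (of_real x + z) * h x)"
      have H': "(H has_field_derivative D z) (at z)" for z
        unfolding H_def D_def by (rule test_pairing(1)[OF hol h])
      have H_real: "norm (H (of_real t)) \<le> \<mu> t * M" for t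
        unfolding H_def M_def by (rule test_pairing(2)[OF hol h g])
      have H_0: "norm (H 0) \<le> M"
        unfolding H_def M_def by (rule test_pairing(3)[OF hol h g])
      obtain K where K: "\<And>z. norm (H z) \<le> K * exp ((r + r) * norm z)"
      proof -
        have "\<exists>K. \<forall>z. norm (H z) \<le> K * exp ((r + r) * norm z)"
          unfolding H_def using r by (intro test_pairing(4)[OF hol h G]) auto
        then show ?thesis using that by blast
      qed
      define F where "F = (\<lambda>z. \<phi> z * H (z / of_real r))"
      have \<phi>': "(\<phi> has_field_derivative deriv \<phi> z) (at z)" for z
        using \<phi>(1) by (rule holomorphic_derivI) auto
      have F': "(F has_field_derivative (deriv \<phi> z * H (z / of_real r) + D (z / of_real r) / of_real r * \<phi> z)) (at z)" for z
        unfolding F_def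
        using r by (auto intro!: derivative_eq_intros DERIV_chain2[OF H'] \<phi>')
      have "norm (deriv F 0) \<le> (B * M) * exp (3 * (A + 2))"
      proof (rule phragmen_lindelof_deriv[where K = K])
        show "F holomorphic_on UNIV"
          by (rule holomorphic_onI) (use F' in \<open>auto simp: field_differentiable_def\<close>)
        show "0 \<le> B * M" "0 \<le> A + 2" using AB M0 by auto
        show "norm (F z) \<le> K * exp ((A + 2) * norm z)" for z
        proof -
          have "norm (H (z / of_real r)) \<le> K * exp (2 * norm z)"
            using K[of "z / of_real r"] r by (simp add: norm_divide field_simps)
          then have "norm (F z) \<le> exp (A * norm z) * (K * exp (2 * norm z))"
            unfolding F_def norm_mult using AB(3)[of z] by (intro mult_mono) auto
          also have "\<dots> = K * (exp (A * norm z) * exp (2 * norm z))" by simp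
          also have "exp (A * norm z) * exp (2 * norm z) = exp ((A + 2) * norm z)"
            by (simp only: distrib_right exp_add)
          finally show ?thesis .
        qed
        show "norm (F (of_real t)) \<le> B * M" for t
        proof -
          have "\<mu> (t / r) \<le> \<mu> t"
          proof (cases "t = 0")
            case False
            then show ?thesis
              using r by (intro weight_mono[OF \<mu>]) (auto simp: abs_divide divide_le_eq mult_left_le_one_le)
          qed simp
          then have "norm (H (of_real (t / r))) \<le> \<mu> t * M"
            using H_real[of "t / r"] mult_right_mono[of "\<mu> (t / r)" "\<mu> t" M] M0 by linarith
          then have "norm (F (of_real t)) \<le> norm (\<phi> (of_real t)) * (\<mu> t * M)"
            unfolding F_def norm_mult by (intro mult_left_mono) auto
          also have "\<dots> \<le> B * M" using mult_right_mono[OF AB(4)[of t] M0] by (simp add: mult.assoc)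
          finally show ?thesis .
        qed
      qed
      moreover have "D 0 = of_real r * (deriv F 0 - deriv \<phi> 0 * H 0)"
        using DERIV_imp_deriv[OF F'[of 0]] r \<phi>(2) by (simp add: field_simps)
      then have "norm (D 0) = r * norm (deriv F 0 - deriv \<phi> 0 * H 0)"
        using r by (simp add: norm_mult)
      moreover have "norm (deriv F 0 - deriv \<phi> 0 * H 0) \<le> norm (deriv F 0) + norm (deriv \<phi> 0) * norm (H 0)"
        using norm_triangle_ineq4[of "deriv F 0" "deriv \<phi> 0 * H 0"] by (simp add: norm_mult)
      moreover have "norm (deriv \<phi> 0) * norm (H 0) \<le> norm (deriv \<phi> 0) * M"
        by (intro mult_left_mono H_0) auto
      ultimately have "norm (D 0) \<le> r * ((B * M) * exp (3 * (A + 2)) + norm (deriv \<phi> 0) * M)"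
        using r by (smt (verit) mult_left_mono)
      also have "\<dots> = C * r * M" by (simp add: C_def algebra_simps)
      finally show ?thesis by (simp add: D_def)
    qed
    from Lp_if_test_le[OF holomorphic_measurable_line(2)[OF hol'] holomorphic_locally_bounded[OF hol'] this]
    show ?thesis by (simp add: M_def)
  qed
  moreover have "0 \<le> C" using AB by (simp add: C_def)
  ultimately show thesis using that by blast
qed

text \<open>Cauchy's estimate on circles of radius 1.\<close>

lemma entire_exp_type_deriv:
  assumes G: "entire_exp_type r G" and r: "0 \<le> r"
  shows "entire_exp_type r (deriv G)"
  unfolding entire_exp_type_def
proof (intro conjI allI impI)
  have hol: "G holomorphic_on UNIV" using G by (simp add: entire_exp_type_def)
  show "deriv G holomorphic_on UNIV" by (intro holomorphic_deriv hol) auto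
  fix \<epsilon> :: real assume \<epsilon>: "0 < \<epsilon>"
  obtain C where C: "0 < C" "\<And>z. norm (G z) \<le> C * exp ((r + \<epsilon>) * norm z)"
    using G \<epsilon> unfolding entire_exp_type_def by blast
  have "norm (deriv G z) \<le> C * exp (r + \<epsilon>) * exp ((r + \<epsilon>) * norm z)" for z
  proof -
    have "norm ((deriv ^^ 1) G z) \<le> fact 1 * (C * exp ((r + \<epsilon>) * (1 + norm z))) / 1 ^ 1"
    proof (rule Cauchy_inequality)
      show "G holomorphic_on ball z 1" "continuous_on (cball z 1) G"
        using hol holomorphic_on_imp_continuous_on holomorphic_on_subset by blast+
      fix w assume "norm (z - w) = 1"
      then have "norm w \<le> 1 + norm z" using norm_triangle_ineq2[of w z] by (simp add: norm_minus_commute)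
      then have "(r + \<epsilon>) * norm w \<le> (r + \<epsilon>) * (1 + norm z)" using r \<epsilon> by (intro mult_left_mono) auto
      then have "C * exp ((r + \<epsilon>) * norm w) \<le> C * exp ((r + \<epsilon>) * (1 + norm z))" using C(1) by simp
      then show "norm (G w) \<le> C * exp ((r + \<epsilon>) * (1 + norm z))" using C(2)[of w] by linarith
    qed simp
    then show ?thesis by (simp add: distrib_left exp_add mult_ac)
  qed
  then show "\<exists>C>0. \<forall>z. norm (deriv G z) \<le> C * exp ((r + \<epsilon>) * norm z)"
    using C(1) by (intro exI[of _ "C * exp (r + \<epsilon>)"]) auto
qed

text \<open>By duality this is the mean value inequality for the pairing \<open>H\<close> on the segment from 0 to \<open>h\<close>.\<close>

lemma Lp_norm_difference_le:
  assumes G: "G holomorphic_on UNIV" and g: "(\<lambda>s. G (of_real s)) \<in> L" and g': "(\<lambda>s. deriv G (of_real s)) \<in> L"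
    and h: "0 \<le> h"
  shows "nm (\<lambda>s. G (of_real (s + h)) - G (of_real s)) \<le> h * \<mu> h * nm (\<lambda>s. deriv G (of_real s))"
proof (rule Lp_if_test_le(2))
  define M where "M = nm (\<lambda>s. deriv G (of_real s))"
  have G': "deriv G holomorphic_on UNIV" by (intro holomorphic_deriv G) auto
  have hol: "(\<lambda>z. G (z + of_real h) - G z) holomorphic_on UNIV"
    by (intro holomorphic_intros G holomorphic_on_compose[of "\<lambda>z. z + of_real h" UNIV G, unfolded o_def] holomorphic_on_subset[OF G]) auto
  show "(\<lambda>s. G (of_real (s + h)) - G (of_real s)) \<in> borel_measurable lebesgue"
    using holomorphic_measurable_line(2)[OF hol] by simp
  show "\<exists>K. \<forall>x. \<bar>x\<bar> \<le> R \<longrightarrow> norm (G (of_real (x + h)) - G (of_real x)) \<le> K" for R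
    using holomorphic_locally_bounded[OF hol, of R] by simp
  fix \<psi> assume \<psi>: "test_function \<psi>"
  define H where "H = (\<lambda>z. LINT x|lebesgue. G (of_real x + z) * \<psi> x)"
  define D where "D = (\<lambda>z. LINT x|lebesgue. deriv G (of_real x + z) * \<psi> x)"
  have H': "(H has_field_derivative D z) (at z)" for z
    unfolding H_def D_def by (rule test_pairing(1)[OF G \<psi>])
  have D_real: "norm (D (of_real t)) \<le> \<mu> t * M" for t
    unfolding D_def M_def by (rule test_pairing(2)[OF G' \<psi> g'])
  have D_0: "norm (D 0) \<le> M"
    unfolding D_def M_def by (rule test_pairing(3)[OF G' \<psi> g'])
  have "norm (H (of_real h) - H 0) \<le> (\<mu> h * M) * norm (of_real h - (0::complex))"
  proof (rule field_differentiable_bound[of "closed_segment 0 (of_real h)" H D])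
    show "(H has_field_derivative D z) (at z within closed_segment 0 (of_real h))" for z
      by (rule has_field_derivative_at_within) (rule H')
    fix z :: complex assume "z \<in> closed_segment 0 (of_real h)"
    then obtain u where u: "z = of_real (u * h)" "0 \<le> u" "u \<le> 1"
      by (auto simp: in_segment scaleR_conv_of_real)
    show "norm (D z) \<le> \<mu> h * M"
    proof (cases "u * h = 0")
      case True
      have "norm (D 0) \<le> 1 * M" using D_0 by simp
      also have "\<dots> \<le> \<mu> h * M" using \<mu>_ge_1[of h] by (intro mult_right_mono) (auto simp: M_def)
      finally show ?thesis unfolding u(1) True by simp
    next
      case False
      have "norm (D z) \<le> \<mu> (u * h) * M" unfolding u(1) by (rule D_real)
      also have "\<dots> \<le> \<mu> h * M"
        using False u h by (intro mult_right_mono weight_mono[OF \<mu>]) (auto simp: M_def abs_mult mult_left_le_one_le)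
      finally show ?thesis .
    qed
  qed auto
  moreover have "(LINT x|lebesgue. (G (of_real (x + h)) - G (of_real x)) * \<psi> x) = H (of_real h) - H 0"
  proof -
    obtain K R where KR: "\<And>x. norm (\<psi> x) \<le> K" "\<And>x. R < \<bar>x\<bar> \<Longrightarrow> \<psi> x = 0" and hm: "\<psi> \<in> borel_measurable lebesgue"
      using \<psi> by (auto simp: test_function_def)
    have int: "integrable lebesgue (\<lambda>x. G (of_real x + z) * \<psi> x)" for z
      by (rule has_field_derivative_translation_pairing(2)[OF G hm KR(1)]) (rule KR(2))
    show ?thesis
      using Bochner_Integration.integral_diff[OF int[of "of_real h"] int[of 0]]
      by (simp add: H_def left_diff_distrib)
  qed
  ultimately show "norm (LINT x|lebesgue. (G (of_real (x + h)) - G (of_real x)) * \<psi> x) \<le> h * \<mu> h * nm (\<lambda>s. deriv G (of_real s))"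
    using h by (simp add: M_def mult_ac)
qed

end

section \<open>Finite differences\<close>

text \<open>The \<open>k\<close>-th forward difference of step \<open>h\<close>, whose norms define the modulus of continuity.\<close>

definition fdiff :: "nat \<Rightarrow> real \<Rightarrow> (real \<Rightarrow> complex) \<Rightarrow> real \<Rightarrow> complex" where
  "fdiff k h u s = (\<Sum>j=0..k. (-1) ^ (k - j) * of_nat (k choose j) * u (s + real j * h))"

text \<open>Pascal's rule, followed by a shift of the summation index.\<close>

lemma binomial_difference_step:
  fixes a :: "nat \<Rightarrow> complex"
  shows "(\<Sum>j=0..Suc k. (-1) ^ (Suc k - j) * of_nat (Suc k choose j) * a j) =
    (\<Sum>j=0..k. (-1) ^ (k - j) * of_nat (k choose j) * (a (Suc j) - a j))"
proof -
  have "(\<Sum>j=0..k. (-1) ^ (k - j) * of_nat (k choose j) * a j) =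
    (\<Sum>j=0..Suc k. (-1) ^ (k - j) * of_nat (k choose j) * a j)" by simp
  also have "\<dots> = (-1) ^ k * a 0 + (\<Sum>j=0..k. (-1) ^ (k - Suc j) * of_nat (k choose Suc j) * a (Suc j))"
    by (subst sum.atLeast0_atMost_Suc_shift) simp
  also have "(\<Sum>j=0..k. (-1) ^ (k - Suc j) * of_nat (k choose Suc j) * a (Suc j)) =
     - (\<Sum>j=0..k. (-1) ^ (k - j) * of_nat (k choose Suc j) * a (Suc j))"
    unfolding sum_negf[symmetric]
  proof (rule sum.cong)
    fix j assume "j \<in> {0..k}"
    show "(-1) ^ (k - Suc j) * of_nat (k choose Suc j) * a (Suc j) = - ((-1) ^ (k - j) * of_nat (k choose Suc j) * a (Suc j))"
    proof (cases "j < k")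
      case True
      then have "k - j = Suc (k - Suc j)" by simp
      then show ?thesis by simp
    qed simp
  qed simp
  finally have *: "(\<Sum>j=0..k. (-1) ^ (k - j) * of_nat (k choose j) * a j) =
    (-1) ^ k * a 0 - (\<Sum>j=0..k. (-1) ^ (k - j) * of_nat (k choose Suc j) * a (Suc j))" by simp
  have "(\<Sum>j=0..Suc k. (-1) ^ (Suc k - j) * of_nat (Suc k choose j) * a j) =
    - ((-1) ^ k * a 0) + (\<Sum>j=0..k. (-1) ^ (k - j) * of_nat (Suc k choose Suc j) * a (Suc j))"
    by (subst sum.atLeast0_atMost_Suc_shift) simp
  also have "(\<Sum>j=0..k. (-1) ^ (k - j) * of_nat (Suc k choose Suc j) * a (Suc j)) =
     (\<Sum>j=0..k. (-1) ^ (k - j) * of_nat (k choose j) * a (Suc j)) + (\<Sum>j=0..k. (-1) ^ (k - j) * of_nat (k choose Suc j) * a (Suc j))"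
    unfolding sum.distrib[symmetric] by (intro sum.cong) (auto simp: algebra_simps)
  finally show ?thesis using * by (simp add: right_diff_distrib sum_subtractf)
qed

lemma fdiff_Suc: "fdiff (Suc k) h u s = fdiff k h u (s + h) - fdiff k h u s"
  unfolding fdiff_def binomial_difference_step
  by (simp add: right_diff_distrib sum_subtractf algebra_simps)

lemma fdiff_add: "fdiff k h (\<lambda>s. u s + v s) s = fdiff k h u s + fdiff k h v s"
  by (simp add: fdiff_def distrib_left sum.distrib)

lemma fdiff_sum: "fdiff k h (\<lambda>s. \<Sum>i\<in>I. u i s) s = (\<Sum>i\<in>I. fdiff k h (u i) s)"
  unfolding fdiff_def sum_distrib_left by (rule sum.swap)

context weighted_Lp
begin

text \<open>The \<open>k\<close>-th difference of \<open>G\<close> is the restriction of an entire function \<open>G\<^sub>k\<close>, whose derivative is the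
\<open>k\<close>-th difference of \<open>G'\<close>. One further difference of \<open>G\<^sub>k\<close> costs a factor \<open>h \<mu>(h)\<close> and a derivative.\<close>

lemma Lp_norm_fdiff_entire_le:
  assumes "G holomorphic_on UNIV" "0 \<le> h" "\<And>l. l \<le> k \<Longrightarrow> (\<lambda>s. (deriv ^^ l) G (of_real s)) \<in> L"
  shows "fdiff k h (\<lambda>s. G (of_real s)) \<in> L \<and>
    nm (fdiff k h (\<lambda>s. G (of_real s))) \<le> (h * \<mu> h) ^ k * nm (\<lambda>s. (deriv ^^ k) G (of_real s))"
  using assms
proof (induction k arbitrary: G)
  case 0
  then have "(\<lambda>s. G (of_real s)) \<in> L" by (metis funpow_0 le_refl)
  moreover have "fdiff 0 h (\<lambda>s. G (of_real s)) = (\<lambda>s. G (of_real s))" by (simp add: fdiff_def fun_eq_iff)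
  ultimately show ?case by simp
next
  case (Suc k)
  define Gk where "Gk = (\<lambda>z. \<Sum>j=0..k. (-1) ^ (k - j) * of_nat (k choose j) * G (z + of_real (real j * h)))"
  have fd: "fdiff k h (\<lambda>s. G (of_real s)) = (\<lambda>s. Gk (of_real s))"
    by (simp add: fdiff_def Gk_def fun_eq_iff)
  have G': "(G has_field_derivative deriv G z) (at z)" for z
    using Suc.prems(1) by (rule holomorphic_derivI) auto
  have Gk': "(Gk has_field_derivative (\<Sum>j=0..k. (-1) ^ (k - j) * of_nat (k choose j) * deriv G (z + of_real (real j * h)))) (at z)" for z
    unfolding Gk_def by (auto intro!: derivative_eq_intros DERIV_chain2[OF G'] sum.cong)
  have holk: "Gk holomorphic_on UNIV"
    by (rule holomorphic_onI) (use Gk' in \<open>auto simp: field_differentiable_def\<close>)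
  have fd': "fdiff k h (\<lambda>s. deriv G (of_real s)) = (\<lambda>s. deriv Gk (of_real s))"
    by (simp add: DERIV_imp_deriv[OF Gk'] fdiff_def fun_eq_iff)
  have "\<And>l. l \<le> k \<Longrightarrow> (\<lambda>s. (deriv ^^ l) G (of_real s)) \<in> L" using Suc.prems(3) by auto
  from Suc.IH[OF Suc.prems(1,2) this] have gk: "(\<lambda>s. Gk (of_real s)) \<in> L" by (simp add: fd)
  have holG': "deriv G holomorphic_on UNIV" by (intro holomorphic_deriv Suc.prems(1)) auto
  have derivs: "(\<lambda>s. (deriv ^^ l) (deriv G) (of_real s)) \<in> L" if "l \<le> k" for l
    using Suc.prems(3)[of "Suc l"] that by (simp add: funpow_swap1)
  have IH: "(\<lambda>s. deriv Gk (of_real s)) \<in> L"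
     "nm (\<lambda>s. deriv Gk (of_real s)) \<le> (h * \<mu> h) ^ k * nm (\<lambda>s. (deriv ^^ Suc k) G (of_real s))"
    using Suc.IH[OF holG' Suc.prems(2) derivs] by (simp_all add: fd' funpow_swap1)
  have eq: "fdiff (Suc k) h (\<lambda>s. G (of_real s)) = (\<lambda>s. Gk (of_real (s + h)) - Gk (of_real s))"
    using fd by (simp add: fdiff_Suc fun_eq_iff)
  have "nm (fdiff (Suc k) h (\<lambda>s. G (of_real s))) \<le> h * \<mu> h * nm (\<lambda>s. deriv Gk (of_real s))"
    unfolding eq by (rule Lp_norm_difference_le[OF holk gk IH(1) Suc.prems(2)])
  also have "\<dots> \<le> h * \<mu> h * ((h * \<mu> h) ^ k * nm (\<lambda>s. (deriv ^^ Suc k) G (of_real s)))"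
    using Suc.prems(2) \<mu>_pos[of h] by (intro mult_left_mono IH(2)) auto
  finally have "nm (fdiff (Suc k) h (\<lambda>s. G (of_real s))) \<le> (h * \<mu> h) ^ Suc k * nm (\<lambda>s. (deriv ^^ Suc k) G (of_real s))"
    by (simp add: mult_ac)
  moreover have "fdiff (Suc k) h (\<lambda>s. G (of_real s)) \<in> L"
    unfolding eq by (rule Lp_diff(1)[OF Lp_shift(1)[OF gk] gk])
  ultimately show ?case by simp
qed

lemma Lp_norm_fdiff_le:
  assumes g: "g \<in> L" and h: "0 \<le> h" "h \<le> 1"
  shows "fdiff k h g \<in> L \<and> nm (fdiff k h g) \<le> 2 ^ k * (\<mu> 0 + \<mu> (real k)) * nm g"
proof -
  have summand: "(\<lambda>s. (-1) ^ (k - j) * of_nat (k choose j) * g (s + real j * h)) \<in> L \<and>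
     nm (\<lambda>s. (-1) ^ (k - j) * of_nat (k choose j) * g (s + real j * h)) \<le> real (k choose j) * ((\<mu> 0 + \<mu> (real k)) * nm g)" if j: "j \<le> k" for j
  proof -
    have sh: "(\<lambda>s. g (s + real j * h)) \<in> L" "nm (\<lambda>s. g (s + real j * h)) \<le> \<mu> (real j * h) * nm g"
      using Lp_shift[OF g] by auto
    have "real j * h \<le> real k * 1" using j h by (intro mult_mono) auto
    then have "\<mu> (real j * h) \<le> \<mu> 0 + \<mu> (real k)" using h by (intro weight_le_on_ball) auto
    then have "nm (\<lambda>s. g (s + real j * h)) \<le> (\<mu> 0 + \<mu> (real k)) * nm g"
      using sh(2) mult_right_mono[of _ _ "nm g"] by (meson Lp_norm_nonneg order_trans)
    then have "real (k choose j) * nm (\<lambda>s. g (s + real j * h)) \<le> real (k choose j) * ((\<mu> 0 + \<mu> (real k)) * nm g)"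
      by (rule mult_left_mono) simp
    moreover have "norm ((-1) ^ (k - j) * of_nat (k choose j) :: complex) = real (k choose j)"
      by (simp add: norm_mult norm_power)
    ultimately show ?thesis
      using Lp_cmult[OF sh(1), of "(-1) ^ (k - j) * of_nat (k choose j)"] Lp_norm_cmult[OF sh(1), of "(-1) ^ (k - j) * of_nat (k choose j)"] by auto
  qed
  have "fdiff k h g \<in> L \<and> nm (fdiff k h g) \<le> (\<Sum>j=0..k. nm (\<lambda>s. (-1) ^ (k - j) * of_nat (k choose j) * g (s + real j * h)))"
    unfolding fdiff_def[abs_def] by (rule Lp_sum) (use summand in auto)
  moreover have "(\<Sum>j=0..k. nm (\<lambda>s. (-1) ^ (k - j) * of_nat (k choose j) * g (s + real j * h)))
      \<le> (\<Sum>j=0..k. real (k choose j) * ((\<mu> 0 + \<mu> (real k)) * nm g))"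
    using summand by (intro sum_mono) auto
  moreover have "(\<Sum>j=0..k. real (k choose j)) = 2 ^ k"
    using choose_row_sum[of k] by (simp add: atLeast0AtMost flip: of_nat_sum)
  ultimately show ?thesis by (simp add: mult.assoc flip: sum_distrib_right)
qed

end

section \<open>Differentiation of indefinite integrals\<close>

text \<open>The weak-type bound for the Hardy-Littlewood maximal function by Vitali covering: the fivefold
enlargements of disjoint intervals of radius \<open>r\<close> have length \<open>10 r\<close>. The exceptional set is enclosed
in a measurable one, since only outer measure matters below.\<close>

lemma maximal_inequality:
  fixes w :: "real \<Rightarrow> real"
  assumes w: "integrable lebesgue w" "\<And>x. 0 \<le> w x" and lam: "0 < l"
  obtains T where "T \<in> lmeasurable" "measure lebesgue T \<le> 10 / l * (LINT x|lebesgue. w x)"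
    "\<And>x r. 0 < r \<Longrightarrow> r \<le> 1 \<Longrightarrow> l * r < (LINT t:cball x r|lebesgue. w t) \<Longrightarrow> x \<in> T"
proof -
  define E where "E = {x. \<exists>r. 0 < r \<and> r \<le> 1 \<and> l * r < (LINT t:cball x r|lebesgue. w t)}"
  obtain r where r: "\<And>x. x \<in> E \<Longrightarrow> 0 < r x \<and> r x \<le> 1 \<and> l * r x < (LINT t:cball x (r x)|lebesgue. w t)"
  proof -
    have "\<forall>x\<in>E. \<exists>r. 0 < r \<and> r \<le> 1 \<and> l * r < (LINT t:cball x r|lebesgue. w t)" by (simp add: E_def)
    from bchoice[OF this] show ?thesis using that by blast
  qed
  obtain C where C: "countable C" "C \<subseteq> E"
    "pairwise (\<lambda>i j. disjnt (cball i (r i)) (cball j (r j))) C" "E \<subseteq> (\<Union>i\<in>C. cball i (5 * r i))"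
  proof (rule Vitali_covering_lemma_cballs[where S = E and K = E and a = "\<lambda>x. x" and r = r and B = 1])
    show "E \<subseteq> (\<Union>i\<in>E. cball i (r i))" using r by (force simp: less_imp_le)
  qed (use r in auto)
  have wint: "set_integrable lebesgue A w" if "A \<in> sets lebesgue" for A
    unfolding set_integrable_def by (rule integrable_mult_indicator[OF that w(1)])
  have bound: "measure lebesgue (\<Union>i\<in>F. cball i (5 * r i)) \<le> 10 / l * (LINT x|lebesgue. w x)"
    if F: "F \<subseteq> C" "finite F" for F
  proof -
    have rF: "0 < r i" "l * r i < (LINT t:cball i (r i)|lebesgue. w t)" if "i \<in> F" for i
      using r[of i] C(2) F that by auto
    have "measure lebesgue (\<Union>i\<in>F. cball i (5 * r i)) \<le> (\<Sum>i\<in>F. measure lebesgue (cball i (5 * r i)))"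
      using F by (intro measure_UNION_le) auto
    also have "\<dots> = (\<Sum>i\<in>F. 10 / l * (l * r i))"
      using rF lam by (intro sum.cong) (auto simp: cball_eq_atLeastAtMost less_imp_le)
    also have "\<dots> \<le> (\<Sum>i\<in>F. 10 / l * (LINT t:cball i (r i)|lebesgue. w t))"
      using rF(2) lam by (intro sum_mono mult_left_mono) (auto simp: less_imp_le)
    also have "\<dots> = 10 / l * (LINT t:(\<Union>i\<in>F. cball i (r i))|lebesgue. w t)"
      unfolding sum_distrib_left[symmetric]
      by (subst set_integral_finite_Union)
        (use F C(3) in \<open>auto simp: disjoint_family_on_def pairwise_def disjnt_def intro!: wint\<close>)
    also have "\<dots> \<le> 10 / l * (LINT x|lebesgue. w x)"
    proof (rule mult_left_mono)
      have "(\<Union>i\<in>F. cball i (r i)) \<in> sets lebesgue" using F by (intro sets.finite_UN) auto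
      then show "(LINT t:(\<Union>i\<in>F. cball i (r i))|lebesgue. w t) \<le> (LINT x|lebesgue. w x)"
        unfolding set_lebesgue_integral_def
        by (intro integral_mono w integrable_mult_indicator) (auto simp: indicator_def w(2))
    qed (use lam in auto)
    finally show ?thesis .
  qed
  show thesis
  proof (rule that[of "\<Union>i\<in>C. cball i (5 * r i)"])
    show "(\<Union>i\<in>C. cball i (5 * r i)) \<in> lmeasurable"
      by (rule fmeasurable_UN_bound[OF C(1) _ bound]) auto
    show "measure lebesgue (\<Union>i\<in>C. cball i (5 * r i)) \<le> 10 / l * (LINT x|lebesgue. w x)"
      by (rule measure_UN_bound[OF C(1) _ bound]) auto
    show "x \<in> (\<Union>i\<in>C. cball i (5 * r i))" if "0 < s" "s \<le> 1" "l * s < (LINT t:cball x s|lebesgue. w t)" for x s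
    proof -
      have "x \<in> E" using that unfolding E_def by blast
      then show ?thesis using C(4) by blast
    qed
  qed
qed

lemma set_integrable_continuous_Ioo:
  fixes f :: "real \<Rightarrow> complex"
  assumes "continuous_on UNIV f"
  shows "set_integrable lebesgue {a<..<b} f"
proof -
  have "f absolutely_integrable_on cbox a b"
    by (rule absolutely_integrable_continuous) (rule continuous_on_subset[OF assms subset_UNIV])
  then show ?thesis by (rule set_integrable_subset) auto
qed

lemma set_integrable_const_Ioo: "set_integrable lebesgue {a<..<b::real} (\<lambda>x. c :: 'a :: {banach, second_countable_topology})"
  unfolding set_integrable_def
  by (intro integrable_scaleR_left integrable_real_indicator)
    (use bounded_set_imp_lmeasurable[of "{a<..<b}"] in \<open>auto simp: fmeasurable_def\<close>)

lemma set_integral_const_Ioo: "a \<le> b \<Longrightarrow> (LINT x:{a<..<b::real}|lebesgue. c :: 'a :: {banach, second_countable_topology}) = (b - a) *\<^sub>R c"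
  by (subst set_integral_const) (simp_all add: less_top[symmetric])

text \<open>A primitive \<open>F\<close> of a locally integrable \<open>v\<close>. Approximability of \<open>v\<close> by continuous functions is part of
the locale because in the application the approximants come with \<open>v\<close>: they are the derivatives of
entire functions that converge to \<open>F\<close>.\<close>

locale locally_integrable_primitive =
  fixes v F :: "real \<Rightarrow> complex"
  assumes v_int: "\<And>a b. set_integrable lebesgue {a<..<b} v"
    and primitive: "\<And>a b. a \<le> b \<Longrightarrow> F b - F a = (LINT x:{a<..<b}|lebesgue. v x)"
    and approx: "\<And>a b \<epsilon>. 0 < \<epsilon> \<Longrightarrow> \<exists>c. continuous_on UNIV c \<and> (LINT x:{a<..<b}|lebesgue. norm (v x - c x)) < \<epsilon>"
begin

text \<open>Split \<open>v\<close> into a continuous function, bounded by \<open>M\<close> on \<open>[a, b]\<close>, and a remainder of small integral.\<close>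

lemma primitive_locally_AC: "locally_AC F"
  unfolding locally_AC_def
proof (intro allI impI)
  fix a b \<epsilon> :: real assume \<epsilon>: "0 < \<epsilon>"
  obtain c where c: "continuous_on UNIV c" "(LINT x:{a<..<b}|lebesgue. norm (v x - c x)) < \<epsilon> / 2"
    using approx[of "\<epsilon> / 2" a b] \<epsilon> by auto
  have "bounded (c ` {a..b})"
    by (intro compact_imp_bounded compact_continuous_image continuous_on_subset[OF c(1)]) auto
  then obtain M0 where M0: "\<forall>z\<in>c ` {a..b}. norm z \<le> M0" unfolding bounded_iff by blast
  define M where "M = max M0 1"
  have M: "0 < M" "\<And>x. x \<in> {a..b} \<Longrightarrow> norm (c x) \<le> M" using M0 by (auto simp: M_def le_max_iff_disj)
  have diff_int: "set_integrable lebesgue {s<..<t} (\<lambda>x. norm (v x - c x))" for s t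
    by (intro set_integrable_norm set_integral_diff v_int set_integrable_continuous_Ioo c)
  show "\<exists>\<delta>>0. \<forall>(N::nat) u w. (\<forall>i<N. a \<le> u i \<and> u i \<le> w i \<and> w i \<le> b) \<and>
     disjoint_family_on (\<lambda>i. {u i<..<w i}) {..<N} \<and> (\<Sum>i<N. w i - u i) < \<delta> \<longrightarrow>
     (\<Sum>i<N. norm (F (w i) - F (u i))) < \<epsilon>"
  proof (intro exI[of _ "\<epsilon> / (2 * M)"] conjI allI impI)
    show "0 < \<epsilon> / (2 * M)" using \<epsilon> M by simp
    fix N :: nat and u w :: "nat \<Rightarrow> real"
    assume "(\<forall>i<N. a \<le> u i \<and> u i \<le> w i \<and> w i \<le> b) \<and>
     disjoint_family_on (\<lambda>i. {u i<..<w i}) {..<N} \<and> (\<Sum>i<N. w i - u i) < \<epsilon> / (2 * M)"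
    then have uw: "\<And>i. i < N \<Longrightarrow> a \<le> u i \<and> u i \<le> w i \<and> w i \<le> b"
      and disj: "disjoint_family_on (\<lambda>i. {u i<..<w i}) {..<N}" and small: "(\<Sum>i<N. w i - u i) < \<epsilon> / (2 * M)"
      by auto
    have "norm (F (w i) - F (u i)) \<le> (LINT x:{u i<..<w i}|lebesgue. norm (v x - c x)) + M * (w i - u i)" if i: "i < N" for i
    proof -
      have "norm (F (w i) - F (u i)) \<le> (LINT x:{u i<..<w i}|lebesgue. norm (v x))"
        using uw[OF i] by (simp add: primitive set_integral_norm_bound v_int)
      also have "\<dots> \<le> (LINT x:{u i<..<w i}|lebesgue. norm (v x - c x) + M)"
      proof (rule set_integral_mono)
        fix x assume "x \<in> {u i<..<w i}"
        then have "norm (c x) \<le> M" using uw[OF i] by (intro M) auto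
        then show "norm (v x) \<le> norm (v x - c x) + M" using norm_triangle_sub[of "v x" "c x"] by simp
      qed (intro set_integrable_norm v_int set_integral_add diff_int set_integrable_const_Ioo)+
      also have "\<dots> = (LINT x:{u i<..<w i}|lebesgue. norm (v x - c x)) + M * (w i - u i)"
        using uw[OF i] diff_int by (simp add: set_integral_add set_integrable_const_Ioo set_integral_const_Ioo)
      finally show ?thesis .
    qed
    then have "(\<Sum>i<N. norm (F (w i) - F (u i))) \<le> (\<Sum>i<N. (LINT x:{u i<..<w i}|lebesgue. norm (v x - c x)) + M * (w i - u i))"
      by (intro sum_mono) auto
    also have "\<dots> = (LINT x:(\<Union>i<N. {u i<..<w i})|lebesgue. norm (v x - c x)) + M * (\<Sum>i<N. w i - u i)"
      by (simp add: sum.distrib set_integral_finite_Union[OF _ disj] diff_int flip: sum_distrib_left)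
    also have "(LINT x:(\<Union>i<N. {u i<..<w i})|lebesgue. norm (v x - c x)) \<le> (LINT x:{a<..<b}|lebesgue. norm (v x - c x))"
    proof -
      have "(\<Union>i<N. {u i<..<w i}) \<subseteq> {a<..<b}" using uw by force
      moreover have "(\<Union>i<N. {u i<..<w i}) \<in> sets lebesgue" by auto
      ultimately show ?thesis by (intro set_integral_mono_subset diff_int) auto
    qed
    also have "M * (\<Sum>i<N. w i - u i) < \<epsilon> / 2" using small M by (simp add: field_simps)
    finally show "(\<Sum>i<N. norm (F (w i) - F (u i))) < \<epsilon>" using c(2) by simp
  qed
qed

text \<open>With \<open>c\<close> continuous and close to \<open>v\<close>, the mean of \<open>|v - v(x)|\<close> over a short interval at \<open>x\<close> is at most
the mean of \<open>|v - c|\<close>, plus the oscillation of \<open>c\<close>, plus \<open>|c(x) - v(x)|\<close>. The first term is controlled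
off a small set by the maximal inequality, the second by continuity, the third off a small set by
Markov's inequality.\<close>

lemma bad_set_negligible:
  assumes \<epsilon>: "0 < \<epsilon>"
  shows "negligible {x\<in>{-R<..<R}. \<not> (\<forall>\<^sub>F y in at x. norm (F y - F x - (y - x) *\<^sub>R v x) \<le> \<epsilon> * norm (y - x))}"
    (is "negligible ?B")
  unfolding negligible_outer_le
proof (intro allI impI)
  fix e :: real assume e: "0 < e"
  define \<eta> where "\<eta> = \<epsilon> / 3"
  have \<eta>: "0 < \<eta>" using \<epsilon> by (simp add: \<eta>_def)
  define J where "J = {-R-1<..<R+1}"
  obtain c where c: "continuous_on UNIV c" "(LINT x:J|lebesgue. norm (v x - c x)) < e * \<eta> / 11"
    using approx[of "e * \<eta> / 11" "-R-1" "R+1"] e \<eta> by (auto simp: J_def)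
  define w where "w = (\<lambda>x. indicator J x *\<^sub>R norm (v x - c x))"
  have diff_int: "set_integrable lebesgue {s<..<t} (\<lambda>x. norm (v x - c x))" for s t
    by (intro set_integrable_norm set_integral_diff v_int set_integrable_continuous_Ioo c)
  have w: "integrable lebesgue w" "\<And>x. 0 \<le> w x" "(LINT x|lebesgue. w x) < e * \<eta> / 11"
    using diff_int[of "-R-1" "R+1"] c(2) by (auto simp: w_def J_def set_integrable_def set_lebesgue_integral_def)
  obtain T where T: "T \<in> lmeasurable" "measure lebesgue T \<le> 10 / \<eta> * (LINT x|lebesgue. w x)"
    "\<And>x r. 0 < r \<Longrightarrow> r \<le> 1 \<Longrightarrow> \<eta> * r < (LINT t:cball x r|lebesgue. w t) \<Longrightarrow> x \<in> T"
    using maximal_inequality[OF w(1,2) \<eta>] by blast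
  define S where "S = {x \<in> space lebesgue. \<eta> \<le> w x}"
  have S_meas: "S \<in> sets lebesgue" unfolding S_def using w(1) by measurable
  have S_emeasure: "emeasure lebesgue S \<le> ennreal (1 / \<eta> * (LINT x|lebesgue. w x))"
    unfolding S_def by (rule integral_Markov_inequality) (use w \<eta> in auto)
  have S: "S \<in> lmeasurable"
    by (rule fmeasurableI[OF S_meas]) (use S_emeasure in \<open>auto intro: le_less_trans\<close>)
  have S_le: "measure lebesgue S \<le> 1 / \<eta> * (LINT x|lebesgue. w x)"
  proof -
    have "0 \<le> 1 / \<eta> * (LINT x|lebesgue. w x)" using \<eta> w(2) by (intro mult_nonneg_nonneg integral_nonneg_AE) auto
    then show ?thesis
      using S_emeasure S by (simp add: emeasure_eq_measure2)
  qed
  have "?B \<subseteq> T \<union> S"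
  proof
    fix x assume x: "x \<in> ?B"
    show "x \<in> T \<union> S"
    proof (rule ccontr)
      assume nx: "x \<notin> T \<union> S"
      then have wx: "w x < \<eta>" by (auto simp: S_def)
      have xJ: "x \<in> J" "x \<in> {-R<..<R}" using x by (auto simp: J_def)
      then have cx: "norm (c x - v x) < \<eta>" using wx by (simp add: w_def norm_minus_commute)
      have max: "(LINT t:cball x r|lebesgue. w t) \<le> \<eta> * r" if "0 < r" "r \<le> 1" for r
        using T(3)[OF that, of x] nx by force
      have "isCont c x" using c(1) by (simp add: continuous_on_eq_continuous_at)
      then obtain d where d: "0 < d" "\<And>y. \<bar>y - x\<bar> < d \<Longrightarrow> norm (c y - c x) < \<eta>"
        unfolding continuous_at_eps_delta using \<eta> by (metis dist_norm real_norm_def)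
      have key: "norm ((LINT t:{a<..<b}|lebesgue. v t) - (b - a) *\<^sub>R v x) \<le> \<epsilon> * (b - a)"
        if ab: "a \<le> x" "x \<le> b" "a < b" "b - a < d" "b - a \<le> 1" for a b
      proof -
        have sub: "{a<..<b} \<subseteq> cball x (b - a)" "{a<..<b} \<subseteq> J" "{a<..<b} \<subseteq> {y. \<bar>y - x\<bar> < d}"
          using ab xJ by (auto simp: dist_real_def J_def)
        have "norm ((LINT t:{a<..<b}|lebesgue. v t) - (b - a) *\<^sub>R v x) = norm (LINT t:{a<..<b}|lebesgue. v t - v x)"
          using ab by (simp add: set_integral_diff v_int set_integrable_const_Ioo set_integral_const_Ioo)
        also have "\<dots> \<le> (LINT t:{a<..<b}|lebesgue. norm (v t - v x))"
          by (intro set_integral_norm_bound set_integral_diff v_int set_integrable_const_Ioo)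
        also have "\<dots> \<le> (LINT t:{a<..<b}|lebesgue. norm (v t - c t) + 2 * \<eta>)"
        proof (rule set_integral_mono)
          fix t assume "t \<in> {a<..<b}"
          then have "norm (c t - c x) < \<eta>" using sub by (intro d) auto
          moreover have "v t - v x = (v t - c t) + ((c t - c x) + (c x - v x))" by simp
          then have "norm (v t - v x) \<le> norm (v t - c t) + (norm (c t - c x) + norm (c x - v x))"
            by (metis norm_triangle_ineq norm_triangle_mono order_refl)
          ultimately show "norm (v t - v x) \<le> norm (v t - c t) + 2 * \<eta>" using cx by simp
        qed (intro set_integrable_norm v_int set_integral_add set_integral_diff diff_int set_integrable_const_Ioo)+
        also have "\<dots> = (LINT t:{a<..<b}|lebesgue. norm (v t - c t)) + 2 * \<eta> * (b - a)"
          using ab diff_int by (simp add: set_integral_add set_integrable_const_Ioo set_integral_const_Ioo)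
        also have "(LINT t:{a<..<b}|lebesgue. norm (v t - c t)) \<le> (LINT t:cball x (b - a)|lebesgue. w t)"
          unfolding set_lebesgue_integral_def
        proof (rule integral_mono)
          show "integrable lebesgue (\<lambda>t. indicat_real {a<..<b} t *\<^sub>R norm (v t - c t))"
            using diff_int[of a b] by (simp add: set_integrable_def)
          show "integrable lebesgue (\<lambda>t. indicat_real (cball x (b - a)) t *\<^sub>R w t)"
            by (rule integrable_mult_indicator[OF _ w(1)]) simp
          show "indicat_real {a<..<b} t *\<^sub>R norm (v t - c t) \<le> indicat_real (cball x (b - a)) t *\<^sub>R w t" for t
          proof (cases "t \<in> {a<..<b}")
            case True
            then have "t \<in> cball x (b - a)" "t \<in> J" using sub by blast+
            then show ?thesis using True by (simp add: w_def)
          next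
            case False
            then show ?thesis using w(2)[of t] by simp
          qed
        qed
        also have "\<dots> \<le> \<eta> * (b - a)" using ab by (intro max) auto
        also have "\<eta> * (b - a) + 2 * \<eta> * (b - a) = \<epsilon> * (b - a)" by (simp add: \<eta>_def)
        finally show ?thesis by simp
      qed
      have "\<forall>\<^sub>F y in at x. norm (F y - F x - (y - x) *\<^sub>R v x) \<le> \<epsilon> * norm (y - x)"
        unfolding eventually_at
      proof (intro exI[of _ "min d 1"] conjI ballI impI)
        show "0 < min d 1" using d by simp
        fix y assume "y \<noteq> x \<and> dist y x < min d 1"
        then have y: "y \<noteq> x" "\<bar>y - x\<bar> < d" "\<bar>y - x\<bar> \<le> 1" by (auto simp: dist_real_def)
        show "norm (F y - F x - (y - x) *\<^sub>R v x) \<le> \<epsilon> * norm (y - x)"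
        proof (cases "x < y")
          case True
          then show ?thesis using key[of x y] y primitive[of x y] by simp
        next
          case False
          then have "y < x" using y by simp
          then have "norm (F x - F y - (x - y) *\<^sub>R v x) \<le> \<epsilon> * (x - y)"
            using key[of y x] y primitive[of y x] by simp
          moreover have "F y - F x - (y - x) *\<^sub>R v x = - (F x - F y - (x - y) *\<^sub>R v x)"
            by (simp add: algebra_simps)
          ultimately show ?thesis using \<open>y < x\<close> by (simp only: norm_minus_cancel) simp
        qed
      qed
      then show False using x by simp
    qed
  qed
  moreover have "T \<union> S \<in> lmeasurable" using T S by (intro fmeasurable.Un)
  moreover have "measure lebesgue (T \<union> S) \<le> e"
  proof -
    have "measure lebesgue (T \<union> S) \<le> measure lebesgue T + measure lebesgue S"
      using T S by (intro measure_Un_le) (auto dest: fmeasurableD)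
    also have "\<dots> \<le> 11 / \<eta> * (LINT x|lebesgue. w x)" using T(2) S_le by (simp add: add_divide_distrib)
    also have "\<dots> \<le> 11 / \<eta> * (e * \<eta> / 11)" using w(3) \<eta> by (intro mult_left_mono) auto
    also have "\<dots> = e" using \<eta> by simp
    finally show ?thesis .
  qed
  ultimately show "\<exists>T. ?B \<subseteq> T \<and> T \<in> lmeasurable \<and> measure lebesgue T \<le> e" by blast
qed

lemma AE_has_vector_derivative: "AE x in lebesgue. (F has_vector_derivative v x) (at x)"
proof -
  define B where "B = (\<lambda>(R::nat) (k::nat). {x\<in>{-real R<..<real R}. \<not> (\<forall>\<^sub>F y in at x. norm (F y - F x - (y - x) *\<^sub>R v x) \<le> (1 / Suc k) * norm (y - x))})"
  have neg: "negligible (\<Union>R. \<Union>k. B R k)"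
    unfolding B_def by (intro negligible_Union_nat bad_set_negligible) simp
  have "(F has_vector_derivative v x) (at x)" if x: "x \<notin> (\<Union>R. \<Union>k. B R k)" for x
    unfolding has_vector_derivative_def has_derivative_within_alt2
  proof (intro conjI allI impI)
    show "bounded_linear (\<lambda>h. h *\<^sub>R v x)" by (rule bounded_linear_scaleR_left)
    fix e :: real assume "0 < e"
    then obtain k where k: "1 / Suc k < e" using nat_approx_posE by blast
    obtain R where "\<bar>x\<bar> < real R" using reals_Archimedean2 by blast
    then have "\<forall>\<^sub>F y in at x. norm (F y - F x - (y - x) *\<^sub>R v x) \<le> (1 / Suc k) * norm (y - x)"
      using x by (auto simp: B_def abs_less_iff)
    then show "\<forall>\<^sub>F y in at x. norm (F y - F x - (y - x) *\<^sub>R v x) \<le> e * norm (y - x)"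
    proof eventually_elim
      case (elim y)
      have "(1 / Suc k) * norm (y - x) \<le> e * norm (y - x)" using k by (intro mult_right_mono) auto
      with elim show ?case by linarith
    qed
  qed
  then have "{x \<in> space lebesgue. \<not> (F has_vector_derivative v x) (at x)} \<subseteq> (\<Union>R. \<Union>k. B R k)" by blast
  then show ?thesis
    using neg unfolding eventually_ae_filter negligible_iff_null_sets by auto
qed

end

section \<open>The graph of differentiation\<close>

text \<open>Absolute continuity applied to a single interval.\<close>

lemma locally_AC_imp_continuous:
  assumes "locally_AC F"
  shows "continuous_on UNIV F"
  unfolding continuous_on_iff
proof (intro ballI allI impI)
  fix x e :: real assume e: "0 < e"
  obtain \<delta> where \<delta>: "0 < \<delta>" "\<And>(N::nat) u v. (\<forall>i<N. x - 1 \<le> u i \<and> u i \<le> v i \<and> v i \<le> x + 1) \<and>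
      disjoint_family_on (\<lambda>i. {u i<..<v i}) {..<N} \<and> (\<Sum>i<N. v i - u i) < \<delta> \<Longrightarrow>
      (\<Sum>i<N. norm (F (v i) - F (u i))) < e"
    using assms e unfolding locally_AC_def by meson
  show "\<exists>d>0. \<forall>x'\<in>UNIV. dist x' x < d \<longrightarrow> dist (F x') (F x) < e"
  proof (intro exI[of _ "min \<delta> 1"] conjI ballI impI)
    show "0 < min \<delta> 1" using \<delta> by simp
    fix y assume y: "dist y x < min \<delta> 1"
    have "(\<Sum>i<(1::nat). norm (F (max x y) - F (min x y))) < e"
      by (rule \<delta>(2)) (use y in \<open>auto simp: dist_real_def disjoint_family_on_def\<close>)
    then show "dist (F y) (F x) < e"
      by (cases "x \<le> y") (auto simp: dist_norm norm_minus_commute)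
  qed
qed

lemma continuous_AE_eq_imp_eq:
  fixes f g :: "real \<Rightarrow> complex"
  assumes "continuous_on UNIV f" "continuous_on UNIV g" "AE s in lebesgue. f s = g s"
  shows "f = g"
proof -
  have "open {s. f s \<noteq> g s}" using assms by (intro open_Collect_neq)
  moreover have "negligible {s. f s \<noteq> g s}"
  proof -
    obtain N where "{s \<in> space lebesgue. f s \<noteq> g s} \<subseteq> N" "N \<in> null_sets lebesgue"
      using assms(3) unfolding eventually_ae_filter by auto
    then have "negligible N" "{s. f s \<noteq> g s} \<subseteq> N" by (simp_all add: negligible_iff_null_sets)
    then show ?thesis by (rule negligible_subset)
  qed
  ultimately have "{s. f s \<noteq> g s} = {}" using open_not_negligible by blast
  then show ?thesis by auto
qed

text \<open>The absolutely continuous representatives agree almost everywhere, hence everywhere, hence have the same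
derivatives.\<close>

lemma deriv_graph_unique:
  assumes 1: "(x, y) \<in> deriv_graph p \<mu>" and 2: "(x', y') \<in> deriv_graph p \<mu>"
    and eq: "AE s in lebesgue. x s = x' s"
  shows "AE s in lebesgue. y s = y' s"
proof -
  obtain F where F: "locally_AC F" "AE s in lebesgue. F s = x s" "AE s in lebesgue. (F has_vector_derivative y s) (at s)"
    using 1 by (auto simp: deriv_graph_def)
  obtain F' where F': "locally_AC F'" "AE s in lebesgue. F' s = x' s" "AE s in lebesgue. (F' has_vector_derivative y' s) (at s)"
    using 2 by (auto simp: deriv_graph_def)
  have "AE s in lebesgue. F s = F' s"
    using F(2) F'(2) eq by eventually_elim simp
  then have "F = F'"
    by (intro continuous_AE_eq_imp_eq locally_AC_imp_continuous F F')
  have "AE s in lebesgue. (F has_vector_derivative y' s) (at s)"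
    unfolding \<open>F = F'\<close> by (rule F'(3))
  with F(3) show ?thesis
    by eventually_elim (rule vector_derivative_unique_at)
qed

lemma deriv_graph_relpow_unique:
  assumes "(x, y) \<in> deriv_graph p \<mu> ^^ n" "(x', y') \<in> deriv_graph p \<mu> ^^ n" "AE s in lebesgue. x s = x' s"
  shows "AE s in lebesgue. y s = y' s"
  using assms
proof (induction n arbitrary: y y')
  case (Suc n)
  obtain z where z: "(x, z) \<in> deriv_graph p \<mu> ^^ n" "(z, y) \<in> deriv_graph p \<mu>"
    by (rule relpow_Suc_E[OF Suc.prems(1)])
  obtain z' where z': "(x', z') \<in> deriv_graph p \<mu> ^^ n" "(z', y') \<in> deriv_graph p \<mu>"
    by (rule relpow_Suc_E[OF Suc.prems(2)])
  show ?case
    using deriv_graph_unique[OF z(2) z'(2)] Suc.IH[OF z(1) z'(1) Suc.prems(3)] by blast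
qed simp

lemma deriv_graph_relpow_range:
  assumes "(x, y) \<in> deriv_graph p \<mu> ^^ n" "1 \<le> n"
  shows "y \<in> Lp_space p \<mu>"
proof -
  obtain k where "n = Suc k" using assms(2) by (cases n) auto
  with assms(1) obtain z where "(z, y) \<in> deriv_graph p \<mu>" by (metis relpow_Suc_E)
  then show ?thesis by (simp add: deriv_graph_def)
qed

lemma deriv_graph_cong:
  assumes "(x, y) \<in> deriv_graph p \<mu>" "x' \<in> Lp_space p \<mu>" "AE s in lebesgue. x s = x' s"
  shows "(x', y) \<in> deriv_graph p \<mu>"
proof -
  obtain F where F: "locally_AC F" "AE s in lebesgue. F s = x s" "AE s in lebesgue. (F has_vector_derivative y s) (at s)"
    using assms(1) by (auto simp: deriv_graph_def)
  have "AE s in lebesgue. F s = x' s" using F(2) assms(3) by eventually_elim simp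
  with F assms(1,2) show ?thesis by (auto simp: deriv_graph_def)
qed

lemma holomorphic_continuous_line:
  assumes "G holomorphic_on UNIV"
  shows "continuous_on UNIV (\<lambda>s::real. G (of_real s))"
proof -
  have "continuous_on UNIV G" by (rule holomorphic_on_imp_continuous_on[OF assms])
  then show ?thesis by (rule continuous_on_compose2) (auto intro: continuous_intros)
qed

lemma holomorphic_integral_deriv:
  assumes G: "G holomorphic_on UNIV" and ab: "a \<le> b"
  shows "G (of_real b) - G (of_real a) = (LINT x:{a<..<b}|lebesgue. deriv G (of_real x))"
proof -
  have "((\<lambda>x. G (of_real x)) has_vector_derivative deriv G (of_real x)) (at x within {a..b})" for x :: real
  proof -
    have "(G has_field_derivative deriv G (of_real x)) (at (of_real x))"
      using G by (rule holomorphic_derivI) auto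
    then show ?thesis by (rule has_vector_derivative_real_field)
  qed
  then have "((\<lambda>x. deriv G (of_real x)) has_integral G (of_real b) - G (of_real a)) {a..b}"
    by (intro fundamental_theorem_of_calculus ab) auto
  then have "integral {a<..<b} (\<lambda>x. deriv G (of_real x)) = G (of_real b) - G (of_real a)"
    by (simp add: integral_unique flip: integral_open_interval_real)
  moreover have "set_integrable lebesgue {a<..<b} (\<lambda>x. deriv G (of_real x))"
  proof (rule set_integrable_continuous_Ioo)
    have "deriv G holomorphic_on UNIV" by (intro holomorphic_deriv G) auto
    then show "continuous_on UNIV (\<lambda>x::real. deriv G (of_real x))"
      by (rule holomorphic_continuous_line)
  qed
  ultimately show ?thesis by (simp add: set_lebesgue_integral_eq_integral)
qed

context weighted_Lp
begin

text \<open>As \<open>\<mu> \<ge> 1\<close>, the inequality \<open>young_powr\<close> with \<open>b = 1\<close> bounds \<open>|f|/V\<close> by \<open>(|f| \<mu> / V)^p + 1\<close>. For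
\<open>V > \<parallel>f\<parallel>\<close> the first summand has integral at most 1.\<close>

lemma Lp_locally_integrable:
  assumes f: "f \<in> L"
  shows "set_integrable lebesgue {a<..<b} f"
    and "a \<le> b \<Longrightarrow> (LINT x:{a<..<b}|lebesgue. norm (f x)) \<le> (1 + (b - a)) * nm f"
proof -
  note [measurable] = Lp_measurable[OF f]
  define I where "I = (\<lambda>s. norm (f s) powr p * \<mu> s powr p)"
  have I: "integrable lebesgue I" "(LINT s|lebesgue. I s) = nm f powr p" "\<And>s. 0 \<le> I s"
    using f p unfolding Lp_norm_def I_def by (auto simp: Lp_space_def powr_powr intro!: integral_nonneg_AE)
  define W where "W = (\<lambda>V s. V / V powr p * I s + V * indicat_real {a<..<b} s)"
  have ind: "integrable lebesgue (\<lambda>s. indicat_real {a<..<b} s)"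
    using set_integrable_const_Ioo[of a b "1::real"] by (simp add: set_integrable_def)
  have W: "integrable lebesgue (W V)" for V
    unfolding W_def by (intro Bochner_Integration.integrable_add integrable_mult_right I ind)
  have pw: "norm (indicat_real {a<..<b} s *\<^sub>R f s) \<le> W V s" if V: "0 < V" for V s
  proof -
    have "norm (f s) \<le> V / V powr p * I s + V"
    proof -
      define u where "u = norm (f s) * \<mu> s / V"
      have u0: "0 \<le> u" using V \<mu>_pos[of s] by (simp add: u_def)
      have "norm (f s) * 1 \<le> norm (f s) * \<mu> s" using \<mu>_ge_1[of s] by (intro mult_left_mono) auto
      also have "\<dots> = V * (u * 1 powr (p - 1))" using V by (simp add: u_def)
      also have "\<dots> \<le> V * (u powr p / p + (1 - 1 / p) * 1 powr p)"
        using V u0 p by (intro mult_left_mono young_powr) auto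
      also have "\<dots> \<le> V * (u powr p / 1 + 1)"
        using V p by (intro mult_left_mono add_mono divide_left_mono) auto
      also have "\<dots> = V / V powr p * I s + V"
        using V \<mu>_pos[of s] by (simp add: u_def I_def powr_divide powr_mult distrib_left)
      finally show ?thesis by simp
    qed
    then show ?thesis using V I(3)[of s] by (auto simp: W_def indicator_def)
  qed
  show int: "set_integrable lebesgue {a<..<b} f"
    unfolding set_integrable_def
  proof (rule Bochner_Integration.integrable_bound[OF W[of 1]])
    show "(\<lambda>x. indicat_real {a<..<b} x *\<^sub>R f x) \<in> borel_measurable lebesgue"
      by (intro borel_measurable_scaleR borel_measurable_indicator Lp_measurable[OF f]) simp
    show "AE x in lebesgue. norm (indicat_real {a<..<b} x *\<^sub>R f x) \<le> norm (W 1 x)"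
      unfolding real_norm_def by (intro AE_I2 order_trans[OF pw abs_ge_self]) simp
  qed
  show "(LINT x:{a<..<b}|lebesgue. norm (f x)) \<le> (1 + (b - a)) * nm f" if ab: "a \<le> b"
  proof -
    have "(LINT x:{a<..<b}|lebesgue. norm (f x)) / (1 + (b - a)) \<le> V" if V: "nm f < V" for V
    proof -
      have V0: "0 < V" using V Lp_norm_nonneg[of f] by linarith
      have "(LINT x:{a<..<b}|lebesgue. norm (f x)) \<le> (LINT x|lebesgue. W V x)"
        unfolding set_lebesgue_integral_def
      proof (rule integral_mono[OF _ W])
        show "integrable lebesgue (\<lambda>x. indicat_real {a<..<b} x *\<^sub>R norm (f x))"
          using set_integrable_norm[OF int] by (simp add: set_integrable_def)
        show "indicat_real {a<..<b} x *\<^sub>R norm (f x) \<le> W V x" for x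
          using pw[OF V0, of x] by simp
      qed
      also have "\<dots> = V / V powr p * nm f powr p + V * (b - a)"
        using ab ind I set_integral_const_Ioo[OF ab, of "1::real"]
        by (simp add: W_def Bochner_Integration.integral_add set_lebesgue_integral_def)
      also have "\<dots> \<le> V / V powr p * V powr p + V * (b - a)"
        using V V0 p by (intro add_mono mult_left_mono powr_mono2) auto
      also have "\<dots> = (1 + (b - a)) * V" using V0 by (simp add: algebra_simps)
      finally show ?thesis using ab by (simp add: divide_le_eq mult.commute)
    qed
    then have "(LINT x:{a<..<b}|lebesgue. norm (f x)) / (1 + (b - a)) \<le> nm f" by (rule dense_ge)
    then show ?thesis using ab by (simp add: divide_le_eq mult.commute)
  qed
qed

lemma Lp_norm_zero_imp_AE:
  assumes f: "f \<in> L" "nm f = 0"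
  shows "AE s in lebesgue. f s = 0"
proof -
  note [measurable] = Lp_measurable[OF f(1)]
  have "pint f = 0" using f p by (simp add: pint_Lp)
  then have "AE s in lebesgue. ennreal (norm (f s) powr p * \<mu> s powr p) = 0"
    unfolding pint_def by (subst (asm) nn_integral_0_iff_AE) auto
  then show ?thesis
  proof eventually_elim
    case (elim s)
    then have "norm (f s) powr p * \<mu> s powr p \<le> 0" by (simp add: ennreal_eq_0_iff)
    moreover have "0 < \<mu> s powr p" using \<mu>_pos[of s] by simp
    ultimately have "norm (f s) powr p = 0" by (metis mult_le_0_iff not_le powr_ge_zero order_antisym)
    then show ?case by simp
  qed
qed

text \<open>Increments of \<open>G\<^sub>N\<close> are integrals of \<open>G\<^sub>N'\<close>, which converge since norm convergence implies local
\<open>L\<^sub>1\<close> convergence. So convergence of \<open>G\<^sub>N\<close> at one point implies convergence everywhere, and the limit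
is a primitive of \<open>y\<close> that agrees with \<open>x\<close> almost everywhere.\<close>

lemma deriv_graph_limit:
  assumes G: "\<And>N. G N holomorphic_on UNIV" and x: "x \<in> L" and y: "y \<in> L"
    and G': "\<And>N. (\<lambda>s. deriv (G N) (of_real s)) \<in> L"
    and lim: "AE s in lebesgue. (\<lambda>N. G N (of_real s)) \<longlonglongrightarrow> x s"
    and lim': "(\<lambda>N. nm (\<lambda>s. y s - deriv (G N) (of_real s))) \<longlonglongrightarrow> 0"
  shows "(x, y) \<in> deriv_graph p \<mu>"
proof -
  have loc: "(\<lambda>N. (LINT s:{a<..<b}|lebesgue. norm (y s - deriv (G N) (of_real s)))) \<longlonglongrightarrow> 0" if ab: "a \<le> b" for a b
  proof (rule tendsto_sandwich[of "\<lambda>_. 0" _ _ "\<lambda>N. (1 + (b - a)) * nm (\<lambda>s. y s - deriv (G N) (of_real s))"])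
    have "(\<lambda>N. (1 + (b - a)) * nm (\<lambda>s. y s - deriv (G N) (of_real s))) \<longlonglongrightarrow> (1 + (b - a)) * 0"
      by (intro tendsto_intros lim')
    then show "(\<lambda>N. (1 + (b - a)) * nm (\<lambda>s. y s - deriv (G N) (of_real s))) \<longlonglongrightarrow> 0" by simp
    show "\<forall>\<^sub>F N in sequentially. (LINT s:{a<..<b}|lebesgue. norm (y s - deriv (G N) (of_real s)))
       \<le> (1 + (b - a)) * nm (\<lambda>s. y s - deriv (G N) (of_real s))"
      by (intro always_eventually allI Lp_locally_integrable(2) Lp_diff y G' ab)
    show "\<forall>\<^sub>F N in sequentially. 0 \<le> (LINT s:{a<..<b}|lebesgue. norm (y s - deriv (G N) (of_real s)))"
      unfolding set_lebesgue_integral_def by (intro always_eventually allI integral_nonneg_AE) auto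
  qed auto
  have incr: "(\<lambda>N. G N (of_real b) - G N (of_real a)) \<longlonglongrightarrow> (LINT s:{a<..<b}|lebesgue. y s)" if ab: "a \<le> b" for a b
  proof -
    define A where "A = (LINT s:{a<..<b}|lebesgue. y s)"
    have "norm (A - (G N (of_real b) - G N (of_real a)))
       \<le> (LINT s:{a<..<b}|lebesgue. norm (y s - deriv (G N) (of_real s)))" for N
    proof -
    have "A - (G N (of_real b) - G N (of_real a))
      = (LINT s:{a<..<b}|lebesgue. y s - deriv (G N) (of_real s))"
      unfolding holomorphic_integral_deriv[OF G ab] A_def
      by (intro set_integral_diff(2)[symmetric] Lp_locally_integrable y G')
    also have "norm \<dots> \<le> (LINT s:{a<..<b}|lebesgue. norm (y s - deriv (G N) (of_real s)))"
      by (intro set_integral_norm_bound Lp_locally_integrable Lp_diff y G')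
    finally show ?thesis .
    qed
    then have "(\<lambda>N. A - (G N (of_real b) - G N (of_real a))) \<longlonglongrightarrow> 0"
      by (intro Lim_null_comparison[OF _ loc[OF ab]] always_eventually allI)
    from tendsto_diff[OF tendsto_const[of A] this] show ?thesis by (simp add: A_def)
  qed
  obtain s0 where s0: "(\<lambda>N. G N (of_real s0)) \<longlonglongrightarrow> x s0"
  proof -
    obtain Z where Z: "{s \<in> space lebesgue. \<not> (\<lambda>N. G N (of_real s)) \<longlonglongrightarrow> x s} \<subseteq> Z" "Z \<in> null_sets lebesgue"
      using lim unfolding eventually_ae_filter by auto
    have "Z \<noteq> UNIV" using Z(2) non_negligible_UNIV by (auto simp: negligible_iff_null_sets)
    then show ?thesis using Z(1) that by auto
  qed
  have conv: "convergent (\<lambda>N. G N (of_real s))" for s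
  proof (cases "s0 \<le> s")
    case True
    have "(\<lambda>N. (G N (of_real s) - G N (of_real s0)) + G N (of_real s0)) \<longlonglongrightarrow> (LINT t:{s0<..<s}|lebesgue. y t) + x s0"
      by (intro tendsto_add incr True s0)
    then show ?thesis by (auto simp: convergent_def)
  next
    case False
    have "(\<lambda>N. G N (of_real s0) - (G N (of_real s0) - G N (of_real s))) \<longlonglongrightarrow> x s0 - (LINT t:{s<..<s0}|lebesgue. y t)"
      using False by (intro tendsto_diff incr s0) auto
    then show ?thesis by (auto simp: convergent_def)
  qed
  define F where "F = (\<lambda>s. lim (\<lambda>N. G N (of_real s)))"
  have F: "(\<lambda>N. G N (of_real s)) \<longlonglongrightarrow> F s" for s
    using conv[of s] by (simp add: F_def convergent_LIMSEQ_iff)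
  interpret locally_integrable_primitive y F
  proof
    show "set_integrable lebesgue {a<..<b} y" for a b by (rule Lp_locally_integrable(1)[OF y])
    show "F b - F a = (LINT s:{a<..<b}|lebesgue. y s)" if "a \<le> b" for a b
      using tendsto_diff[OF F[of b] F[of a]] incr[OF that] LIMSEQ_unique by blast
    show "\<exists>c. continuous_on UNIV c \<and> (LINT s:{a<..<b}|lebesgue. norm (y s - c s)) < \<epsilon>" if \<epsilon>: "0 < \<epsilon>" for a b \<epsilon>
    proof (cases "a \<le> b")
      case True
      have "\<forall>\<^sub>F N in sequentially. (LINT s:{a<..<b}|lebesgue. norm (y s - deriv (G N) (of_real s))) < \<epsilon>"
        using loc[OF True] \<epsilon> by (rule order_tendstoD)
      then obtain N where N: "(LINT s:{a<..<b}|lebesgue. norm (y s - deriv (G N) (of_real s))) < \<epsilon>"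
        by (auto simp: eventually_sequentially)
      have "deriv (G N) holomorphic_on UNIV" by (intro holomorphic_deriv G) auto
      then have "continuous_on UNIV (\<lambda>s::real. deriv (G N) (of_real s))"
        by (rule holomorphic_continuous_line)
      with N show ?thesis by blast
    next
      case False
      then show ?thesis using \<epsilon> by (intro exI[of _ "\<lambda>_. 0"]) (simp add: set_lebesgue_integral_def)
    qed
  qed
  have "AE s in lebesgue. F s = x s"
    using lim by eventually_elim (use F LIMSEQ_unique in blast)
  with primitive_locally_AC AE_has_vector_derivative x y show ?thesis
    by (auto simp: deriv_graph_def)
qed

end

section \<open>Synthesis from approximants at dyadic scales\<close>

lemma entire_exp_type_mono:
  assumes "entire_exp_type r G" "r \<le> r'"
  shows "entire_exp_type r' G"
  unfolding entire_exp_type_def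
proof (intro conjI allI impI)
  show "G holomorphic_on UNIV" using assms by (simp add: entire_exp_type_def)
  fix \<epsilon> :: real assume "0 < \<epsilon>"
  then obtain C where C: "0 < C" "\<And>z. norm (G z) \<le> C * exp ((r + \<epsilon>) * norm z)"
    using assms(1) unfolding entire_exp_type_def by blast
  have "norm (G z) \<le> C * exp ((r' + \<epsilon>) * norm z)" for z
  proof -
    have "(r + \<epsilon>) * norm z \<le> (r' + \<epsilon>) * norm z" using assms(2) by (intro mult_right_mono) auto
    then have "C * exp ((r + \<epsilon>) * norm z) \<le> C * exp ((r' + \<epsilon>) * norm z)" using C(1) by simp
    with C(2)[of z] show ?thesis by linarith
  qed
  with C(1) show "\<exists>C>0. \<forall>z. norm (G z) \<le> C * exp ((r' + \<epsilon>) * norm z)" by blast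
qed

lemma entire_exp_type_diff:
  assumes "entire_exp_type r G" "entire_exp_type r H"
  shows "entire_exp_type r (\<lambda>z. G z - H z)"
  unfolding entire_exp_type_def
proof (intro conjI allI impI)
  show "(\<lambda>z. G z - H z) holomorphic_on UNIV"
    using assms by (intro holomorphic_intros) (auto simp: entire_exp_type_def)
  fix \<epsilon> :: real assume \<epsilon>: "0 < \<epsilon>"
  obtain C where C: "0 < C" "\<And>z. norm (G z) \<le> C * exp ((r + \<epsilon>) * norm z)"
    using assms(1) \<epsilon> unfolding entire_exp_type_def by blast
  obtain D where D: "0 < D" "\<And>z. norm (H z) \<le> D * exp ((r + \<epsilon>) * norm z)"
    using assms(2) \<epsilon> unfolding entire_exp_type_def by blast
  have "norm (G z - H z) \<le> (C + D) * exp ((r + \<epsilon>) * norm z)" for z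
    using norm_triangle_ineq4[of "G z" "H z"] C(2)[of z] D(2)[of z] by (simp add: distrib_right)
  with C(1) D(1) show "\<exists>C>0. \<forall>z. norm (G z - H z) \<le> C * exp ((r + \<epsilon>) * norm z)"
    by (intro exI[of _ "C + D"]) auto
qed

context weighted_Lp
begin

lemma bernstein_iterated:
  obtains C where "0 \<le> C"
    "\<And>r G l. 1 \<le> r \<Longrightarrow> entire_exp_type r G \<Longrightarrow> (\<lambda>s. G (of_real s)) \<in> L \<Longrightarrow>
      (\<lambda>s. (deriv ^^ l) G (of_real s)) \<in> L \<and>
      nm (\<lambda>s. (deriv ^^ l) G (of_real s)) \<le> (C * r) ^ l * nm (\<lambda>s. G (of_real s))"
proof -
  obtain C where C: "0 \<le> C"
    "\<And>r G. 1 \<le> r \<Longrightarrow> entire_exp_type r G \<Longrightarrow> (\<lambda>s. G (of_real s)) \<in> L \<Longrightarrow>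
      (\<lambda>s. deriv G (of_real s)) \<in> L \<and> nm (\<lambda>s. deriv G (of_real s)) \<le> C * r * nm (\<lambda>s. G (of_real s))"
    using bernstein by blast
  have "entire_exp_type r ((deriv ^^ l) G) \<and> (\<lambda>s. (deriv ^^ l) G (of_real s)) \<in> L \<and>
      nm (\<lambda>s. (deriv ^^ l) G (of_real s)) \<le> (C * r) ^ l * nm (\<lambda>s. G (of_real s))"
    if r: "1 \<le> r" and G: "entire_exp_type r G" "(\<lambda>s. G (of_real s)) \<in> L" for r G l
  proof (induction l)
    case (Suc l)
    have "nm (\<lambda>s. (deriv ^^ Suc l) G (of_real s)) \<le> C * r * nm (\<lambda>s. (deriv ^^ l) G (of_real s))"
      using C(2)[OF r, of "(deriv ^^ l) G"] Suc by simp
    also have "\<dots> \<le> C * r * ((C * r) ^ l * nm (\<lambda>s. G (of_real s)))"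
      using Suc C(1) r by (intro mult_left_mono) auto
    finally have "nm (\<lambda>s. (deriv ^^ Suc l) G (of_real s)) \<le> (C * r) ^ Suc l * nm (\<lambda>s. G (of_real s))"
      by (simp add: mult.assoc)
    moreover have "entire_exp_type r ((deriv ^^ Suc l) G)"
      using Suc r entire_exp_type_deriv[of r "(deriv ^^ l) G"] by simp
    ultimately show ?case using C(2)[OF r, of "(deriv ^^ l) G"] Suc by simp
  qed (use G in auto)
  with C(1) that show thesis by blast
qed

lemma near_best_approximation:
  assumes f: "f \<in> L" and lt: "best_approx p \<mu> r f < B"
  obtains G where "entire_exp_type r G" "(\<lambda>s. G (of_real s)) \<in> L" "nm (\<lambda>s. f s - G (of_real s)) < B"
proof -
  have "entire_exp_type r (\<lambda>_. 0)" unfolding entire_exp_type_def by (auto intro: exI[of _ 1])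
  then have "(\<lambda>_. 0) \<in> B_space r \<inter> L" unfolding B_space_def by force
  then have ne: "(\<lambda>g. nm (\<lambda>s. f s - g s)) ` (B_space r \<inter> L) \<noteq> {}" by blast
  obtain g where g: "g \<in> B_space r" "g \<in> L" "nm (\<lambda>s. f s - g s) < B"
    using cInf_lessD[OF ne, of B] lt unfolding best_approx_def by blast
  from g(1) obtain G where "entire_exp_type r G" "g = (\<lambda>s. G (of_real s))" unfolding B_space_def by blast
  with g that show thesis by blast
qed

text \<open>Telescoping \<open>G\<^sub>N = G\<^sub>0 + \<Sum> Q\<^sub>j\<close>, with derivatives estimated by the Bernstein inequality. In the final
estimate the remainder \<open>E\<close> of the \<open>N\<close>-th partial sum is bounded by its norm, the partial sum itself by
\<open>h^k\<close> times the norms of further derivatives. The Bernstein bound of the \<open>(n+k)\<close>-th derivative of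
\<open>Q\<^sub>j\<close> leaves \<open>2^(kj) W\<^sub>j\<close>, and the summand 1 accounts for \<open>G\<^sub>0\<close>.\<close>

lemma dyadic_synthesis:
  fixes W :: "nat \<Rightarrow> real" and n :: nat
  assumes f: "f \<in> L" and W: "\<And>j. 0 \<le> W j" "\<And>j. W (Suc j) \<le> W j" "summable W" and n: "1 \<le> n"
    and G: "\<And>j. entire_exp_type (2 ^ j) (G j)" "\<And>j. (\<lambda>s. G j (of_real s)) \<in> L"
    and K: "0 \<le> K" "\<And>j. nm (\<lambda>s. f s - G j (of_real s)) \<le> K * W j / 2 ^ (n * j)"
  shows "\<exists>g\<in>L. (f, g) \<in> deriv_graph p \<mu> ^^ n \<and>
    (\<forall>k. \<exists>M\<ge>0. \<forall>N h. 0 \<le> h \<longrightarrow> h \<le> 1 \<longrightarrow>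
       nm (fdiff k h g) \<le> M * ((\<Sum>j. W (j + N)) + h ^ k * (1 + (\<Sum>j<N. 2 ^ (k * j) * W j))))"
proof -
  obtain C where C: "0 \<le> C"
    "\<And>r G l. 1 \<le> r \<Longrightarrow> entire_exp_type r G \<Longrightarrow> (\<lambda>s. G (of_real s)) \<in> L \<Longrightarrow>
      (\<lambda>s. (deriv ^^ l) G (of_real s)) \<in> L \<and>
      nm (\<lambda>s. (deriv ^^ l) G (of_real s)) \<le> (C * r) ^ l * nm (\<lambda>s. G (of_real s))"
    using bernstein_iterated by blast
  have holG: "G j holomorphic_on UNIV" for j using G(1)[of j] by (simp add: entire_exp_type_def)
  have hol_deriv: "(deriv ^^ l) H holomorphic_on UNIV" if "H holomorphic_on UNIV" for H :: "complex \<Rightarrow> complex" and l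
    using that by (intro holomorphic_higher_deriv) auto
  define Q where "Q = (\<lambda>j z. G (Suc j) z - G j z)"
  have Q: "entire_exp_type (2 ^ Suc j) (Q j)" "(\<lambda>s. Q j (of_real s)) \<in> L" for j
  proof -
    show "entire_exp_type (2 ^ Suc j) (Q j)"
      unfolding Q_def by (intro entire_exp_type_diff G entire_exp_type_mono[OF G(1)[of j]]) simp
    show "(\<lambda>s. Q j (of_real s)) \<in> L"
      unfolding Q_def by (intro Lp_diff G)
  qed
  have holQ: "Q j holomorphic_on UNIV" for j using Q(1)[of j] by (simp add: entire_exp_type_def)
  have nmQ: "nm (\<lambda>s. Q j (of_real s)) \<le> 2 * K * W j / 2 ^ (n * j)" for j
  proof -
    have "nm (\<lambda>s. Q j (of_real s)) = nm (\<lambda>s. (f s - G j (of_real s)) - (f s - G (Suc j) (of_real s)))"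
      by (simp add: Q_def)
    also have "\<dots> \<le> nm (\<lambda>s. f s - G j (of_real s)) + nm (\<lambda>s. f s - G (Suc j) (of_real s))"
      by (intro Lp_diff f G)
    also have "nm (\<lambda>s. f s - G (Suc j) (of_real s)) \<le> K * W j / 2 ^ (n * j)"
    proof (rule order_trans[OF K(2)])
      show "K * W (Suc j) / 2 ^ (n * Suc j) \<le> K * W j / 2 ^ (n * j)"
        using K(1) W(1)[of j] W(1)[of "Suc j"] W(2)[of j] by (intro frac_le mult_left_mono power_increasing mult_nonneg_nonneg) auto
    qed
    also have "nm (\<lambda>s. f s - G j (of_real s)) \<le> K * W j / 2 ^ (n * j)" by (rule K(2))
    finally show ?thesis by simp
  qed
  define P where "P = (\<lambda>l (s::real). (deriv ^^ l) (G 0) (of_real s))"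
  define D where "D = (\<lambda>l j (s::real). (deriv ^^ l) (Q j) (of_real s))"
  have P: "P l \<in> L" for l unfolding P_def using C(2)[of "2 ^ 0" "G 0" l] G(1)[of 0] G(2)[of 0] by simp
  define A where "A = (\<lambda>l. (2 * C) ^ l * (2 * K))"
  have A0: "0 \<le> A l" for l using C(1) K(1) by (simp add: A_def)
  have D: "D l j \<in> L" "nm (D l j) \<le> A l * (2 ^ (l * j) / 2 ^ (n * j) * W j)" for l j
  proof -
    have b: "D l j \<in> L \<and> nm (D l j) \<le> (C * 2 ^ Suc j) ^ l * nm (\<lambda>s. Q j (of_real s))"
      unfolding D_def by (rule C(2)[OF _ Q]) (simp del: power_Suc)
    then show "D l j \<in> L" by blast
    have "nm (D l j) \<le> (C * 2 ^ Suc j) ^ l * (2 * K * W j / 2 ^ (n * j))"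
      using b C(1) nmQ[of j] by (elim conjE) (erule order_trans, intro mult_left_mono, auto)
    also have "\<dots> = A l * (2 ^ (l * j) / 2 ^ (n * j) * W j)"
      by (simp add: A_def power_mult_distrib power_mult[symmetric] mult.commute[of j])
    finally show "nm (D l j) \<le> A l * (2 ^ (l * j) / 2 ^ (n * j) * W j)" .
  qed
  have D_le: "nm (D l j) \<le> A l * W j" if "l \<le> n" for l j
  proof (rule order_trans[OF D(2)])
    have "(2::real) ^ (l * j) \<le> 2 ^ (n * j)" using that by (intro power_increasing) auto
    then have "(2::real) ^ (l * j) / 2 ^ (n * j) * W j \<le> 1 * W j" by (intro mult_right_mono W) simp
    then show "A l * (2 ^ (l * j) / 2 ^ (n * j) * W j) \<le> A l * W j" using A0 by (intro mult_left_mono) auto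
  qed
  have partial: "(deriv ^^ l) (G N) (of_real s) = P l s + (\<Sum>j<N. D l j s)" for l N s
  proof (induction N)
    case (Suc N)
    have "(deriv ^^ l) (Q N) (of_real s) = (deriv ^^ l) (G (Suc N)) (of_real s) - (deriv ^^ l) (G N) (of_real s)"
      unfolding Q_def by (rule higher_deriv_diff[of _ UNIV]) (auto intro: holG)
    then show ?case using Suc by (simp add: D_def algebra_simps)
  qed (simp add: P_def)
  define v where "v = (\<lambda>l s. P l s + (\<Sum>j. D l j s))"
  have v: "v l \<in> L" "AE s in lebesgue. (\<lambda>N. (deriv ^^ l) (G N) (of_real s)) \<longlonglongrightarrow> v l s"
    "nm (\<lambda>s. v l s - (deriv ^^ l) (G N) (of_real s)) \<le> A l * (\<Sum>j. W (j + N))" if l: "l \<le> n" for l N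
  proof -
    have summ: "summable (\<lambda>j. A l * W j)" by (intro summable_mult W)
    note S = Lp_suminf[OF D(1) D_le[OF l] summ]
    show "v l \<in> L" unfolding v_def by (intro minkowski(1) P S)
    show "AE s in lebesgue. (\<lambda>N. (deriv ^^ l) (G N) (of_real s)) \<longlonglongrightarrow> v l s"
      using S(1)
    proof eventually_elim
      case (elim s)
      then have "(\<lambda>N. \<Sum>j<N. D l j s) \<longlonglongrightarrow> (\<Sum>j. D l j s)"
        by (rule summable_LIMSEQ[OF summable_norm_cancel])
      then show ?case unfolding partial v_def by (intro tendsto_intros)
    qed
    have "(\<Sum>j. A l * W (j + N)) = A l * (\<Sum>j. W (j + N))"
      by (rule suminf_mult) (simp add: summable_iff_shift W)
    then show "nm (\<lambda>s. v l s - (deriv ^^ l) (G N) (of_real s)) \<le> A l * (\<Sum>j. W (j + N))"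
      using S(3)[of N] by (simp add: partial v_def)
  qed
  have tail0: "(\<lambda>N. A l * (\<Sum>j. W (j + N))) \<longlonglongrightarrow> 0" for l
    using tendsto_mult[OF tendsto_const[of "A l"] suminf_exist_split2[OF W(3)]] by simp
  have null: "(\<lambda>N. nm (\<lambda>s. v l s - (deriv ^^ l) (G N) (of_real s))) \<longlonglongrightarrow> 0" if "l \<le> n" for l
    by (rule Lim_null_comparison[OF _ tail0[of l]]) (use v(3)[OF that] in auto)
  have derivs_L: "(\<lambda>s. (deriv ^^ l) (G N) (of_real s)) \<in> L" for l N
    using C(2)[of "2 ^ N" "G N" l] G by simp
  have edge: "(v l, v (Suc l)) \<in> deriv_graph p \<mu>" if "l < n" for l
  proof (rule deriv_graph_limit[of "\<lambda>N. (deriv ^^ l) (G N)"])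
    show "(\<lambda>N. nm (\<lambda>s. v (Suc l) s - deriv ((deriv ^^ l) (G N)) (of_real s))) \<longlonglongrightarrow> 0"
      using null[of "Suc l"] that by simp
    show "(\<lambda>s. deriv ((deriv ^^ l) (G N)) (of_real s)) \<in> L" for N
      using derivs_L[of "Suc l" N] by simp
  qed (use v that hol_deriv holG in auto)
  have fv: "AE s in lebesgue. v 0 s = f s"
  proof -
    have "nm (\<lambda>s. v 0 s - f s) \<le> 0"
    proof (rule tendsto_lowerbound)
      have "(\<lambda>N. K * W N) \<longlonglongrightarrow> K * 0"
        by (intro tendsto_intros summable_LIMSEQ_zero W)
      then show "(\<lambda>N. A 0 * (\<Sum>j. W (j + N)) + K * W N) \<longlonglongrightarrow> 0"
        using tendsto_add[OF tail0[of 0]] by fastforce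
      have "nm (\<lambda>s. v 0 s - f s) \<le> A 0 * (\<Sum>j. W (j + N)) + K * W N" for N
      proof -
        have "nm (\<lambda>s. v 0 s - f s) = nm (\<lambda>s. (v 0 s - (deriv ^^ 0) (G N) (of_real s)) - (f s - G N (of_real s)))" by simp
        also have "\<dots> \<le> nm (\<lambda>s. v 0 s - (deriv ^^ 0) (G N) (of_real s)) + nm (\<lambda>s. f s - G N (of_real s))"
          by (intro Lp_diff v f G derivs_L) simp
        also have "nm (\<lambda>s. f s - G N (of_real s)) \<le> K * W N / 1"
          using K W(1)[of N] by (intro order_trans[OF K(2)] divide_left_mono) auto
        finally show ?thesis using v(3)[of 0 N] by simp
      qed
      then show "\<forall>\<^sub>F N in sequentially. nm (\<lambda>s. v 0 s - f s) \<le> A 0 * (\<Sum>j. W (j + N)) + K * W N" by simp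
    qed simp
    then have "nm (\<lambda>s. v 0 s - f s) = 0" using Lp_norm_nonneg order_antisym by blast
    then have "AE s in lebesgue. v 0 s - f s = 0"
      using v(1)[of 0] f by (intro Lp_norm_zero_imp_AE Lp_diff) auto
    then show ?thesis by eventually_elim simp
  qed
  show ?thesis
  proof (intro bexI[of _ "v n"] conjI allI)
    show "v n \<in> L" by (simp add: v)
    have "(f, v 1) \<in> deriv_graph p \<mu>"
      using deriv_graph_cong[OF edge[of 0] f fv] n by simp
    then show "(f, v n) \<in> deriv_graph p \<mu> ^^ n"
      unfolding relpow_fun_conv using n edge
      by (intro exI[of _ "\<lambda>l. if l = 0 then f else v l"]) auto
    fix k
    define c where "c = \<mu> 0 + \<mu> 1"
    have c: "0 \<le> c" using \<mu>_pos[of 0] \<mu>_pos[of 1] by (simp add: c_def)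
    define B where "B = 2 ^ k * (\<mu> 0 + \<mu> (real k))"
    have B0: "0 \<le> B" using \<mu>_pos[of 0] \<mu>_pos[of "real k"] by (simp add: B_def)
    define M where "M = B * A n + c ^ k * (nm (P (n + k)) + A (n + k))"
    have "nm (fdiff k h (v n)) \<le> M * ((\<Sum>j. W (j + N)) + h ^ k * (1 + (\<Sum>j<N. 2 ^ (k * j) * W j)))"
      if h: "0 \<le> h" "h \<le> 1" for N h
    proof -
      define E where "E = (\<lambda>s. v n s - (deriv ^^ n) (G N) (of_real s))"
      define T where "T = (\<Sum>j. W (j + N))"
      have T0: "0 \<le> T" unfolding T_def by (intro suminf_nonneg) (auto simp: summable_iff_shift W)
      define S where "S = (\<Sum>j<N. 2 ^ (k * j) * W j)"
      have S0: "0 \<le> S" unfolding S_def by (intro sum_nonneg mult_nonneg_nonneg W) auto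
      have E: "E \<in> L" "nm E \<le> A n * T"
        unfolding E_def T_def by (auto intro!: Lp_diff v derivs_L)
      have hk: "(h * \<mu> h) ^ k \<le> c ^ k * h ^ k"
      proof -
        have "h * \<mu> h \<le> c * h"
          unfolding c_def mult.commute[of h] using h by (intro mult_right_mono weight_le_on_ball) auto
        then have "(h * \<mu> h) ^ k \<le> (c * h) ^ k" using h \<mu>_pos[of h] by (intro power_mono) auto
        then show ?thesis by (simp add: power_mult_distrib)
      qed
      have fE: "fdiff k h E \<in> L \<and> nm (fdiff k h E) \<le> B * (A n * T)"
        using Lp_norm_fdiff_le[OF E(1) h, of k] mult_left_mono[OF E(2) B0] unfolding B_def[symmetric]
        by linarith
      have entire: "fdiff k h (\<lambda>s. (deriv ^^ n) H (of_real s)) \<in> L \<and>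
          nm (fdiff k h (\<lambda>s. (deriv ^^ n) H (of_real s))) \<le> c ^ k * h ^ k * nm (\<lambda>s. (deriv ^^ (n + k)) H (of_real s))"
        if H: "H holomorphic_on UNIV" "\<And>l. (\<lambda>s. (deriv ^^ l) H (of_real s)) \<in> L" for H
      proof -
        have shift: "(deriv ^^ l) ((deriv ^^ n) H) = (deriv ^^ (n + l)) H" for l
          by (simp add: funpow_add add.commute)
        have "fdiff k h (\<lambda>s. (deriv ^^ n) H (of_real s)) \<in> L \<and>
          nm (fdiff k h (\<lambda>s. (deriv ^^ n) H (of_real s))) \<le> (h * \<mu> h) ^ k * nm (\<lambda>s. (deriv ^^ (n + k)) H (of_real s))"
          using Lp_norm_fdiff_entire_le[of "(deriv ^^ n) H" h k] hol_deriv[OF H(1)] H(2) h by (simp add: shift)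
        then show ?thesis using mult_right_mono[OF hk Lp_norm_nonneg] order_trans by blast
      qed
      have fP: "fdiff k h (P n) \<in> L \<and> nm (fdiff k h (P n)) \<le> c ^ k * h ^ k * nm (P (n + k))"
        using entire[OF holG derivs_L, of 0] unfolding P_def .
      have fD: "fdiff k h (D n j) \<in> L \<and> nm (fdiff k h (D n j)) \<le> c ^ k * h ^ k * (A (n + k) * (2 ^ (k * j) * W j))" for j
      proof -
        have "fdiff k h (D n j) \<in> L \<and> nm (fdiff k h (D n j)) \<le> c ^ k * h ^ k * nm (D (n + k) j)"
          using entire[OF holQ, of j] D(1) unfolding D_def by simp
        moreover have "nm (D (n + k) j) \<le> A (n + k) * (2 ^ (k * j) * W j)"
          using D(2)[of "n + k" j] by (simp add: power_add distrib_right)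
        then have "c ^ k * h ^ k * nm (D (n + k) j) \<le> c ^ k * h ^ k * (A (n + k) * (2 ^ (k * j) * W j))"
          using c h by (intro mult_left_mono) auto
        ultimately show ?thesis by linarith
      qed
      have "v n = (\<lambda>s. E s + (P n s + (\<Sum>j<N. D n j s)))"
        by (simp add: E_def partial fun_eq_iff)
      then have eq: "fdiff k h (v n) = (\<lambda>s. fdiff k h E s + (fdiff k h (P n) s + (\<Sum>j<N. fdiff k h (D n j) s)))"
        by (subst \<open>v n = _\<close>) (simp add: fun_eq_iff fdiff_add fdiff_sum)
      have sumD: "(\<lambda>s. \<Sum>j<N. fdiff k h (D n j) s) \<in> L \<and> nm (\<lambda>s. \<Sum>j<N. fdiff k h (D n j) s) \<le> (\<Sum>j<N. nm (fdiff k h (D n j)))"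
        by (rule Lp_sum) (use fD in auto)
      have sumD_le: "(\<Sum>j<N. nm (fdiff k h (D n j))) \<le> c ^ k * h ^ k * (A (n + k) * S)"
        unfolding S_def sum_distrib_left by (intro sum_mono) (use fD in auto)
      have "nm (fdiff k h (v n)) \<le> nm (fdiff k h E) + (nm (fdiff k h (P n)) + nm (\<lambda>s. \<Sum>j<N. fdiff k h (D n j) s))"
        unfolding eq using minkowski[of "fdiff k h E" "\<lambda>s. fdiff k h (P n) s + (\<Sum>j<N. fdiff k h (D n j) s)"]
          minkowski[of "fdiff k h (P n)" "\<lambda>s. \<Sum>j<N. fdiff k h (D n j) s"] fE fP sumD by auto
      also have "\<dots> \<le> B * (A n * T) + (c ^ k * h ^ k * nm (P (n + k)) + c ^ k * h ^ k * (A (n + k) * S))"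
        using fE fP sumD sumD_le by linarith
      also have "\<dots> \<le> M * (T + h ^ k * (1 + S))"
      proof -
        define a b d H where "a = B * A n" and "b = c ^ k * nm (P (n + k))" and "d = c ^ k * A (n + k)" and "H = h ^ k"
        have nn: "0 \<le> a" "0 \<le> b" "0 \<le> d" "0 \<le> H" using B0 A0 c h by (auto simp: a_def b_def d_def H_def)
        have "a * T + (b * H + d * (H * S)) \<le> (a + (b + d)) * (T + H * (1 + S))"
          using nn T0 S0 by (simp add: algebra_simps)
        then show ?thesis by (simp add: a_def b_def d_def H_def M_def algebra_simps)
      qed
      finally show ?thesis by (simp add: T_def S_def)
    qed
    moreover have "0 \<le> M" using B0 A0 c by (simp add: M_def)
    ultimately show "\<exists>M\<ge>0. \<forall>N h. 0 \<le> h \<longrightarrow> h \<le> 1 \<longrightarrow>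
       nm (fdiff k h (v n)) \<le> M * ((\<Sum>j. W (j + N)) + h ^ k * (1 + (\<Sum>j<N. 2 ^ (k * j) * W j)))" by blast
  qed
qed

end

section \<open>Dyadic sums of a modulus of continuity\<close>

text \<open>Here \<open>N\<close> is the dyadic scale of \<open>t\<close>, that is \<open>2^(-N-1) < t \<le> 2^(-N)\<close>. On the cell
\<open>A\<^sub>j = (2^(-j-1), 2^(-j)]\<close> the integrand is at least a constant times \<open>2^(kj) W\<^sub>j\<^sub>+\<^sub>1\<close>. The cells with \<open>j > N\<close>
lie in \<open>(0, t]\<close>, those with \<open>j < N\<close> in \<open>[t, 1]\<close>. The terms left out, \<open>W\<^sub>N\<close>, \<open>W\<^sub>N\<^sub>+\<^sub>1\<close> and \<open>W\<^sub>0\<close>, are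
bounded by their successors through the doubling condition. Since \<open>t \<le> 1/2\<close> forces \<open>N \<ge> 1\<close>, the second
integral dominates a multiple of \<open>W\<^sub>1 > 0\<close>, which absorbs the constant 1.\<close>

lemma modulus_type_dyadic:
  assumes \<omega>: "modulus_type \<omega>" and pos: "0 < \<omega> 1"
  defines "W \<equiv> \<lambda>j::nat. \<omega> (1 / 2 ^ j)"
  shows "\<And>j. 0 < W j" "\<And>j. W (Suc j) \<le> W j" "summable W"
    "\<And>k. \<exists>M>0. \<forall>t. 0 < t \<and> t \<le> 1 / 2 \<longrightarrow> (\<exists>N.
        (\<Sum>j. W (j + N)) \<le> M * (LINT u:{0<..t}|lebesgue. \<omega> u / u) \<and>
        1 + (\<Sum>j<N. 2 ^ (k * j) * W j) \<le> M * (LINT u:{t..1}|lebesgue. \<omega> u / u ^ (k + 1)))"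
proof -
  obtain c where c: "0 < c" "\<And>t. t \<in> {0..1} \<Longrightarrow> \<omega> (2 * t) \<le> c * \<omega> t"
    using \<omega> unfolding modulus_type_def by blast
  have mono: "\<omega> s \<le> \<omega> t" if "0 \<le> s" "s \<le> t" for s t
    using \<omega> that unfolding modulus_type_def by (auto intro: mono_onD)
  have nonneg: "0 \<le> \<omega> t" if "0 \<le> t" for t
    using mono[of 0 t] that \<omega> by (simp add: modulus_type_def)
  have int: "set_integrable lebesgue {0<..1} (\<lambda>u. \<omega> u / u)" using \<omega> by (simp add: modulus_type_def)
  have double: "W j \<le> c * W (Suc j)" for j
  proof -
    have "1 / 2 ^ Suc j \<in> {0..1::real}" by (simp del: power_Suc)
    from c(2)[OF this] show ?thesis by (simp add: W_def)
  qed
  show Wpos: "0 < W j" for j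
  proof (induction j)
    case (Suc j)
    then have "0 < c * W (Suc j)" using double[of j] by linarith
    then show ?case using c(1) by (simp add: zero_less_mult_iff)
  qed (simp add: W_def pos)
  show Wdec: "W (Suc j) \<le> W j" for j
    unfolding W_def by (intro mono) (auto simp: field_simps)
  define A where "A = (\<lambda>j::nat. {1 / 2 ^ Suc j<..1 / 2 ^ j} :: real set)"
  have disj: "disjoint_family A"
  proof -
    have "antimono (\<lambda>j::nat. 1 / 2 ^ j :: real)" by (intro antimonoI divide_left_mono power_increasing) auto
    moreover have "A = (\<lambda>j. {min (1 / 2 ^ j) (1 / 2 ^ Suc j)<..max (1 / 2 ^ j) (1 / 2 ^ Suc j)})"
      by (auto simp: A_def fun_eq_iff min_def max_def field_simps)
    ultimately show ?thesis using disjoint_family_Ioc_mono[of "\<lambda>j. 1 / 2 ^ j"] by simp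
  qed
  have A_sets: "A j \<in> sets lebesgue" for j by (simp add: A_def)
  have A_upper: "x \<in> A j \<Longrightarrow> x \<le> 1 / 2 ^ i" if "i \<le> j" for x i j
  proof -
    assume "x \<in> A j"
    then have "x \<le> 1 / 2 ^ j" by (simp add: A_def)
    also have "(1::real) / 2 ^ j \<le> 1 / 2 ^ i" using that by (intro divide_left_mono power_increasing) auto
    finally show ?thesis .
  qed
  have A_lower: "x \<in> A j \<Longrightarrow> 1 / 2 ^ i < x" if "j < i" for x i j
  proof -
    assume "x \<in> A j"
    then have "1 / 2 ^ Suc j < x" by (simp add: A_def)
    moreover have "(1::real) / 2 ^ i \<le> 1 / 2 ^ Suc j" using that by (intro divide_left_mono power_increasing) auto
    ultimately show ?thesis by linarith
  qed
  have A_01: "A j \<subseteq> {0<..1}" for j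
    using A_upper[of 0 j] A_lower[of j "Suc j"] by (force intro: less_trans[OF _ A_lower[of j "Suc j"]])
  have cell: "2 ^ (k * j) * W (Suc j) / 2 \<le> (LINT u:A j|lebesgue. \<omega> u / u ^ (k + 1))"
    if kint: "set_integrable lebesgue (A j) (\<lambda>u. \<omega> u / u ^ (k + 1))" for k j
  proof -
    define q :: real where "q = W (Suc j) * 2 ^ ((k + 1) * j)"
    have q_int: "set_integrable lebesgue (A j) (\<lambda>u. q)"
      unfolding set_integrable_def A_def
      by (intro integrable_scaleR_left integrable_real_indicator)
         (use bounded_set_imp_lmeasurable[of "{1 / 2 ^ Suc j<..1 / 2 ^ j::real}"] in \<open>auto simp: fmeasurable_def\<close>)
    have "2 ^ (k * j) * W (Suc j) / 2 = (LINT u:A j|lebesgue. q)"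
    proof -
      have "measure lebesgue (A j) = 1 / 2 ^ Suc j" by (simp add: A_def field_simps)
      moreover have "emeasure lebesgue (A j) \<noteq> \<infinity>"
        using bounded_set_imp_lmeasurable[of "A j"] by (auto simp: A_def fmeasurable_def)
      ultimately have "(LINT u:A j|lebesgue. q) = 1 / 2 ^ Suc j * q"
        by (subst set_integral_const) (auto simp: A_sets)
      moreover have "1 / 2 ^ Suc j * q = 2 ^ (k * j) * W (Suc j) / 2"
      proof -
        have eq: "(2::real) ^ ((k + 1) * j) = 2 ^ (k * j) * 2 ^ j"
          by (simp add: add.commute flip: power_add)
        show ?thesis unfolding q_def eq by simp
      qed
      ultimately show ?thesis by (simp only:)
    qed
    also have "\<dots> \<le> (LINT u:A j|lebesgue. \<omega> u / u ^ (k + 1))"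
    proof (rule set_integral_mono[OF q_int kint])
      fix u assume u: "u \<in> A j"
      then have u': "1 / 2 ^ Suc j < u" "u \<le> 1 / 2 ^ j" "0 < u" using A_01[of j] by (auto simp: A_def)
      have "q = W (Suc j) / (1 / 2 ^ j) ^ (k + 1)"
      proof -
        have eq: "(2::real) ^ ((k + 1) * j) = (2 ^ j) ^ (k + 1)" by (metis mult.commute power_mult)
        show ?thesis unfolding q_def eq power_one_over by simp
      qed
      also have "\<dots> \<le> \<omega> u / u ^ (k + 1)"
      proof (rule frac_le)
        show "W (Suc j) \<le> \<omega> u" unfolding W_def using u' by (intro mono) auto
        show "u ^ (k + 1) \<le> (1 / 2 ^ j) ^ (k + 1)" using u' by (intro power_mono) auto
      qed (use u' nonneg[of u] in auto)
      finally show "q \<le> \<omega> u / u ^ (k + 1)" .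
    qed
    finally show ?thesis .
  qed
  have cell0: "W (Suc j) \<le> 2 * (LINT u:A j|lebesgue. \<omega> u / u)" for j
    using cell[of j 0] set_integrable_subset[OF int A_sets A_01, of j] by simp
  have quot_nonneg: "0 \<le> \<omega> u / u ^ i" if "0 < u" for u i using nonneg[of u] that by simp
  have summA: "summable (\<lambda>j. LINT u:A j|lebesgue. \<omega> u / u)"
    by (rule set_integrals_disjoint_suminf_le(1)[OF int _ A_sets A_01 disj]) (use quot_nonneg[of _ 1] in auto)
  have "summable (\<lambda>j. W (Suc j))"
    by (rule summable_comparison_test'[OF summable_mult[OF summA, of 2]]) (use cell0 Wpos in \<open>auto simp: less_imp_le\<close>)
  then show summW: "summable W" by (simp add: summable_Suc_iff)
  fix k :: nat
  define M where "M = 2 * (c * c + c + 1) + 2 * 2 ^ k * (1 / W 1 + c + 1)"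
  have W1: "0 < W 1" by (rule Wpos)
  have M: "2 * (c * c + c + 1) \<le> M" "2 * 2 ^ k * (1 / W 1 + c + 1) \<le> M"
    using c(1) W1 by (auto simp: M_def)
  have "\<exists>N. (\<Sum>j. W (j + N)) \<le> M * (LINT u:{0<..t}|lebesgue. \<omega> u / u) \<and>
        1 + (\<Sum>j<N. 2 ^ (k * j) * W j) \<le> M * (LINT u:{t..1}|lebesgue. \<omega> u / u ^ (k + 1))"
    if t: "0 < t" "t \<le> 1 / 2" for t
  proof -
    obtain N where "2 ^ N \<le> 1 / t" "1 / t < 2 ^ (N + 1)"
      using dyadic_scale[of "1 / t"] t by auto
    then have N: "1 / 2 ^ Suc N < t" "t \<le> 1 / 2 ^ N"
      using t by (simp_all add: field_simps)
    have N1: "1 \<le> N"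
    proof (rule ccontr)
      assume "\<not> 1 \<le> N"
      then have "N = 0" by simp
      then show False using N(1) t(2) by simp
    qed
    define I where "I = (LINT u:{0<..t}|lebesgue. \<omega> u / u)"
    define J where "J = (LINT u:{t..1}|lebesgue. \<omega> u / u ^ (k + 1))"
    have low: "(\<Sum>j. W (j + N)) \<le> M * I"
    proof -
      \<comment> \<open>The cell with index \<open>N\<close> itself may stick out of \<open>(0, t]\<close>, so the sum starts at \<open>W\<^sub>N\<^sub>+\<^sub>2\<close>.\<close>
      define B where "B = (\<lambda>j. A (j + Suc N))"
      have B_t: "B j \<subseteq> {0<..t}" for j
        using A_upper[of "Suc N" "j + Suc N"] A_01[of "j + Suc N"] N(1) by (force simp: B_def)
      have B_disj: "disjoint_family B" using disj by (auto simp: disjoint_family_on_def B_def)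
      have It: "set_integrable lebesgue {0<..t} (\<lambda>u. \<omega> u / u)"
        by (rule set_integrable_subset[OF int]) (use t in auto)
      have B_sum: "summable (\<lambda>j. LINT u:B j|lebesgue. \<omega> u / u)" "(\<Sum>j. LINT u:B j|lebesgue. \<omega> u / u) \<le> I"
        unfolding I_def by (rule set_integrals_disjoint_suminf_le[OF It _ _ B_t B_disj]; use quot_nonneg[of _ 1] in \<open>auto simp: B_def A_sets\<close>)+
      have summS: "summable (\<lambda>j. W (j + (N + 2)))" unfolding summable_iff_shift by (rule summW)
      define S where "S = (\<Sum>j. W (j + (N + 2)))"
      have S_le: "S \<le> 2 * I"
      proof -
        have "S \<le> (\<Sum>j. 2 * (LINT u:B j|lebesgue. \<omega> u / u))"
          unfolding S_def by (intro suminf_le summS summable_mult B_sum) (use cell0 in \<open>auto simp: B_def\<close>)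
        also have "\<dots> \<le> 2 * I" using B_sum by (simp add: suminf_mult)
        finally show ?thesis .
      qed
      have W2: "W (N + 2) \<le> S"
        using sum_le_suminf[OF summS, of "{0}"] Wpos by (auto simp: S_def less_imp_le)
      have WN1: "W (N + 1) \<le> c * S"
      proof -
        have "W (N + 1) \<le> c * W (N + 2)" using double[of "N + 1"] by simp
        also have "\<dots> \<le> c * S" using W2 c(1) by simp
        finally show ?thesis .
      qed
      have "W N \<le> c * (c * S)"
      proof -
        have "W N \<le> c * W (N + 1)" using double[of N] by simp
        also have "\<dots> \<le> c * (c * S)" using WN1 c(1) by simp
        finally show ?thesis .
      qed
      moreover have "(\<Sum>j. W (j + N)) = W N + W (N + 1) + S"
        using suminf_split_initial_segment[of "\<lambda>j. W (j + N)" 2] summW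
        by (simp add: summable_iff_shift S_def numeral_2_eq_2 add_ac)
      ultimately have "(\<Sum>j. W (j + N)) \<le> (c * c + c + 1) * S" using WN1 by (simp add: algebra_simps)
      also have "\<dots> \<le> (c * c + c + 1) * (2 * I)" using c(1) by (intro mult_left_mono S_le) auto
      also have "\<dots> = 2 * (c * c + c + 1) * I" by simp
      also have "\<dots> \<le> M * I"
      proof (rule mult_right_mono[OF M(1)])
        have "0 \<le> S" using W2 Wpos[of "N + 2"] by linarith
        then show "0 \<le> I" using S_le by simp
      qed
      finally show ?thesis .
    qed
    have high: "1 + (\<Sum>j<N. 2 ^ (k * j) * W j) \<le> M * J"
    proof -
      have Jint: "set_integrable lebesgue {t..1} (\<lambda>u. \<omega> u / u ^ (k + 1))"
      proof -
        have "continuous_on {t..1} \<omega>"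
        proof (rule continuous_on_subset)
          show "continuous_on {0..} \<omega>" using \<omega> by (simp add: modulus_type_def)
        qed (use t in auto)
        then have "continuous_on {t..1} (\<lambda>u. \<omega> u / u ^ (k + 1))"
          using t by (intro continuous_intros) auto
        then show ?thesis
          using absolutely_integrable_continuous[of t 1 "\<lambda>u. \<omega> u / u ^ (k + 1)"] by simp
      qed
      have A_t: "A j \<subseteq> {t..1}" if "j < N" for j
        using A_lower[of j N] A_01[of j] N(2) that by force
      define S where "S = (\<Sum>j<N. 2 ^ (k * Suc j) * W (Suc j))"
      have S_le: "S \<le> 2 * 2 ^ k * J"
      proof -
        have "S = (\<Sum>j<N. 2 * 2 ^ k * (2 ^ (k * j) * W (Suc j) / 2))"
          unfolding S_def by (intro sum.cong) (auto simp: power_add)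
        also have "\<dots> \<le> (\<Sum>j<N. 2 * 2 ^ k * (LINT u:A j|lebesgue. \<omega> u / u ^ (k + 1)))"
          using A_t by (intro sum_mono mult_left_mono cell set_integrable_subset[OF Jint A_sets]) auto
        also have "\<dots> = 2 * 2 ^ k * (\<Sum>j<N. LINT u:A j|lebesgue. \<omega> u / u ^ (k + 1))"
          by (simp add: sum_distrib_left)
        also have "\<dots> \<le> 2 * 2 ^ k * J"
          unfolding J_def
          by (intro mult_left_mono sum_set_integrals_disjoint_le Jint)
             (use A_t A_sets disj t in \<open>auto simp: disjoint_family_on_def intro!: nonneg divide_nonneg_nonneg\<close>)
        finally show ?thesis .
      qed
      have W1_S: "W 1 \<le> S"
      proof -
        have "1 * W 1 \<le> 2 ^ (k * Suc 0) * W 1" using W1 by (intro mult_right_mono) auto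
        also have "\<dots> \<le> S"
          unfolding S_def using member_le_sum[of 0 "{..<N}" "\<lambda>j. 2 ^ (k * Suc j) * W (Suc j)"] N1 Wpos
          by (auto simp: less_imp_le)
        finally show ?thesis by simp
      qed
      have S0: "0 \<le> S" using W1_S W1 by linarith
      obtain N' where N': "N = Suc N'" using N1 by (cases N) auto
      have "(\<Sum>j<N. 2 ^ (k * j) * W j) = W 0 + (\<Sum>j<N'. 2 ^ (k * Suc j) * W (Suc j))"
        unfolding N' by (subst sum.lessThan_Suc_shift) simp
      also have "(\<Sum>j<N'. 2 ^ (k * Suc j) * W (Suc j)) \<le> S"
        unfolding S_def N' using Wpos by (simp add: less_imp_le)
      also have "W 0 \<le> c * S"
      proof -
        have "W 0 \<le> c * W 1" using double[of 0] by simp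
        also have "\<dots> \<le> c * S" using W1_S c(1) by simp
        finally show ?thesis .
      qed
      finally have "(\<Sum>j<N. 2 ^ (k * j) * W j) \<le> c * S + S" by simp
      moreover have "1 \<le> 1 / W 1 * S" using W1_S W1 by simp
      ultimately have "1 + (\<Sum>j<N. 2 ^ (k * j) * W j) \<le> (1 / W 1 + c + 1) * S"
        by (simp add: algebra_simps)
      also have "\<dots> \<le> (1 / W 1 + c + 1) * (2 * 2 ^ k * J)"
        using c(1) W1 by (intro mult_left_mono S_le) auto
      also have "\<dots> = 2 * 2 ^ k * (1 / W 1 + c + 1) * J" by simp
      also have "\<dots> \<le> M * J"
      proof (rule mult_right_mono[OF M(2)])
        have "0 \<le> J * (2 * 2 ^ k)" using S0 S_le by (simp add: mult.commute)
        then show "0 \<le> J" by (rule mult_right_le_imp_le[of 0 "2 * 2 ^ k", simplified]) simp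
      qed
      finally show ?thesis .
    qed
    from low high show ?thesis unfolding I_def J_def by blast
  qed
  moreover have "0 < M" using c(1) W1 by (simp add: M_def add_pos_pos)
  ultimately show "\<exists>M>0. \<forall>t. 0 < t \<and> t \<le> 1 / 2 \<longrightarrow> (\<exists>N.
        (\<Sum>j. W (j + N)) \<le> M * (LINT u:{0<..t}|lebesgue. \<omega> u / u) \<and>
        1 + (\<Sum>j<N. 2 ^ (k * j) * W j) \<le> M * (LINT u:{t..1}|lebesgue. \<omega> u / u ^ (k + 1)))" by blast
qed

text \<open>This turns a modulus that may vanish identically on \<open>[0, 1]\<close> into one that is positive off 0.\<close>

lemma modulus_type_add_id:
  assumes "modulus_type \<omega>"
  shows "modulus_type (\<lambda>t. \<omega> t + t)"
proof -
  obtain c where c: "0 < c" "\<And>t. t \<in> {0..1} \<Longrightarrow> \<omega> (2 * t) \<le> c * \<omega> t"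
    using assms unfolding modulus_type_def by blast
  have nonneg: "0 \<le> \<omega> t" if "0 \<le> t" for t
    using assms mono_onD[of "{0..}" \<omega> 0 t] that by (auto simp: modulus_type_def)
  have "set_integrable lebesgue {0<..1} (\<lambda>t. \<omega> t / t + 1)"
  proof (rule set_integral_add(1))
    show "set_integrable lebesgue {0<..1} (\<lambda>t. \<omega> t / t)" using assms by (simp add: modulus_type_def)
    show "set_integrable lebesgue {0<..1::real} (\<lambda>t. 1::real)"
      unfolding set_integrable_def
      by (intro integrable_scaleR_left integrable_real_indicator) auto
  qed
  then have int: "set_integrable lebesgue {0<..1} (\<lambda>t. (\<omega> t + t) / t)"
    by (rule set_integrable_cong[THEN iffD1, rotated -1]) (auto simp: add_divide_distrib)
  have "\<omega> (2 * t) + 2 * t \<le> max c 2 * (\<omega> t + t)" if t: "t \<in> {0..1}" for t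
  proof -
    have "\<omega> (2 * t) \<le> max c 2 * \<omega> t"
      using c(2)[OF t] mult_right_mono[of c "max c 2" "\<omega> t"] nonneg[of t] t by (auto intro: order_trans)
    moreover have "2 * t \<le> max c 2 * t" using t by (intro mult_right_mono) auto
    ultimately show ?thesis by (simp add: distrib_left)
  qed
  then have "\<exists>c>0. \<forall>t\<in>{0..1}. \<omega> (2 * t) + 2 * t \<le> c * (\<omega> t + t)"
    by (intro exI[of _ "max c 2"]) auto
  moreover have "mono_on {0..} (\<lambda>t. \<omega> t + t)"
    using assms by (auto simp: modulus_type_def mono_on_def intro!: add_mono)
  moreover have "continuous_on {0..} (\<lambda>t. \<omega> t + t)"
    using assms by (auto simp: modulus_type_def intro!: continuous_intros)
  ultimately show ?thesis
    using int assms by (simp add: modulus_type_def)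
qed

section \<open>The inverse theorem\<close>

abbreviation smoothness_bound :: "(real \<Rightarrow> real) \<Rightarrow> nat \<Rightarrow> real \<Rightarrow> real" where
  "smoothness_bound \<omega> k t \<equiv> t ^ k * (LINT u:{t..1}|lebesgue. \<omega> u / u ^ (k + 1))
     + (LINT u:{0<..t}|lebesgue. \<omega> u / u)"

context weighted_Lp
begin

text \<open>Positivity of \<open>\<omega> 1\<close> and the doubling condition make every \<open>\<omega>(2^(-j))\<close> positive, so that an approximant
within twice the assumed bound exists at each scale.\<close>

lemma inverse_theorem_positive:
  assumes \<omega>: "modulus_type \<omega>" and pos: "0 < \<omega> 1" and f: "f \<in> L" and n: "1 \<le> n" and m: "0 < m"
    and best: "\<And>r. 1 \<le> r \<Longrightarrow> best_approx p \<mu> r f \<le> m / r ^ n * \<omega> (1 / r)"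
  shows "\<exists>g\<in>L. (f, g) \<in> deriv_graph p \<mu> ^^ n \<and>
    (\<forall>k. \<exists>M>0. \<forall>t h. 0 < t \<and> t \<le> 1 / 2 \<and> 0 \<le> h \<and> h \<le> t \<longrightarrow>
       nm (fdiff k h g) \<le> M * smoothness_bound \<omega> k t)"
proof -
  define W where "W = (\<lambda>j::nat. \<omega> (1 / 2 ^ j))"
  have W: "\<And>j. 0 < W j" "\<And>j. W (Suc j) \<le> W j" "summable W"
    "\<And>k. \<exists>M>0. \<forall>t. 0 < t \<and> t \<le> 1 / 2 \<longrightarrow> (\<exists>N.
        (\<Sum>j. W (j + N)) \<le> M * (LINT u:{0<..t}|lebesgue. \<omega> u / u) \<and>
        1 + (\<Sum>j<N. 2 ^ (k * j) * W j) \<le> M * (LINT u:{t..1}|lebesgue. \<omega> u / u ^ (k + 1)))"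
    unfolding W_def by (fact modulus_type_dyadic[OF \<omega> pos])+
  have "\<exists>G. entire_exp_type (2 ^ j) G \<and> (\<lambda>s. G (of_real s)) \<in> L \<and>
     nm (\<lambda>s. f s - G (of_real s)) \<le> 2 * m * W j / 2 ^ (n * j)" for j :: nat
  proof -
    have "best_approx p \<mu> (2 ^ j) f \<le> m / (2 ^ j) ^ n * W j"
      unfolding W_def by (rule best) simp
    also have "\<dots> = m * W j / 2 ^ (n * j)" by (simp add: power_mult[symmetric] mult.commute)
    also have "\<dots> < 2 * m * W j / 2 ^ (n * j)" using m W(1)[of j] by (simp add: field_simps)
    finally obtain G where "entire_exp_type (2 ^ j) G" "(\<lambda>s. G (of_real s)) \<in> L"
       "nm (\<lambda>s. f s - G (of_real s)) < 2 * m * W j / 2 ^ (n * j)"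
      by (rule near_best_approximation[OF f])
    then show ?thesis by (intro exI[of _ G]) simp
  qed
  then obtain G where G: "\<And>j. entire_exp_type (2 ^ j) (G j)" "\<And>j. (\<lambda>s. G j (of_real s)) \<in> L"
     "\<And>j. nm (\<lambda>s. f s - G j (of_real s)) \<le> 2 * m * W j / 2 ^ (n * j)" by metis
  obtain g where g: "(f, g) \<in> deriv_graph p \<mu> ^^ n" "g \<in> L"
    "\<forall>k. \<exists>M\<ge>0. \<forall>N h. 0 \<le> h \<longrightarrow> h \<le> 1 \<longrightarrow>
       nm (fdiff k h g) \<le> M * ((\<Sum>j. W (j + N)) + h ^ k * (1 + (\<Sum>j<N. 2 ^ (k * j) * W j)))"
  proof -
    have "0 \<le> 2 * m" using m by simp
    from dyadic_synthesis[OF f less_imp_le[OF W(1)] W(2,3) n G(1,2) this G(3)] show ?thesis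
      using that by blast
  qed
  show ?thesis
  proof (intro bexI[of _ g] conjI allI g(1,2))
    fix k
    obtain M where M: "0 \<le> M" "\<And>N h. 0 \<le> h \<Longrightarrow> h \<le> 1 \<Longrightarrow>
       nm (fdiff k h g) \<le> M * ((\<Sum>j. W (j + N)) + h ^ k * (1 + (\<Sum>j<N. 2 ^ (k * j) * W j)))"
      using g(3) by blast
    obtain M' where M': "0 < M'" "\<And>t. 0 < t \<Longrightarrow> t \<le> 1 / 2 \<Longrightarrow> (\<exists>N.
        (\<Sum>j. W (j + N)) \<le> M' * (LINT u:{0<..t}|lebesgue. \<omega> u / u) \<and>
        1 + (\<Sum>j<N. 2 ^ (k * j) * W j) \<le> M' * (LINT u:{t..1}|lebesgue. \<omega> u / u ^ (k + 1)))"
      using W(4)[of k] by blast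
    have "nm (fdiff k h g) \<le> ((M + 1) * M') * smoothness_bound \<omega> k t"
      if t: "0 < t" "t \<le> 1 / 2" and h: "0 \<le> h" "h \<le> t" for t h
    proof -
      define I where "I = (LINT u:{0<..t}|lebesgue. \<omega> u / u)"
      define J where "J = (LINT u:{t..1}|lebesgue. \<omega> u / u ^ (k + 1))"
      obtain N where N: "(\<Sum>j. W (j + N)) \<le> M' * I" "1 + (\<Sum>j<N. 2 ^ (k * j) * W j) \<le> M' * J"
        using M'(2)[OF t] unfolding I_def J_def by blast
      define T where "T = (\<Sum>j. W (j + N))"
      define S where "S = 1 + (\<Sum>j<N. 2 ^ (k * j) * W j)"
      have T0: "0 \<le> T" unfolding T_def by (intro suminf_nonneg) (auto simp: summable_iff_shift W less_imp_le)
      have S0: "0 \<le> S" unfolding S_def using W(1) by (intro add_nonneg_nonneg sum_nonneg) (auto simp: less_imp_le)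
      have "nm (fdiff k h g) \<le> M * (T + h ^ k * S)"
        unfolding T_def S_def using h t by (intro M) auto
      also have "\<dots> \<le> (M + 1) * (T + t ^ k * S)"
        using M(1) h t T0 S0 by (intro mult_mono add_mono mult_right_mono power_mono add_nonneg_nonneg mult_nonneg_nonneg) auto
      also have "\<dots> \<le> (M + 1) * (M' * I + t ^ k * (M' * J))"
        using M(1) t N by (intro mult_left_mono add_mono) (auto simp: T_def S_def)
      also have "\<dots> = ((M + 1) * M') * (t ^ k * J + I)" by (simp add: algebra_simps)
      finally show ?thesis by (simp add: I_def J_def)
    qed
    then show "\<exists>M>0. \<forall>t h. 0 < t \<and> t \<le> 1 / 2 \<and> 0 \<le> h \<and> h \<le> t \<longrightarrow>
       nm (fdiff k h g) \<le> M * smoothness_bound \<omega> k t"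
      using M(1) M'(1) by (intro exI[of _ "(M + 1) * M'"]) auto
  qed
qed

lemma Lp_norm_fdiff_cong_AE:
  assumes g: "g \<in> L" and g': "g' \<in> L" and eq: "AE s in lebesgue. g s = g' s" and h: "0 \<le> h" "h \<le> 1"
  shows "nm (fdiff k h g) = nm (fdiff k h g')"
proof (rule Lp_cong_AE(2))
  show "fdiff k h g' \<in> L" by (rule conjunct1[OF Lp_norm_fdiff_le[OF g' h]])
  show "fdiff k h g \<in> borel_measurable lebesgue" by (rule Lp_measurable[OF conjunct1[OF Lp_norm_fdiff_le[OF g h]]])
  have "AE s in lebesgue. \<forall>j\<in>{0..k}. g (s + real j * h) = g' (s + real j * h)"
    using AE_shift[OF eq] by (intro AE_finite_allI) auto
  then show "AE s in lebesgue. fdiff k h g s = fdiff k h g' s"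
    by eventually_elim (simp add: fdiff_def)
qed

end

theorem corollary5:
  fixes p m :: real and n :: nat
    and \<mu> \<omega> :: "real \<Rightarrow> real" and f :: "real \<Rightarrow> complex"
  assumes "1 \<le> p"
    and "weight \<mu>"
    and "modulus_type \<omega>"
    and "f \<in> Lp_space p \<mu>"
    and "1 \<le> n" and "0 < m"
    and "\<And>r. 1 \<le> r \<Longrightarrow> best_approx p \<mu> r f \<le> m / r ^ n * \<omega> (1 / r)"
  shows "f \<in> weighted_Sobolev p \<mu> n \<and>
    ((\<exists>t\<in>{0..1}. \<omega> t \<noteq> 0) \<longrightarrow>
      (\<forall>g. (f, g) \<in> deriv_graph p \<mu> ^^ n \<longrightarrow>
        (\<forall>k\<ge>1. \<exists>m\<^sub>k>0. \<forall>t. 0 < t \<and> t \<le> 1 / 2 \<longrightarrow>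
          modulus_of_continuity p \<mu> k t g
            \<le> m\<^sub>k * (t ^ k * (LINT u:{t..1}|lebesgue. \<omega> u / u ^ (k + 1))
                    + (LINT u:{0<..t}|lebesgue. \<omega> u / u)))))"
proof -
  interpret weighted_Lp p \<mu> by (rule weighted_Lp.intro) (fact assms(1,2))+
  have mono: "\<omega> s \<le> \<omega> t" if "0 \<le> s" "s \<le> t" for s t
    using assms(3) that unfolding modulus_type_def by (auto intro: mono_onD)
  have \<omega>0: "\<omega> 0 = 0" using assms(3) by (simp add: modulus_type_def)
  \<comment> \<open>The first claim is also made when \<open>\<omega>\<close> vanishes on \<open>[0, 1]\<close>; the larger modulus \<open>\<omega> t + t\<close> is always positive.\<close>
  have sobolev: "f \<in> weighted_Sobolev p \<mu> n"
  proof -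
    have best: "best_approx p \<mu> r f \<le> m / r ^ n * (\<omega> (1 / r) + 1 / r)" if r: "1 \<le> r" for r
    proof (rule order_trans[OF assms(7)[OF r]])
      show "m / r ^ n * \<omega> (1 / r) \<le> m / r ^ n * (\<omega> (1 / r) + 1 / r)"
        using assms(6) r by (intro mult_left_mono) auto
    qed
    have pos: "0 < \<omega> 1 + 1" using mono[of 0 1] \<omega>0 by simp
    obtain g where "(f, g) \<in> deriv_graph p \<mu> ^^ n"
      using inverse_theorem_positive[OF modulus_type_add_id[OF assms(3)] pos assms(4,5,6) best] by blast
    then show ?thesis using assms(4) by (auto simp: weighted_Sobolev_def)
  qed
  have "\<exists>m\<^sub>k>0. \<forall>t. 0 < t \<and> t \<le> 1 / 2 \<longrightarrow> modulus_of_continuity p \<mu> k t g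
            \<le> m\<^sub>k * smoothness_bound \<omega> k t"
    if nz: "\<exists>t\<in>{0..1}. \<omega> t \<noteq> 0" and g: "(f, g) \<in> deriv_graph p \<mu> ^^ n" for g k
  proof -
    obtain t where "t \<in> {0..1}" "\<omega> t \<noteq> 0" using nz by blast
    \<comment> \<open>By monotonicity a nonzero value anywhere on \<open>[0, 1]\<close> makes \<open>\<omega> 1\<close> positive.\<close>
    then have pos: "0 < \<omega> 1" using mono[of 0 t] mono[of t 1] \<omega>0 by force
    obtain g' where g': "(f, g') \<in> deriv_graph p \<mu> ^^ n" "g' \<in> L"
      "\<forall>k. \<exists>M>0. \<forall>t h. 0 < t \<and> t \<le> 1 / 2 \<and> 0 \<le> h \<and> h \<le> t \<longrightarrow>
       nm (fdiff k h g') \<le> M * smoothness_bound \<omega> k t"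
      using inverse_theorem_positive[OF assms(3) pos assms(4,5,6,7)] by blast
    obtain M where M: "0 < M" "\<And>t h. 0 < t \<Longrightarrow> t \<le> 1 / 2 \<Longrightarrow> 0 \<le> h \<Longrightarrow> h \<le> t \<Longrightarrow>
       nm (fdiff k h g') \<le> M * smoothness_bound \<omega> k t"
      using g'(3) by blast
    have gL: "g \<in> L" by (rule deriv_graph_relpow_range[OF g assms(5)])
    have eq: "AE s in lebesgue. g s = g' s" by (rule deriv_graph_relpow_unique[OF g g'(1)]) simp
    have "modulus_of_continuity p \<mu> k t g \<le> M * smoothness_bound \<omega> k t" if t: "0 < t" "t \<le> 1 / 2" for t
      unfolding modulus_of_continuity_def fdiff_def[symmetric]
    proof (rule cSUP_least)
      show "{0..t} \<noteq> {}" using t by simp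
      fix h assume h: "h \<in> {0..t}"
      then have "nm (fdiff k h g) = nm (fdiff k h g')"
        using t by (intro Lp_norm_fdiff_cong_AE[OF gL g'(2) eq]) auto
      then show "nm (fdiff k h g) \<le> M * smoothness_bound \<omega> k t"
        using M(2)[OF t] h by simp
    qed
    with M(1) show ?thesis by blast
  qed
  with sobolev show ?thesis by blast
qed

end
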